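(* For every fixed $k\in\mathbb N$ the following problem is decidable: given finite alphabets $A,B$ and a timed automaton with $\varepsilon$-transitions recognising (with Büchi acceptance) a timed $\omega$-language $W\subseteq (A\times B\times\mathbb R_{\ge0})^\omega$ over the alphabet $A\times B$, decide whether there exists $m\in\mathbb N$ such that Player II has a winning $k,m$-controller in the timed synthesis game $G(A,B,W)$.
   Context: Timed words: sequences $(a_1,t_1)(a_2,t_2)\cdots$ with $0\le t_1\le t_2\le\cdots$ reals. Clock constraints over clocks $X$: Boolean combinations of $x\sim z$, $x-y\sim z$ ($z\in\mathbb Z$, $\sim\in\{<,\le,=,\ge,>\}$). A timed automaton with $\varepsilon$-transitions $(\Sigma,L,X,I,F,\Delta)$ has rules $(p,a,\varphi,Y,q)$, $a\in\Sigma\cup\{\varepsilon\}$, taken after time elapse when the valuation satisfies $\varphi$, resetting $Y$; runs start in $I$ with all clocks $0$; its timed $\omega$-language consists of the infinite timed words over $\Sigma$ obtained by deleting $\varepsilon$-letters from words of runs visiting $F$ infinitely often (keeping only infinite results). For clocks $X$ and $m\in\mathbb N$, valuations are $(X,m)$-region equivalent if they satisfy the same constraints over $X$ with constants of absolute value $\le m$; classes are regions. Game $G(A,B,W)$: in rounds $i=1,2,\dots$ Player I picks $a_i\in A$, $t_i\ge t_{i-1}$ ($t_0=0$), Player II answers $b_i\in B$; Player I wins iff $(a_1,b_1,t_1)(a_2,b_2,t_2)\cdots\in W$. A $k,m$-controller is $(A,B,L,\ell_0,\delta)$ with finite memory $L$, $\ell_0\in L$, $k$ clocks $X$, $\delta:L\times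 A\times \mathrm{Regions}(X,m)\to L\times B\times 2^X$; from $(\ell_n,\mu_n)$ (initially $\ell_0$ and all clocks $0$), on $(a_{n+1},t_{n+1})$ with $\nu=\mu_n+(t_{n+1}-t_n)$ and $\delta(\ell_n,a_{n+1},[\nu])=(\ell',b,Y)$ it answers $b$ and moves to $\ell'$ and $\nu$ with $Y$ reset to $0$. It is winning if no consistent infinite play lies in $W$. *)

theory Defs
  imports Complex_Main "HOL-Library.Nat_Bijection"
begin

datatype recf = RZ | RS | RProj nat | RComp recf "recf list" | RPrim recf recf | RMin recf

inductive reval :: "recf \<Rightarrow> nat list \<Rightarrow> nat \<Rightarrow> bool" where
  rz: "reval RZ xs 0"
| rs: "reval RS (x # xs) (Suc x)"
| rproj: "i < length xs \<Longrightarrow> reval (RProj i) xs (xs ! i)"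
| rcomp: "length ys = length gs \<Longrightarrow> (\<forall>i < length gs. reval (gs ! i) xs (ys ! i))
          \<Longrightarrow> reval f ys z \<Longrightarrow> reval (RComp f gs) xs z"
| rprim0: "reval f xs z \<Longrightarrow> reval (RPrim f g) (0 # xs) z"
| rprimS: "reval (RPrim f g) (n # xs) y \<Longrightarrow> reval g (n # y # xs) z
          \<Longrightarrow> reval (RPrim f g) (Suc n # xs) z"
| rmin: "reval f (n # xs) 0 \<Longrightarrow> (\<forall>i < n. \<exists>y. reval f (i # xs) y \<and> 0 < y)
          \<Longrightarrow> reval (RMin f) xs n"

text \<open>A property P of instances (encoded injectively and effectively into nat by enc),
  restricted to the valid instances V, is decidable if some recursive function
  computes its characteristic function on (codes of) valid instances.\<close>
definition decidable_on :: "('i \<Rightarrow> nat) \<Rightarrow> ('i \<Rightarrow> bool) \<Rightarrow> ('i \<Rightarrow> bool) \<Rightarrow> bool" where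
  "decidable_on enc V P \<longleftrightarrow>
     (\<exists>f. \<forall>x. V x \<longrightarrow> reval f [enc x] (if P x then 1 else 0))"

datatype cmp = CLt | CLe | CEq | CGe | CGt

datatype cc = CTrue | Atom1 nat cmp int | Atom2 nat nat cmp int
            | CNot cc | CAnd cc cc | COr cc cc

type_synonym valuation = "nat \<Rightarrow> real"

fun cmp_sem :: "cmp \<Rightarrow> real \<Rightarrow> real \<Rightarrow> bool" where
  "cmp_sem CLt a b = (a < b)"
| "cmp_sem CLe a b = (a \<le> b)"
| "cmp_sem CEq a b = (a = b)"
| "cmp_sem CGe a b = (a \<ge> b)"
| "cmp_sem CGt a b = (a > b)"

fun sat :: "cc \<Rightarrow> valuation \<Rightarrow> bool" where
  "sat CTrue v = True"
| "sat (Atom1 x c z) v = cmp_sem c (v x) (of_int z)"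
| "sat (Atom2 x y c z) v = cmp_sem c (v x - v y) (of_int z)"
| "sat (CNot p) v = (\<not> sat p v)"
| "sat (CAnd p q) v = (sat p v \<and> sat q v)"
| "sat (COr p q) v = (sat p v \<or> sat q v)"

fun cc_clocks :: "cc \<Rightarrow> nat set" where
  "cc_clocks CTrue = {}"
| "cc_clocks (Atom1 x c z) = {x}"
| "cc_clocks (Atom2 x y c z) = {x, y}"
| "cc_clocks (CNot p) = cc_clocks p"
| "cc_clocks (CAnd p q) = cc_clocks p \<union> cc_clocks q"
| "cc_clocks (COr p q) = cc_clocks p \<union> cc_clocks q"

fun cc_consts :: "cc \<Rightarrow> int set" where
  "cc_consts CTrue = {}"
| "cc_consts (Atom1 x c z) = {z}"
| "cc_consts (Atom2 x y c z) = {z}"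
| "cc_consts (CNot p) = cc_consts p"
| "cc_consts (CAnd p q) = cc_consts p \<union> cc_consts q"
| "cc_consts (COr p q) = cc_consts p \<union> cc_consts q"

text \<open>Letters are pairs (a,b) of natural numbers; epsilon is None.
  A rule (p, lab, guard, Y, q).\<close>
type_synonym rule = "nat \<times> (nat \<times> nat) option \<times> cc \<times> nat list \<times> nat"

record ta =
  locs   :: "nat list"
  clks   :: "nat list"
  inits  :: "nat list"
  finals :: "nat list"
  rules  :: "rule list"

definition r_src :: "rule \<Rightarrow> nat" where "r_src r = fst r"
definition r_lab :: "rule \<Rightarrow> (nat \<times> nat) option" where "r_lab r = fst (snd r)"
definition r_guard :: "rule \<Rightarrow> cc" where "r_guard r = fst (snd (snd r))"
definition r_resets :: "rule \<Rightarrow> nat list" where "r_resets r = fst (snd (snd (snd r)))"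
definition r_tgt :: "rule \<Rightarrow> nat" where "r_tgt r = snd (snd (snd (snd r)))"

definition wf_ta :: "nat list \<Rightarrow> nat list \<Rightarrow> ta \<Rightarrow> bool" where
  "wf_ta A B T \<longleftrightarrow>
     set (inits T) \<subseteq> set (locs T) \<and> set (finals T) \<subseteq> set (locs T) \<and>
     (\<forall>r \<in> set (rules T).
        r_src r \<in> set (locs T) \<and> r_tgt r \<in> set (locs T) \<and>
        (\<forall>ab. r_lab r = Some ab \<longrightarrow> ab \<in> set A \<times> set B) \<and>
        cc_clocks (r_guard r) \<subseteq> set (clks T) \<and> set (r_resets r) \<subseteq> set (clks T))"

fun last_reset :: "(nat \<Rightarrow> rule) \<Rightarrow> (nat \<Rightarrow> real) \<Rightarrow> nat \<Rightarrow> nat \<Rightarrow> real" where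
  "last_reset rs ts 0 x = 0"
| "last_reset rs ts (Suc i) x =
     (if x \<in> set (r_resets (rs i)) then ts i else last_reset rs ts i x)"

definition run_val :: "(nat \<Rightarrow> rule) \<Rightarrow> (nat \<Rightarrow> real) \<Rightarrow> nat \<Rightarrow> valuation" where
  "run_val rs ts i = (\<lambda>x. ts i - last_reset rs ts i x)"

text \<open>Infinite run: step i takes rule rs i at absolute time ts i.
  Starts in an initial location with all clocks 0 at time 0.\<close>
definition is_run :: "ta \<Rightarrow> (nat \<Rightarrow> rule) \<Rightarrow> (nat \<Rightarrow> real) \<Rightarrow> bool" where
  "is_run T rs ts \<longleftrightarrow>
     r_src (rs 0) \<in> set (inits T) \<and> 0 \<le> ts 0 \<and>
     (\<forall>i. rs i \<in> set (rules T)) \<and>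
     (\<forall>i. r_tgt (rs i) = r_src (rs (Suc i))) \<and>
     (\<forall>i. ts i \<le> ts (Suc i)) \<and>
     (\<forall>i. sat (r_guard (rs i)) (run_val rs ts i))"

definition is_accepting :: "ta \<Rightarrow> (nat \<Rightarrow> rule) \<Rightarrow> bool" where
  "is_accepting T rs \<longleftrightarrow> (\<exists>\<^sub>\<infinity>i. r_tgt (rs i) \<in> set (finals T))"

type_synonym tword = "nat \<Rightarrow> (nat \<times> nat) \<times> real"

text \<open>Timed omega-language (Buechi acceptance): delete the epsilon steps of an accepting
  run, keeping the result only if it is infinite. The strictly monotone enumeration e
  lists exactly the indices of non-epsilon steps.\<close>
definition ta_lang :: "ta \<Rightarrow> tword set" where
  "ta_lang T = {w. \<exists>rs ts e. is_run T rs ts \<and> is_accepting T rs \<and>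
                      strict_mono e \<and> range e = {i. r_lab (rs i) \<noteq> None} \<and>
                      (\<forall>n. w n = (the (r_lab (rs (e n))), ts (e n)))}"

definition region_equiv :: "nat set \<Rightarrow> nat \<Rightarrow> valuation \<Rightarrow> valuation \<Rightarrow> bool" where
  "region_equiv X m v v' \<longleftrightarrow>
     (\<forall>\<phi>. cc_clocks \<phi> \<subseteq> X \<and> (\<forall>z \<in> cc_consts \<phi>. \<bar>z\<bar> \<le> int m)
           \<longrightarrow> (sat \<phi> v \<longleftrightarrow> sat \<phi> v'))"

text \<open>A controller: memory set L (finite, w.l.o.g. a set of naturals), initial memory l0,
  and a transition function delta on memory, Player I letters and valuations which
  depends only on the (X,m)-region of the valuation, i.e. a function on regions.\<close>
type_synonym ctrl_fun = "nat \<Rightarrow> nat \<Rightarrow> valuation \<Rightarrow> nat \<times> nat \<times> nat set"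

definition is_controller ::
  "nat list \<Rightarrow> nat list \<Rightarrow> nat \<Rightarrow> nat \<Rightarrow> nat set \<Rightarrow> nat \<Rightarrow> ctrl_fun \<Rightarrow> bool" where
  "is_controller A B k m L l0 \<delta> \<longleftrightarrow>
     finite L \<and> l0 \<in> L \<and>
     (\<forall>l \<in> L. \<forall>a \<in> set A. \<forall>v.
        (let (l', b, Y) = \<delta> l a v in l' \<in> L \<and> b \<in> set B \<and> Y \<subseteq> {..<k})) \<and>
     (\<forall>l \<in> L. \<forall>a \<in> set A. \<forall>v v'. region_equiv {..<k} m v v' \<longrightarrow> \<delta> l a v = \<delta> l a v')"

text \<open>Configuration (l_n, mu_n) of the controller after the first n rounds of a play in
  which Player I plays letters a and times t (rounds indexed from 0).\<close>
fun ctrl_conf :: "ctrl_fun \<Rightarrow> nat \<Rightarrow> (nat \<Rightarrow> nat) \<Rightarrow> (nat \<Rightarrow> real) \<Rightarrow> nat \<Rightarrow> nat \<times> valuation" where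
  "ctrl_conf \<delta> l0 a t 0 = (l0, (\<lambda>x. 0))"
| "ctrl_conf \<delta> l0 a t (Suc n) =
     (let (l, \<mu>) = ctrl_conf \<delta> l0 a t n;
          \<nu> = (\<lambda>x. \<mu> x + (t n - (if n = 0 then 0 else t (n - 1))));
          (l', b, Y) = \<delta> l (a n) \<nu>
      in (l', (\<lambda>x. if x \<in> Y then 0 else \<nu> x)))"

definition ctrl_val :: "ctrl_fun \<Rightarrow> nat \<Rightarrow> (nat \<Rightarrow> nat) \<Rightarrow> (nat \<Rightarrow> real) \<Rightarrow> nat \<Rightarrow> valuation" where
  "ctrl_val \<delta> l0 a t n =
     (\<lambda>x. snd (ctrl_conf \<delta> l0 a t n) x + (t n - (if n = 0 then 0 else t (n - 1))))"

definition ctrl_answer :: "ctrl_fun \<Rightarrow> nat \<Rightarrow> (nat \<Rightarrow> nat) \<Rightarrow> (nat \<Rightarrow> real) \<Rightarrow> nat \<Rightarrow> nat" where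
  "ctrl_answer \<delta> l0 a t n =
     fst (snd (\<delta> (fst (ctrl_conf \<delta> l0 a t n)) (a n) (ctrl_val \<delta> l0 a t n)))"

definition winning_controller ::
  "nat list \<Rightarrow> nat list \<Rightarrow> tword set \<Rightarrow> nat \<Rightarrow> nat \<Rightarrow> nat set \<Rightarrow> nat \<Rightarrow> ctrl_fun \<Rightarrow> bool" where
  "winning_controller A B W k m L l0 \<delta> \<longleftrightarrow>
     is_controller A B k m L l0 \<delta> \<and>
     (\<forall>a t. (\<forall>n. a n \<in> set A) \<and> 0 \<le> t 0 \<and> (\<forall>n. t n \<le> t (Suc n)) \<longrightarrow>
        (\<lambda>n. ((a n, ctrl_answer \<delta> l0 a t n), t n)) \<notin> W)"

definition has_winning_controller :: "nat list \<Rightarrow> nat list \<Rightarrow> tword set \<Rightarrow> nat \<Rightarrow> nat \<Rightarrow> bool" where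
  "has_winning_controller A B W k m \<longleftrightarrow> (\<exists>L l0 \<delta>. winning_controller A B W k m L l0 \<delta>)"

definition enc_cmp :: "cmp \<Rightarrow> nat" where
  "enc_cmp c = (case c of CLt \<Rightarrow> 0 | CLe \<Rightarrow> 1 | CEq \<Rightarrow> 2 | CGe \<Rightarrow> 3 | CGt \<Rightarrow> 4)"

fun enc_cc :: "cc \<Rightarrow> nat" where
  "enc_cc CTrue = list_encode [0]"
| "enc_cc (Atom1 x c z) = list_encode [1, x, enc_cmp c, int_encode z]"
| "enc_cc (Atom2 x y c z) = list_encode [2, x, y, enc_cmp c, int_encode z]"
| "enc_cc (CNot p) = list_encode [3, enc_cc p]"
| "enc_cc (CAnd p q) = list_encode [4, enc_cc p, enc_cc q]"
| "enc_cc (COr p q) = list_encode [5, enc_cc p, enc_cc q]"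

definition enc_lab :: "(nat \<times> nat) option \<Rightarrow> nat" where
  "enc_lab l = (case l of None \<Rightarrow> 0 | Some ab \<Rightarrow> Suc (prod_encode ab))"

definition enc_rule :: "rule \<Rightarrow> nat" where
  "enc_rule r = list_encode [r_src r, enc_lab (r_lab r), enc_cc (r_guard r),
                             list_encode (r_resets r), r_tgt r]"

definition enc_ta :: "ta \<Rightarrow> nat" where
  "enc_ta T = list_encode [list_encode (locs T), list_encode (clks T), list_encode (inits T),
                           list_encode (finals T), list_encode (map enc_rule (rules T))]"

type_synonym problem_inst = "nat list \<times> nat list \<times> ta"

definition enc_instance :: "problem_inst \<Rightarrow> nat" where
  "enc_instance I = (case I of (A, B, T) \<Rightarrow>
     list_encode [list_encode A, list_encode B, enc_ta T])"

definition valid_instance :: "problem_inst \<Rightarrow> bool" where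
  "valid_instance I = (case I of (A, B, T) \<Rightarrow> wf_ta A B T)"

definition synth_problem :: "nat \<Rightarrow> problem_inst \<Rightarrow> bool" where
  "synth_problem k I = (case I of (A, B, T) \<Rightarrow>
     (\<exists>m. has_winning_controller A B (ta_lang T) k m))"

end

theory Submission
  imports Defs "HOL-Library.Infinite_Set"
begin

text \<open>The controller clocks are replaced by clocks that tick: Player I announces when an active clock reaches its next
  integer value, Player II may declare a clock expired, and she loses if some clock ticks forever without being reset
  or expired.  In this game the bound m is no longer mentioned, since a finite-memory strategy keeps every clock active
  for boundedly many ticks, and the region construction turns the objective of Player I into a finite nondeterministic
  Buechi automaton.

  Player II wins if and only if there is a family of budget vectors, assigning to each automaton state the number of
  accepting visits still permitted, from which she can always respond without exceeding the budget.  To bound the budgets,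
  keep as memory an age-ordered list of breakpoint sets (C, D), where D collects the runs in C that were accepting
  since the last time D = C, and where D is copied to the end of the list as a new set to be tracked.  Along an accepted
  word some entry is eventually never removed and satisfies D = C infinitely often.  Choosing for every memory value a
  budget vector whose maxima over the entries are lexicographically minimal, this entry would yield an infinite descent.
  Hence the memory suffices for winning, and the budgets are bounded by the number of states of the product.  So it
  suffices to search the finitely many families of bounded budget vectors.\<close>

text \<open>For a fixed m the regions of the controller clocks form a finite alphabet; the obstacle
  is that m is quantified and nothing bounds it in advance. Ticks remove it from the alphabet, and m
  returns only as the number of ticks a clock may survive. Forbidding endless ticking is itself a
  co-Buechi condition, so it is added to the objective as extra automaton states. Because W is given
  by a nondeterministic automaton, Player II has to keep all runs at finitely many accepting visits.
  Budgets express this without determinising, and they give m back: the budget of the state watching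
  a clock pays for each of its ticks.

  What needs an argument is a computable bound on the budgets. Every winning strategy whose finite
  memory has known size gives one, namely the largest number of marks on a path in the product of
  memory and states. Hence a memory is needed whose size depends on the number of states alone,
  while the choices attached to it may come from arbitrarily large budgets; lexicographic minimality
  selects these choices from the memory alone, independently of the history.\<close>

section \<open>Computability over encoded data\<close>

definition cf :: "nat \<Rightarrow> (nat list \<Rightarrow> nat) \<Rightarrow> bool" where
  "cf n F \<longleftrightarrow> (\<exists>r. \<forall>xs. length xs = n \<longrightarrow> reval r xs (F xs))"

lemma cf_eq: "cf n F \<Longrightarrow> (\<And>xs. length xs = n \<Longrightarrow> F xs = G xs) \<Longrightarrow> cf n G"
  unfolding cf_def by metis

lemma cf_zero: "cf n (\<lambda>xs. 0)"
  unfolding cf_def using rz by blast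

lemma cf_proj: "i < n \<Longrightarrow> cf n (\<lambda>xs. xs ! i)"
  unfolding cf_def using rproj by metis

lemma cf_comp:
  assumes F: "cf (length Gs) F" and G: "\<And>G. G \<in> set Gs \<Longrightarrow> cf n G"
  shows "cf n (\<lambda>xs. F (map (\<lambda>G. G xs) Gs))"
proof -
  obtain r where r: "\<And>ys. length ys = length Gs \<Longrightarrow> reval r ys (F ys)"
    using F unfolding cf_def by blast
  obtain s where s: "\<And>G xs. G \<in> set Gs \<Longrightarrow> length xs = n \<Longrightarrow> reval (s G) xs (G xs)"
    using G unfolding cf_def by metis
  have "reval (RComp r (map s Gs)) xs (F (map (\<lambda>G. G xs) Gs))" if "length xs = n" for xs
    by (rule rcomp[where ys = "map (\<lambda>G. G xs) Gs"]) (use r s that in auto)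
  then show ?thesis unfolding cf_def by blast
qed

lemma cf_Suc: assumes "cf n F" shows "cf n (\<lambda>xs. Suc (F xs))"
proof -
  have "cf 1 (\<lambda>xs. Suc (xs ! 0))"
    unfolding cf_def by (rule exI[of _ RS]) (auto simp: length_Suc_conv intro: rs)
  from cf_comp[of "[F]" "\<lambda>xs. Suc (xs ! 0)" n] this assms show ?thesis by simp
qed

text \<open>The number of iterations is itself a function of the arguments: \<open>RPrim\<close> is
  composed with \<open>M\<close> and the projections. As in \<open>RPrim\<close>, the step receives
  counter, previous value and then the parameters.\<close>

lemma cf_rec:
  assumes F: "cf n F" and G: "cf (Suc (Suc n)) G" and M: "cf n M"
  shows "cf n (\<lambda>xs. rec_nat (F xs) (\<lambda>i y. G (i # y # xs)) (M xs))"
proof -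
  obtain r where r: "\<And>ys. length ys = n \<Longrightarrow> reval r ys (F ys)"
    using F unfolding cf_def by blast
  obtain s where s: "\<And>ys. length ys = Suc (Suc n) \<Longrightarrow> reval s ys (G ys)"
    using G unfolding cf_def by blast
  have R: "reval (RPrim r s) (m # xs) (rec_nat (F xs) (\<lambda>i y. G (i # y # xs)) m)"
    if "length xs = n" for m xs
  proof (induction m)
    case 0 then show ?case using r[OF that] by (auto intro: rprim0)
  next
    case (Suc m)
    have "reval s (m # rec_nat (F xs) (\<lambda>i y. G (i # y # xs)) m # xs)
        (G (m # rec_nat (F xs) (\<lambda>i y. G (i # y # xs)) m # xs))" using s that by simp
    from rprimS[OF Suc this] show ?case by simp
  qed
  have 1: "cf (Suc n) (\<lambda>ys. rec_nat (F (tl ys)) (\<lambda>i y. G (i # y # tl ys)) (hd ys))"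
    unfolding cf_def by (rule exI[of _ "RPrim r s"]) (auto simp: length_Suc_conv intro: R)
  have 2: "map (\<lambda>G. G xs) (map (\<lambda>i xs. xs ! i) [0..<n]) = xs" if "length xs = n" for xs :: "nat list"
    using that by (intro nth_equalityI) auto
  have 3: "cf n G" if "G \<in> set (M # map (\<lambda>i xs. xs ! i) [0..<n])" for G
    using that M by (auto intro: cf_proj)
  show ?thesis
    by (rule cf_eq[OF cf_comp[of "M # map (\<lambda>i xs. xs ! i) [0..<n]"
      "\<lambda>ys. rec_nat (F (tl ys)) (\<lambda>i y. G (i # y # tl ys)) (hd ys)" n]]) (use 1 2 3 in \<open>auto simp: o_def\<close>)
qed

text \<open>Inside a recursion step, counter and accumulator occupy the first two positions; this
  makes functions of the parameters available there.\<close>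

lemma cf_drop2: assumes "cf n G" shows "cf (Suc (Suc n)) (\<lambda>ys. G (drop 2 ys))"
proof -
  have 1: "map (\<lambda>G. G xs) (map (\<lambda>i xs. xs ! i) [2..<Suc (Suc n)]) = drop 2 xs"
    if "length xs = Suc (Suc n)" for xs :: "nat list"
    using that by (intro nth_equalityI) (auto simp del: upt_Suc)
  show ?thesis
    by (rule cf_eq[OF cf_comp[of "map (\<lambda>i xs. xs ! i) [2..<Suc (Suc n)]" G]])
      (use assms 1 in \<open>auto intro: cf_proj simp del: upt_Suc simp: o_def\<close>)
qed

lemma cf_rec':
  assumes "cf n F" "cf n M" "cf (Suc (Suc n)) G" "\<And>xs. length xs = n \<Longrightarrow> rec_nat (F xs) (\<lambda>i y. G (i # y # xs)) (M xs) = H xs"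
  shows "cf n H"
  by (rule cf_eq[OF cf_rec[OF assms(1,3,2)]]) (use assms(4) in auto)

lemma cf_const: "cf n (\<lambda>xs. c)"
  by (induction c) (auto intro: cf_zero cf_Suc)

lemma cf_add: assumes "cf n F" "cf n G" shows "cf n (\<lambda>xs. F xs + G xs)"
proof (rule cf_rec'[OF assms])
  show "cf (Suc (Suc n)) (\<lambda>ys. Suc (ys ! 1))" by (intro cf_Suc cf_proj) simp
  show "rec_nat (F xs) (\<lambda>i y. Suc ((i # y # xs) ! 1)) (G xs) = F xs + G xs" for xs
    by (induction "G xs" arbitrary: G) (simp, metis One_nat_def add_Suc_right nth_Cons_0 nth_Cons_Suc old.nat.simps(7))
qed

lemma cf_pred: assumes "cf n F" shows "cf n (\<lambda>xs. F xs - 1)"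
proof (rule cf_rec'[OF cf_zero assms])
  show "cf (Suc (Suc n)) (\<lambda>ys. ys ! 0)" by (intro cf_proj) simp
  show "rec_nat 0 (\<lambda>i y. (i # y # xs) ! 0) (F xs) = F xs - 1" for xs by (cases "F xs") auto
qed

lemma cf_sub: assumes "cf n F" "cf n G" shows "cf n (\<lambda>xs. F xs - G xs)"
proof (rule cf_rec'[OF assms])
  show "cf (Suc (Suc n)) (\<lambda>ys. ys ! 1 - 1)" by (intro cf_pred cf_proj) simp
  have "rec_nat a (\<lambda>i y. y - 1) b = a - b" for a b :: nat by (induction b) auto
  then show "rec_nat (F xs) (\<lambda>i y. (i # y # xs) ! 1 - 1) (G xs) = F xs - G xs" for xs by simp
qed

lemma cf_mult: assumes "cf n F" "cf n G" shows "cf n (\<lambda>xs. F xs * G xs)"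
proof (rule cf_rec'[OF cf_zero assms(1)])
  show "cf (Suc (Suc n)) (\<lambda>ys. ys ! 1 + G (drop 2 ys))" by (intro cf_add cf_proj cf_drop2 assms) simp
  have "rec_nat 0 (\<lambda>i y. y + b) a = a * b" for a b :: nat by (induction a) auto
  then show "rec_nat 0 (\<lambda>i y. (i # y # xs) ! 1 + G (drop 2 (i # y # xs))) (F xs) = F xs * G xs" for xs by simp
qed

lemma cf_triangle: assumes "cf n F" shows "cf n (\<lambda>xs. triangle (F xs))"
proof (rule cf_rec'[OF cf_zero assms(1)])
  show "cf (Suc (Suc n)) (\<lambda>ys. ys ! 1 + Suc (ys ! 0))" by (intro cf_add cf_Suc cf_proj) simp_all
  have "rec_nat 0 (\<lambda>i y. y + Suc i) a = triangle a" for a :: nat by (induction a) auto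
  then show "rec_nat 0 (\<lambda>i y. (i # y # xs) ! 1 + Suc ((i # y # xs) ! 0)) (F xs) = triangle (F xs)" for xs by simp
qed

lemma cf_prod_encode: assumes "cf n F" "cf n G" shows "cf n (\<lambda>xs. prod_encode (F xs, G xs))"
  unfolding prod_encode_def by (simp add: cf_add cf_triangle assms)

lemma triangle_mono: "a \<le> b \<Longrightarrow> triangle a \<le> triangle b"
  by (induction b) (auto simp: le_Suc_eq)

lemma triangle_ge: "n \<le> triangle n"
  by (induction n) auto

text \<open>The index of the diagonal containing z in Cantor's enumeration. Truncated subtraction
  serves as the test \<open>triangle (Suc i)\<close> \<le> z, and the sum counts the i passing it; z
  iterations are enough because n \<le> \<open>triangle n\<close>.\<close>

definition tri_root :: "nat \<Rightarrow> nat" where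
  "tri_root z = rec_nat 0 (\<lambda>i y. y + (1 - (triangle (Suc i) - z))) z"

lemma tri_root_prod_encode: "tri_root (prod_encode (a, b)) = a + b"
proof -
  let ?z = "triangle (a + b) + a"
  have *: "triangle (Suc i) \<le> ?z \<longleftrightarrow> i < a + b" for i
  proof
    assume "triangle (Suc i) \<le> ?z"
    moreover have "?z < triangle (Suc (a + b))" by simp
    ultimately have "\<not> triangle (Suc (a + b)) \<le> triangle (Suc i)" by linarith
    then have "\<not> Suc (a + b) \<le> Suc i" using triangle_mono by blast
    then show "i < a + b" by simp
  next
    assume "i < a + b"
    then have "triangle (Suc i) \<le> triangle (a + b)" by (intro triangle_mono) simp
    then show "triangle (Suc i) \<le> ?z" by (rule trans_le_add1)
  qed
  have "1 - (x - z) = (of_bool (x \<le> z) :: nat)" for x z :: nat by (cases "x \<le> z") auto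
  then have **: "1 - (triangle (Suc i) - ?z) = of_bool (i < a + b)" for i
    by (simp only: *)
  have "rec_nat 0 (\<lambda>i y. y + (1 - (triangle (Suc i) - ?z))) n = min n (a + b)" for n
    unfolding ** by (induction n) auto
  moreover have "a + b \<le> ?z" using triangle_ge[of "a + b"] by simp
  ultimately show ?thesis by (simp add: tri_root_def prod_encode_def del: triangle_Suc)
qed

lemma cf_tri_root: assumes "cf n F" shows "cf n (\<lambda>xs. tri_root (F xs))"
proof (rule cf_rec'[OF cf_zero assms])
  show "cf (Suc (Suc n)) (\<lambda>ys. ys ! 1 + (1 - (triangle (Suc (ys ! 0)) - F (drop 2 ys))))"
    by (intro cf_add cf_sub cf_const cf_triangle cf_Suc cf_proj cf_drop2 assms) simp_all
qed (simp add: tri_root_def)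

lemma cf_fst: assumes "cf n F" shows "cf n (\<lambda>xs. fst (prod_decode (F xs)))"
proof (rule cf_eq)
  show "cf n (\<lambda>xs. F xs - triangle (tri_root (F xs)))"
    by (intro cf_sub cf_triangle cf_tri_root assms)
  have "z - triangle (tri_root z) = fst (prod_decode z)" for z
  proof -
    obtain a b where z: "prod_decode z = (a, b)" by (cases "prod_decode z")
    then have "z = prod_encode (a, b)" by (metis prod_decode_inverse)
    moreover have "prod_encode (a, b) - triangle (a + b) = a" by (simp add: prod_encode_def)
    ultimately show ?thesis using z by (simp only: tri_root_prod_encode fst_conv)
  qed
  then show "F xs - triangle (tri_root (F xs)) = fst (prod_decode (F xs))" for xs by simp
qed

lemma cf_snd: assumes "cf n F" shows "cf n (\<lambda>xs. snd (prod_decode (F xs)))"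
proof (rule cf_eq)
  show "cf n (\<lambda>xs. tri_root (F xs) - fst (prod_decode (F xs)))"
    by (intro cf_sub cf_fst cf_tri_root assms)
  have "tri_root z - fst (prod_decode z) = snd (prod_decode z)" for z
  proof -
    obtain a b where z: "prod_decode z = (a, b)" by (cases "prod_decode z")
    then have "z = prod_encode (a, b)" by (metis prod_decode_inverse)
    then show ?thesis using z by (simp add: tri_root_prod_encode)
  qed
  then show "tri_root (F xs) - fst (prod_decode (F xs)) = snd (prod_decode (F xs))" for xs by simp
qed

text \<open>A bijection with the naturals is demanded, so that every number is the code of some
  object and functions on codes need no domain conditions.\<close>

class enc =
  fixes en :: "'a \<Rightarrow> nat" and de :: "nat \<Rightarrow> 'a"
  assumes de_en [simp]: "de (en x) = x" and en_de [simp]: "en (de n) = n"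

instantiation nat :: enc begin
definition "en (n::nat) = n"
definition "de n = (n::nat)"
instance by standard (simp_all add: en_nat_def de_nat_def)
end

instantiation prod :: (enc, enc) enc begin
definition "en p = prod_encode (en (fst p), en (snd p))"
definition "de n = (de (fst (prod_decode n)), de (snd (prod_decode n)))"
instance by standard (simp_all add: en_prod_def de_prod_def)
end

instantiation list :: (enc) enc begin
definition "en xs = list_encode (map en xs)"
definition "de n = map de (list_decode n)"
instance by standard (simp_all add: en_list_def de_list_def o_def)
end

definition computable :: "('a::enc \<Rightarrow> 'b::enc) \<Rightarrow> bool" where
  "computable f \<longleftrightarrow> cf 1 (\<lambda>xs. en (f (de (xs ! 0))))"

definition dec :: "('a::enc \<Rightarrow> bool) \<Rightarrow> bool" where
  "dec P \<longleftrightarrow> computable (\<lambda>x. of_bool (P x) :: nat)"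

text \<open>The rules are stated for pointwise compositions, so \<open>intro comp\<close> walks
  through the body of a definition. Under a binder an argument \<open>f x\<close> turns into
  something like \<open>f (fst p)\<close>; instances of \<open>c_comp\<close> deal with
  that.\<close>

named_theorems comp

lemma c_id [comp]: "computable (\<lambda>x. x)"
  unfolding computable_def by (simp add: cf_proj)

lemma c_const [comp]: "computable (\<lambda>x. c)"
  unfolding computable_def by (rule cf_const)

lemma cf_computable:
  assumes "computable f" "cf n G" shows "cf n (\<lambda>xs. en (f (de (G xs))))"
  using cf_comp[of "[G]" "\<lambda>xs. en (f (de (xs ! 0)))" n] assms unfolding computable_def by simp

lemma c_comp: assumes "computable f" "computable g" shows "computable (\<lambda>x. f (g x))"
  using cf_computable[OF assms(1) assms(2)[unfolded computable_def]] unfolding computable_def by simp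

lemma c_pair [comp]: assumes "computable f" "computable g" shows "computable (\<lambda>x. (f x, g x))"
  using assms unfolding computable_def by (simp add: en_prod_def cf_prod_encode)

lemma c_fst [comp]: assumes "computable f" shows "computable (\<lambda>x. fst (f x))"
proof -
  have "computable (fst :: 'b \<times> 'c \<Rightarrow> 'b)" unfolding computable_def
    by (simp add: de_prod_def cf_fst cf_proj)
  from c_comp[OF this assms] show ?thesis .
qed

lemma c_snd [comp]: assumes "computable f" shows "computable (\<lambda>x. snd (f x))"
proof -
  have "computable (snd :: 'b \<times> 'c \<Rightarrow> 'c)" unfolding computable_def
    by (simp add: de_prod_def cf_snd cf_proj)
  from c_comp[OF this assms] show ?thesis .
qed

lemma c2:
  assumes "computable (\<lambda>p. h (fst p) (snd p))" "computable f" "computable g"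
  shows "computable (\<lambda>x. h (f x) (g x))"
  using c_comp[OF assms(1) c_pair[OF assms(2,3)]] by simp

lemma c_Suc [comp]: "computable f \<Longrightarrow> computable (\<lambda>x. Suc (f x))"
  unfolding computable_def by (simp add: en_nat_def cf_Suc)

lemma c_add [comp]: "computable f \<Longrightarrow> computable g \<Longrightarrow> computable (\<lambda>x. f x + g x :: nat)"
  unfolding computable_def by (simp add: en_nat_def cf_add)

lemma c_sub [comp]: "computable f \<Longrightarrow> computable g \<Longrightarrow> computable (\<lambda>x. f x - g x :: nat)"
  unfolding computable_def by (simp add: en_nat_def cf_sub)

lemma c_mult [comp]: "computable f \<Longrightarrow> computable g \<Longrightarrow> computable (\<lambda>x. f x * g x :: nat)"
  unfolding computable_def by (simp add: en_nat_def cf_mult)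

text \<open>The accumulator may have any encoded type: the recursion runs on codes, and decoding
  commutes with each iteration. The step function sees parameter, counter and accumulator, whereas
  \<open>cf_rec\<close> supplies counter, accumulator and parameter.\<close>

lemma c_rec:
  assumes a: "computable a" and m: "computable m"
    and s: "computable (\<lambda>t. s (fst t) (fst (snd t)) (snd (snd t)))"
  shows "computable (\<lambda>x. rec_nat (a x) (\<lambda>n r. s x n r) (m x))"
proof -
  let ?S = "\<lambda>t. s (fst t) (fst (snd t)) (snd (snd t))"
  have "cf (Suc (Suc 1)) (\<lambda>ys. en (?S (de (prod_encode (ys ! 2, prod_encode (ys ! 0, ys ! 1))))))"
    by (intro cf_computable[OF s] cf_prod_encode cf_proj) simp_all
  note S = this
  show ?thesis unfolding computable_def
  proof (rule cf_rec'[of 1 "\<lambda>xs. en (a (de (xs ! 0)))" "\<lambda>xs. en (m (de (xs ! 0)))", OF _ _ S])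
    fix xs :: "nat list" assume "length xs = 1"
    have "rec_nat (en (a e)) (\<lambda>i y. en (s e i (de y))) k = en (rec_nat (a e) (s e) k)" for e k
      by (induction k) auto
    then show "rec_nat (en (a (de (xs ! 0)))) (\<lambda>i y. en (?S (de (prod_encode ((i # y # xs) ! 2, prod_encode ((i # y # xs) ! 0, (i # y # xs) ! 1))))))
        (en (m (de (xs ! 0)))) = en (rec_nat (a (de (xs ! 0))) (s (de (xs ! 0))) (m (de (xs ! 0))))"
      by (simp add: de_prod_def en_nat_def de_nat_def)
  qed (use a m in \<open>auto simp: computable_def\<close>)
qed

lemma c_power [comp]: assumes "computable f" "computable g" shows "computable (\<lambda>x. f x ^ g x :: nat)"
proof -
  have "computable (\<lambda>x. rec_nat 1 (\<lambda>n r. f x * r) (g x))"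
    by (intro c_rec comp assms(2) c_comp[OF assms(1)])
  moreover have "rec_nat 1 (\<lambda>n r. a * r) b = a ^ b" for a b :: nat by (induction b) auto
  ultimately show ?thesis by simp
qed

lemma c_if [comp]:
  assumes "dec P" "computable f" "computable g"
  shows "computable (\<lambda>x. if P x then f x else g x)"
proof -
  have "computable (\<lambda>x. rec_nat (g x) (\<lambda>n r. f x) (of_bool (P x)))"
    by (intro c_rec comp assms(3) c_comp[OF assms(2)] assms(1)[unfolded dec_def])
  moreover have "rec_nat (g x) (\<lambda>n r. f x) (of_bool (P x)) = (if P x then f x else g x)" for x by simp
  ultimately show ?thesis by simp
qed

lemma d2: "dec (\<lambda>p. h (fst p) (snd p)) \<Longrightarrow> computable f \<Longrightarrow> computable g \<Longrightarrow> dec (\<lambda>x. h (f x) (g x))"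
  unfolding dec_def by (rule c2)

lemma d_const [comp]: "dec (\<lambda>x. b)"
  unfolding dec_def by (intro comp)

lemma d_not [comp]: assumes "dec P" shows "dec (\<lambda>x. \<not> P x)"
proof -
  have "computable (\<lambda>x. 1 - of_bool (P x) :: nat)" by (intro comp assms[unfolded dec_def])
  moreover have "(1 - of_bool b :: nat) = of_bool (\<not> b)" for b by simp
  ultimately show ?thesis unfolding dec_def by simp
qed

lemma d_conj [comp]: assumes "dec P" "dec Q" shows "dec (\<lambda>x. P x \<and> Q x)"
  using c_mult[OF assms[unfolded dec_def]] unfolding dec_def by (simp add: of_bool_conj)

lemma d_disj [comp]: assumes "dec P" "dec Q" shows "dec (\<lambda>x. P x \<or> Q x)"
  using d_not[OF d_conj[OF d_not[OF assms(1)] d_not[OF assms(2)]]] by simp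

lemma d_imp [comp]: assumes "dec P" "dec Q" shows "dec (\<lambda>x. P x \<longrightarrow> Q x)"
  using d_disj[OF d_not[OF assms(1)] assms(2)] by (simp only: imp_conv_disj)

lemma d_iff [comp]: assumes "dec P" "dec Q" shows "dec (\<lambda>x. P x = Q x)"
  using d_conj[OF d_imp[OF assms] d_imp[OF assms(2,1)]] by (simp only: iff_conv_conj_imp)

lemma d_le [comp]: assumes "computable f" "computable g" shows "dec (\<lambda>x. (f x :: nat) \<le> g x)"
proof -
  have "computable (\<lambda>x. 1 - (f x - g x))" by (intro comp assms)
  moreover have "1 - (a - b) = (of_bool (a \<le> b) :: nat)" for a b :: nat by (cases "a \<le> b") auto
  ultimately show ?thesis unfolding dec_def by simp
qed

lemma d_less [comp]: assumes "computable f" "computable g" shows "dec (\<lambda>x. (f x :: nat) < g x)"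
  using d_not[OF d_le[OF assms(2,1)]] by (simp add: not_le)

text \<open>The same recursive function represents both sides, since \<open>en\<close> is the
  identity on naturals. This yields equality tests on every encoded type.\<close>

lemma c_en: "computable f \<Longrightarrow> computable (\<lambda>x. en (f x))"
  unfolding computable_def by (simp add: en_nat_def)

lemma d_eq [comp]: assumes "computable f" "computable g" shows "dec (\<lambda>x. f x = g x)"
proof -
  have "(f x = g x) = (en (f x) \<le> en (g x) \<and> en (g x) \<le> en (f x))" for x
    by (metis antisym de_en order_refl)
  then show ?thesis by (simp only:) (intro comp c_en assms)
qed

lemma d_bex_less [comp]:
  fixes P :: "'a::enc \<Rightarrow> nat \<Rightarrow> bool"
  assumes "computable m" "dec (\<lambda>p. P (fst p) (snd p))"
  shows "dec (\<lambda>x. \<exists>i<m x. P x i)"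
proof -
  have "computable (\<lambda>x. rec_nat (0::nat) (\<lambda>n r. if P x n then 1 else r) (m x))"
  proof (intro c_rec comp assms(1))
    show "dec (\<lambda>t. P (fst t) (fst (snd t)))"
      by (rule d2[where h = P, OF assms(2)]; intro comp)
  qed
  moreover have "rec_nat (0::nat) (\<lambda>n r. if P x n then 1 else r) m = of_bool (\<exists>i<m. P x i)" for x m
    by (induction m) (auto simp: less_Suc_eq)
  ultimately show ?thesis unfolding dec_def by simp
qed

lemma d_ball_less [comp]:
  fixes P :: "'a::enc \<Rightarrow> nat \<Rightarrow> bool"
  assumes "computable m" "dec (\<lambda>p. P (fst p) (snd p))"
  shows "dec (\<lambda>x. \<forall>i<m x. P x i)"
proof -
  have "dec (\<lambda>x. \<not> (\<exists>i<m x. \<not> P x i))" by (intro comp assms)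
  then show ?thesis by simp
qed

section \<open>Computable functions on lists\<close>

lemma c_list_decode [comp]: "computable f \<Longrightarrow> computable (\<lambda>x. list_decode (f x))"
  unfolding computable_def by (simp add: en_list_def en_nat_def map_idI)

lemma c_Cons [comp]: assumes "computable f" "computable g" shows "computable (\<lambda>x. f x # g x)"
proof -
  have "computable (\<lambda>x. Suc (prod_encode (en (f x), en (g x))))"
    using c_Suc[OF c_en[OF c_pair[OF assms]]] by (simp add: en_prod_def)
  then show ?thesis unfolding computable_def by (simp add: en_list_def en_nat_def)
qed

text \<open>This takes care of the empty list below: its code is 0, so the truncated predecessor
  decodes to (0, 0), which gives the empty tail and the default head \<open>de 0\<close>.\<close>

lemma prod_decode_0: "prod_decode 0 = (0, 0)"
  using prod_encode_inverse[of "(0, 0)"] by (simp add: prod_encode_def)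

lemma c_tl: assumes "computable f" shows "computable (\<lambda>x. tl (f x))"
proof -
  have "cf 1 (\<lambda>xs. snd (prod_decode (en (f (de (xs ! 0))) - 1)))"
    by (intro cf_snd cf_pred assms[unfolded computable_def])
  moreover have "snd (prod_decode (en xs - 1)) = en (tl xs)" for xs :: "'b list"
    by (cases xs) (simp_all add: en_list_def prod_decode_0)
  ultimately show ?thesis unfolding computable_def by simp
qed

lemma c_hd0: assumes "computable f" shows "computable (\<lambda>x. case f x of [] \<Rightarrow> de 0 | a # _ \<Rightarrow> a)"
proof -
  have "cf 1 (\<lambda>xs. fst (prod_decode (en (f (de (xs ! 0))) - 1)))"
    by (intro cf_fst cf_pred assms[unfolded computable_def])
  moreover have "fst (prod_decode (en xs - 1)) = en (case xs of [] \<Rightarrow> de 0 | a # _ \<Rightarrow> a)" for xs :: "'b list"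
    by (cases xs) (simp_all add: en_list_def prod_decode_0)
  ultimately show ?thesis unfolding computable_def by simp
qed

lemma c_drop: assumes "computable f" "computable g" shows "computable (\<lambda>x. drop (g x) (f x))"
proof -
  have "computable (\<lambda>x. rec_nat (f x) (\<lambda>n r. tl r) (g x))" by (intro c_rec assms c_tl comp)
  moreover have "rec_nat xs (\<lambda>n r. tl r) m = drop m xs" for xs :: "'b list" and m
    by (induction m) (auto simp: drop_Suc tl_drop)
  ultimately show ?thesis by simp
qed

text \<open>Beyond the length \<open>xs ! i\<close> is unspecified; a computable lookup needs a
  definite default.\<close>

definition nthd :: "'a::enc list \<Rightarrow> nat \<Rightarrow> 'a" where
  "nthd xs i = (if i < length xs then xs ! i else de 0)"

lemma c_nthd [comp]: assumes "computable f" "computable g" shows "computable (\<lambda>x. nthd (f x) (g x))"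
proof -
  have "nthd xs i = (case drop i xs of [] \<Rightarrow> de 0 | a # _ \<Rightarrow> a)" for xs :: "'b list" and i
    by (auto simp: nthd_def split: list.split) (metis drop_all list.distinct(1) not_le nth_via_drop)
  then show ?thesis using c_hd0[OF c_drop[OF assms]] by simp
qed

text \<open>Count the n below the code of the list for which \<open>drop n\<close> leaves something;
  a list is never longer than its code.\<close>

lemma c_length [comp]: assumes "computable f" shows "computable (\<lambda>x. length (f x))"
proof -
  have "computable (\<lambda>x. rec_nat (0::nat) (\<lambda>n r. if drop n (f x) = [] then r else Suc r) (en (f x)))"
    by (intro c_rec comp c_drop c_comp[OF assms] c_en)
  moreover have "rec_nat (0::nat) (\<lambda>n r. if drop n xs = [] then r else Suc r) m = min m (length xs)" for xs :: "'b list" and m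
    by (induction m) auto
  moreover have "length ys \<le> list_encode ys" for ys
    by (induction ys) (auto intro: order_trans le_prod_encode_2)
  then have "length xs \<le> en xs" for xs :: "'b list"
    unfolding en_list_def by (metis length_map)
  ultimately show ?thesis by (simp add: min_absorb2)
qed

lemma d_bex_set [comp]:
  assumes f: "computable f" and P: "dec (\<lambda>p. P (fst p) (snd p))"
  shows "dec (\<lambda>x. \<exists>y\<in>set (f x). P x y)"
proof -
  have "dec (\<lambda>x. \<exists>i<length (f x). P x (nthd (f x) i))"
    by (intro comp d2[where h = P, OF P] c_comp[OF f])
  moreover have "(\<exists>y\<in>set xs. Q y) = (\<exists>i<length xs. Q (nthd xs i))" for xs :: "'b list" and Q
  proof -
    have "set xs = nthd xs ` {..<length xs}"
      by (simp add: set_conv_nth nthd_def image_def lessThan_def) metis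
    then show ?thesis by auto
  qed
  ultimately show ?thesis by simp
qed

lemma d_ball_set [comp]:
  assumes f: "computable f" and P: "dec (\<lambda>p. P (fst p) (snd p))"
  shows "dec (\<lambda>x. \<forall>y\<in>set (f x). P x y)"
proof -
  have "dec (\<lambda>x. \<not> (\<exists>y\<in>set (f x). \<not> P x y))" by (intro comp assms)
  then show ?thesis by simp
qed

lemma d_mem [comp]: assumes "computable f" "computable g" shows "dec (\<lambda>x. f x \<in> set (g x))"
proof -
  have "dec (\<lambda>x. \<exists>y\<in>set (g x). y = f x)" by (intro comp assms(2) c_comp[OF assms(1)])
  then show ?thesis by simp
qed

lemma c_foldl:
  assumes f: "computable f" and a: "computable a" and s: "computable (\<lambda>t. s (fst t) (fst (snd t)) (snd (snd t)))"
  shows "computable (\<lambda>x. foldl (\<lambda>r y. s x r y) (a x) (f x))"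
proof -
  have "computable (\<lambda>x. rec_nat (a x) (\<lambda>n r. s x r (nthd (f x) n)) (length (f x)))"
    by (intro c_rec comp a c_comp[where f = "\<lambda>t. s (fst t) (fst (snd t)) (snd (snd t))"
        and g = "\<lambda>t. (fst t, snd (snd t), nthd (f (fst t)) (fst (snd t)))", simplified] s c_comp[OF f])
  moreover have "rec_nat b (\<lambda>n r. h r (nthd xs n)) (length xs) = foldl h b xs" for b xs and h :: "'c \<Rightarrow> 'b \<Rightarrow> 'c"
  proof (induction xs rule: rev_induct)
    case (snoc y xs)
    have "rec_nat b (\<lambda>n r. h r (nthd (xs @ [y]) n)) m = rec_nat b (\<lambda>n r. h r (nthd xs n)) m" if "m \<le> length xs" for m
      using that by (induction m) (auto simp: nthd_def nth_append)
    with snoc show ?case by (simp add: nthd_def)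
  qed simp
  ultimately show ?thesis by simp
qed

lemma c_rev: assumes "computable f" shows "computable (\<lambda>x. rev (f x))"
proof -
  have "computable (\<lambda>x. foldl (\<lambda>r y. y # r) [] (f x))" by (intro c_foldl comp assms)
  moreover have "foldl (\<lambda>r y. y # r) zs xs = rev xs @ zs" for xs zs :: "'b list" by (induction xs arbitrary: zs) auto
  ultimately show ?thesis by simp
qed

lemma c_append [comp]: assumes "computable f" "computable g" shows "computable (\<lambda>x. f x @ g x)"
proof -
  have "computable (\<lambda>x. foldl (\<lambda>r y. y # r) (g x) (rev (f x)))" by (intro c_foldl comp assms c_rev)
  moreover have "foldl (\<lambda>r y. y # r) zs xs = rev xs @ zs" for xs zs :: "'b list" by (induction xs arbitrary: zs) auto
  ultimately show ?thesis by simp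
qed

lemma c_concat_map [comp]:
  assumes f: "computable f" and s: "computable (\<lambda>p. s (fst p) (snd p))"
  shows "computable (\<lambda>x. concat (map (\<lambda>y. s x y) (f x)))"
proof -
  have "computable (\<lambda>x. foldl (\<lambda>r y. r @ s x y) [] (f x))" by (intro c_foldl comp f c2[where h = s, OF s])
  moreover have "foldl (\<lambda>r y. r @ h y) zs xs = zs @ concat (map h xs)" for xs zs and h :: "'b \<Rightarrow> 'c list"
    by (induction xs arbitrary: zs) auto
  ultimately show ?thesis by simp
qed

lemma c_map [comp]:
  assumes f: "computable f" and s: "computable (\<lambda>p. s (fst p) (snd p))"
  shows "computable (\<lambda>x. map (\<lambda>y. s x y) (f x))"
proof -
  have "computable (\<lambda>x. concat (map (\<lambda>y. [s x y]) (f x)))" by (intro comp assms)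
  then show ?thesis by simp
qed

lemma c_upt [comp]: assumes "computable f" shows "computable (\<lambda>x. [0..<f x])"
proof -
  have "computable (\<lambda>x. rec_nat [] (\<lambda>n r. r @ [n]) (f x))" by (intro c_rec comp assms)
  moreover have "rec_nat [] (\<lambda>n r. r @ [n]) m = [0..<m]" for m by (induction m) auto
  ultimately show ?thesis by simp
qed

lemma c_n_lists [comp]: assumes "computable f" "computable g" shows "computable (\<lambda>x. List.n_lists (g x) (f x))"
proof -
  have "computable (\<lambda>x. rec_nat [[]] (\<lambda>n r. concat (map (\<lambda>ys. map (\<lambda>y. y # ys) (f x)) r)) (g x))"
    by (intro c_rec comp assms(2) c_comp[OF assms(1)])
  moreover have "rec_nat [[]] (\<lambda>n r. concat (map (\<lambda>ys. map (\<lambda>y. y # ys) xs) r)) m = List.n_lists m xs" for xs :: "'b list" and m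
    by (induction m) auto
  ultimately show ?thesis by simp
qed

text \<open>A fold rather than \<open>subseqs\<close>, because \<open>c_foldl\<close> covers it;
  only the sets of its members matter later.\<close>

definition sublists :: "'a list \<Rightarrow> 'a list list" where
  "sublists xs = foldl (\<lambda>r x. map ((#) x) r @ r) [[]] xs"

lemma c_sublists [comp]: assumes "computable f" shows "computable (\<lambda>x. sublists (f x))"
  unfolding sublists_def by (intro c_foldl comp assms)

lemma set_sublists: "set ` set (sublists xs) = Pow (set xs)"
proof (induction xs rule: rev_induct)
  case (snoc x xs)
  have "set ` set (sublists (xs @ [x])) = (\<lambda>s. insert x s) ` (set ` set (sublists xs)) \<union> set ` set (sublists xs)"
    by (simp add: sublists_def image_Un image_image)
  then show ?case unfolding snoc by (simp add: Pow_insert Un_commute)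
qed (simp add: sublists_def)

lemma dec_imp_reval:
  fixes P :: "nat \<Rightarrow> bool"
  assumes "dec P" shows "\<exists>f. \<forall>n. reval f [n] (if P n then 1 else 0)"
proof -
  obtain r where "\<And>xs. length xs = 1 \<Longrightarrow> reval r xs (of_bool (P (xs ! 0)))"
    using assms unfolding dec_def computable_def cf_def by (auto simp: en_nat_def de_nat_def)
  then have "reval r [n] (if P n then 1 else 0)" for n
    by (metis One_nat_def length_Cons list.size(3) nth_Cons_0 of_bool_def)
  then show ?thesis by blast
qed

section \<open>Marked paths in finite graphs\<close>

inductive pth :: "('v \<Rightarrow> bool \<Rightarrow> 'v \<Rightarrow> bool) \<Rightarrow> 'v \<Rightarrow> nat \<Rightarrow> 'v \<Rightarrow> bool" for E where
  pth_refl: "pth E v 0 v"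
| pth_step: "E v f u \<Longrightarrow> pth E u n w \<Longrightarrow> pth E v (n + of_bool f) w"

text \<open>Buechi acceptance on the edges of a graph.\<close>

definition live :: "('v \<Rightarrow> bool \<Rightarrow> 'v \<Rightarrow> bool) \<Rightarrow> 'v \<Rightarrow> bool" where
  "live E v \<longleftrightarrow> (\<exists>s fs. s 0 = v \<and> (\<forall>i. E (s i) (fs i) (s (Suc i))) \<and> (\<exists>\<^sub>\<infinity>i. fs i))"

lemma live_step: assumes "E v f u" "live E u" shows "live E v"
proof -
  obtain s fs where s: "s 0 = u" "\<And>i. E (s i) (fs i) (s (Suc i))" "\<exists>\<^sub>\<infinity>i. fs i"
    using assms unfolding live_def by blast
  have "E (case_nat v s i) (case_nat f fs i) (case_nat v s (Suc i))" for i
    using s assms(1) by (cases i) auto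
  moreover have "\<exists>\<^sub>\<infinity>i. case_nat f fs i"
    unfolding INFM_nat
  proof
    fix m obtain n where "n > m" "fs n" using s(3) unfolding INFM_nat by blast
    then show "\<exists>n>m. case_nat f fs n" by (intro exI[of _ "Suc n"]) simp
  qed
  ultimately show ?thesis unfolding live_def
    by (intro exI[of _ "case_nat v s"] exI[of _ "case_nat f fs"]) simp
qed

lemma pth_live: "pth E v n u \<Longrightarrow> live E u \<Longrightarrow> live E v"
  by (induction rule: pth.induct) (auto intro: live_step)

lemma pth_trans: "pth E v n u \<Longrightarrow> pth E u m w \<Longrightarrow> pth E v (n + m) w"
proof (induction rule: pth.induct)
  case (pth_step v f u n w')
  then show ?case using pth.pth_step[of E v f u "n + m" w] by (simp add: add_ac)
qed simp

lemma pth_seq: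
  assumes "pth E v n w"
  shows "\<exists>L s fs. s 0 = v \<and> s L = w \<and> (\<forall>i<L. E (s i) (fs i) (s (Suc i))) \<and> (n > 0 \<longrightarrow> (\<exists>i<L. fs i))"
  using assms
proof (induction rule: pth.induct)
  case (pth_refl v)
  show ?case by (rule exI[of _ 0]) auto
next
  case (pth_step v f u n w)
  then obtain L s fs where s: "s 0 = u" "s L = w" "\<And>i. i < L \<Longrightarrow> E (s i) (fs i) (s (Suc i))" "n > 0 \<longrightarrow> (\<exists>i<L. fs i)"
    by blast
  have "\<exists>i<Suc L. case_nat f fs i" if pos: "n + of_bool f > 0"
  proof (cases f)
    case True then show ?thesis by (intro exI[of _ 0]) simp
  next
    case False
    then obtain i where "i < L" "fs i" using pos s(4) by auto
    then show ?thesis by (intro exI[of _ "Suc i"]) simp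
  qed
  moreover have "E (case_nat v s i) (case_nat f fs i) (case_nat v s (Suc i))" if "i < Suc L" for i
    using that s pth_step(1) by (cases i) auto
  ultimately show ?case using s(2)
    by (intro exI[of _ "Suc L"] exI[of _ "case_nat v s"] exI[of _ "case_nat f fs"]) auto
qed

text \<open>Unroll the cycle by taking indices modulo its length. The wrap-around fits because the
  cycle ends where it starts, and the length is positive because a mark lies on it.\<close>

lemma live_loop: assumes "pth E u n u" "n > 0" shows "live E u"
proof -
  obtain L s fs k where s: "s 0 = u" "s L = u" "\<And>i. i < L \<Longrightarrow> E (s i) (fs i) (s (Suc i))" and k: "k < L" "fs k"
    using pth_seq[OF assms(1)] assms(2) by blast
  have "E (s (i mod L)) (fs (i mod L)) (s (Suc i mod L))" for i
    using s(3)[of "i mod L"] k s(1,2) by (auto simp: mod_Suc)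
  moreover have "\<exists>\<^sub>\<infinity>i. fs (i mod L)" unfolding INFM_nat
  proof
    fix m
    have "m < k + L * Suc m" using k by (cases L) auto
    then show "\<exists>n>m. fs (n mod L)" using k by (intro exI[of _ "k + L * Suc m"]) (simp del: mult_Suc_right)
  qed
  ultimately show ?thesis unfolding live_def using s(1)
    by (intro exI[of _ "\<lambda>i. s (i mod L)"] exI[of _ "\<lambda>i. fs (i mod L)"]) (use k in auto)
qed

text \<open>Cuts a path into pieces with at least one mark each, so that the pigeonhole principle
  can be applied to marks instead of edges.\<close>

lemma pth_marks:
  assumes "pth E v n w"
  shows "\<exists>h. h 0 = v \<and> (\<forall>i<n. \<exists>m>0. pth E (h i) m (h (Suc i)))"
  using assms
proof (induction rule: pth.induct)
  case (pth_step v f u n w)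
  then obtain h where h: "h 0 = u" "\<And>i. i < n \<Longrightarrow> \<exists>m>0. pth E (h i) m (h (Suc i))" by blast
  show ?case
  proof (cases f)
    case True
    have "\<exists>m>0. pth E (case_nat v h i) m (case_nat v h (Suc i))" if "i < n + 1" for i
    proof (cases i)
      case 0
      have "pth E v (0 + of_bool f) u" using pth.pth_step[of E v f u 0 u] pth.pth_refl[of E u] pth_step(1) by blast
      then show ?thesis using 0 h(1) True by auto
    qed (use h that in auto)
    then show ?thesis using True by (intro exI[of _ "case_nat v h"]) simp
  next
    case False
    \<comment> \<open>The unmarked first edge is glued to the first piece; for n = 0 there is no
      piece and nothing to show.\<close>
    have "\<exists>m>0. pth E ((h(0 := v)) i) m ((h(0 := v)) (Suc i))" if i: "i < n" for i
    proof (cases i)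
      case 0
      then obtain m where m: "m > 0" "pth E u m (h 1)" using h(1) h(2)[of 0] i by auto
      have "pth E v (m + of_bool f) (h 1)" using pth_step(1) m by (intro pth.intros)
      then show ?thesis using 0 m by auto
    qed (use h i in auto)
    then show ?thesis using False by (intro exI[of _ "h(0 := v)"]) simp
  qed
qed auto

lemma pth_target:
  assumes "pth E v n w" "n > 0" and V: "\<forall>v f u. E v f u \<longrightarrow> u \<in> V"
  shows "w \<in> V"
proof -
  have "w \<in> V" if "pth E u m w" "u \<in> V" for u m
    using that by induction (use V in auto)
  then show ?thesis using assms(1,2) V by (auto elim!: pth.cases[of E v n w])
qed

text \<open>Among more than \<open>card V\<close> cut points two coincide, and the loop between them
  carries a mark, which would make v live. The first cut point is left out of the counting because v
  itself need not lie in V.\<close>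

lemma pth_bound:
  assumes fin: "finite V" and V: "\<forall>v f u. E v f u \<longrightarrow> u \<in> V" and nl: "\<not> live E v" and p: "pth E v n w"
  shows "n \<le> card V"
proof (rule ccontr)
  assume gt: "\<not> ?thesis"
  obtain h where h: "h 0 = v" "\<And>i. i < n \<Longrightarrow> \<exists>m>0. pth E (h i) m (h (Suc i))" using pth_marks[OF p] by blast
  have reach: "\<exists>m. pth E (h i) m (h (i + d)) \<and> (d > 0 \<longrightarrow> m > 0)" if "i + d \<le> n" for i d
    using that
  proof (induction d)
    case 0 show ?case using pth.pth_refl[of E "h i"] by auto
  next
    case (Suc d)
    then obtain m where "pth E (h i) m (h (i + d))" by auto
    moreover obtain m' where "m' > 0" "pth E (h (i + d)) m' (h (Suc (i + d)))" using h(2)[of "i + d"] Suc by auto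
    ultimately show ?case using pth_trans by (metis add_Suc_right add_gr_0)
  qed
  have "h (Suc i) \<in> V" if "i < n" for i
    using h(2)[OF that] pth_target[of E "h i" _ "h (Suc i)" V] V by blast
  then have "(\<lambda>i. h (Suc i)) ` {..<n} \<subseteq> V" by auto
  then have "card ((\<lambda>i. h (Suc i)) ` {..<n}) \<le> card V" using fin card_mono by blast
  then have "\<not> inj_on (\<lambda>i. h (Suc i)) {..<n}" using gt by (auto dest: card_image)
  then obtain i j where ij: "i < j" "j < n" "h (Suc i) = h (Suc j)"
    unfolding inj_on_def by (metis lessThan_iff linorder_neqE_nat)
  obtain m where "pth E (h (Suc i)) m (h (Suc i))" "m > 0"
    using reach[of "Suc i" "j - i"] ij by auto
  then have "live E (h (Suc i))" by (rule live_loop)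
  moreover obtain m' where "pth E v m' (h (Suc i))" using reach[of 0 "Suc i"] ij h(1) by force
  ultimately show False using nl pth_live[of E v m' "h (Suc i)"] by simp
qed

text \<open>The rank of a vertex for the co-Buechi condition. \<open>Max\<close> is taken over a
  finite set, and so is meaningful, when the vertex is not live and the reachable vertices are
  finite in number.\<close>

definition maxmarks :: "('v \<Rightarrow> bool \<Rightarrow> 'v \<Rightarrow> bool) \<Rightarrow> 'v \<Rightarrow> nat" where
  "maxmarks E v = Max {n. \<exists>w. pth E v n w}"

lemma maxmarks:
  assumes fin: "finite V" and V: "\<forall>v f u. E v f u \<longrightarrow> u \<in> V" and nl: "\<not> live E v"
  shows "maxmarks E v \<le> card V" "pth E v n w \<Longrightarrow> n \<le> maxmarks E v" "\<exists>w. pth E v (maxmarks E v) w"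
proof -
  have sub: "{n. \<exists>w. pth E v n w} \<subseteq> {..card V}" using pth_bound[OF fin V nl] by auto
  then have f: "finite {n. \<exists>w. pth E v n w}" by (rule finite_subset) simp
  have ne: "{n. \<exists>w. pth E v n w} \<noteq> {}" using pth.pth_refl[of E v] by auto
  show "pth E v n w \<Longrightarrow> n \<le> maxmarks E v" unfolding maxmarks_def using f by (auto intro: Max_ge)
  have "maxmarks E v \<in> {n. \<exists>w. pth E v n w}" unfolding maxmarks_def by (rule Max_in[OF f ne])
  then show "\<exists>w. pth E v (maxmarks E v) w" "maxmarks E v \<le> card V" using sub by auto
qed

lemma maxmarks_step:
  assumes fin: "finite V" and V: "\<forall>v f u. E v f u \<longrightarrow> u \<in> V" and nl: "\<not> live E v" and e: "E v f u"
  shows "\<not> live E u" "maxmarks E u + of_bool f \<le> maxmarks E v"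
proof -
  show 1: "\<not> live E u" using live_step[of E v f u] e nl by blast
  obtain w where "pth E u (maxmarks E u) w" using maxmarks(3)[OF fin V 1] by blast
  then show "maxmarks E u + of_bool f \<le> maxmarks E v" using maxmarks(2)[OF fin V nl] pth.pth_step[of E v f u, OF e] by blast
qed

section \<open>Bounded budgets in games with a universal co-Buechi objective\<close>

text \<open>Lexicographic minimality of the first n values, phrased without an order on vectors. In
  the induction, coordinate n is minimised among the elements that agree with the minimum found so
  far.\<close>

lemma lexmin_exists:
  fixes v :: "'g \<Rightarrow> nat \<Rightarrow> nat"
  assumes "S \<noteq> {}"
  shows "\<exists>z\<in>S. \<forall>y\<in>S. \<forall>j<n. (\<forall>i<j. v y i = v z i) \<longrightarrow> v z j \<le> v y j"
proof (induction n)
  case (Suc n)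
  then obtain z where z: "z \<in> S" "\<And>y j. y \<in> S \<Longrightarrow> j < n \<Longrightarrow> \<forall>i<j. v y i = v z i \<Longrightarrow> v z j \<le> v y j" by blast
  define S' where "S' = {y \<in> S. \<forall>i<n. v y i = v z i}"
  have "z \<in> S'" using z unfolding S'_def by simp
  then obtain y where y: "y \<in> S'" "\<And>y'. y' \<in> S' \<Longrightarrow> v y n \<le> v y' n"
    using ex_has_least_nat[of "\<lambda>y. y \<in> S'" z "\<lambda>y. v y n"] by blast
  show ?case
  proof (rule bexI[of _ y], intro ballI allI impI)
    fix y' j assume y': "y' \<in> S" "j < Suc n" "\<forall>i<j. v y' i = v y i"
    show "v y j \<le> v y' j"
    proof (cases "j < n")
      case True
      then have "\<forall>i<j. v y' i = v z i" using y' y(1) unfolding S'_def by simp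
      then show ?thesis using z(2)[OF y'(1) True] y(1) True unfolding S'_def by simp
    next
      case False
      then have "j = n" using y' by simp
      then have "y' \<in> S'" using y' y(1) unfolding S'_def by auto
      then show ?thesis using y(2) \<open>j = n\<close> by simp
    qed
  qed (use y in \<open>simp add: S'_def\<close>)
qed (use assms in auto)

lemma nat_nonincreasing_stabilises:
  fixes s :: "nat \<Rightarrow> nat"
  assumes "\<And>i. i \<ge> T \<Longrightarrow> s (Suc i) \<le> s i"
  shows "\<exists>T'\<ge>T. \<forall>i\<ge>T'. s (Suc i) = s i"
proof -
  obtain t where t: "t \<ge> T" "\<And>t'. t' \<ge> T \<Longrightarrow> s t \<le> s t'"
    using ex_has_least_nat[of "\<lambda>t. t \<ge> T" T s] by blast
  have c: "s i = s t" if "i \<ge> t" for i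
    using that
  proof (induction rule: nat_induct_at_least)
    case (Suc i)
    have "s t \<le> s (Suc i)" using t(2)[of "Suc i"] Suc t(1) by simp
    then show ?case using assms[of i] Suc t(1) by simp
  qed simp
  have "s (Suc i) = s i" if "i \<ge> t" for i using c[of i] c[of "Suc i"] that by simp
  then show ?thesis using t(1) by blast
qed

text \<open>S holds the first components already met, so of equal sets only the oldest survives. The
  resulting distinctness is what bounds the length of a memory.\<close>

fun nrm :: "'q set set \<Rightarrow> ('q set \<times> 'q set) list \<Rightarrow> ('q set \<times> 'q set) list" where
  "nrm S [] = []"
| "nrm S (cd # r) = (if fst cd = {} \<or> fst cd \<in> S then nrm S r else cd # nrm (insert (fst cd) S) r)"

lemma nrm_props: "set (nrm S l) \<subseteq> {cd \<in> set l. fst cd \<noteq> {} \<and> fst cd \<notin> S}" "distinct (map fst (nrm S l))"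
proof (induction l arbitrary: S)
  case (Cons cd r)
  { case 1 show ?case using Cons(1)[of S] Cons(1)[of "insert (fst cd) S"] by auto }
  { case 2 show ?case using Cons(2)[of S] Cons(2)[of "insert (fst cd) S"] Cons(1)[of "insert (fst cd) S"] by auto }
qed auto

text \<open>A nonempty set either keeps its entry or is represented by an older entry with the same
  set, so its position can only fall. If the position stays the same, nothing up to it was deleted;
  this is how entries become stable.\<close>

lemma nrm_follow:
  assumes "p < length l" "fst (l ! p) \<noteq> {}" "fst (l ! p) \<notin> S"
  shows "\<exists>p'\<le>p. p' < length (nrm S l) \<and> fst (nrm S l ! p') = fst (l ! p) \<and>
           (p' = p \<longrightarrow> take (Suc p) (nrm S l) = take (Suc p) l)"
  using assms
proof (induction l arbitrary: S p)
  case (Cons cd r)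
  show ?case
  proof (cases "fst cd = {} \<or> fst cd \<in> S")
    case True
    then obtain p0 where p0: "p = Suc p0" using Cons.prems by (cases p) auto
    then have "\<exists>p'\<le>p0. p' < length (nrm S r) \<and> fst (nrm S r ! p') = fst (r ! p0)"
      using Cons.IH[of p0 S] Cons.prems by auto
    then obtain p' where "p' \<le> p0" "p' < length (nrm S r)" "fst (nrm S r ! p') = fst (r ! p0)" by blast
    then show ?thesis using True p0 by (intro exI[of _ p']) auto
  next
    case False
    show ?thesis
    proof (cases p)
      case 0 then show ?thesis using False by (intro exI[of _ 0]) auto
    next
      case (Suc p0)
      show ?thesis
      proof (cases "fst (r ! p0) = fst cd")
        case True then show ?thesis using False Suc by (intro exI[of _ 0]) auto
      next
        case neq: False
        obtain p' where "p' \<le> p0" "p' < length (nrm (insert (fst cd) S) r)"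
          "fst (nrm (insert (fst cd) S) r ! p') = fst (r ! p0)"
          "p' = p0 \<longrightarrow> take (Suc p0) (nrm (insert (fst cd) S) r) = take (Suc p0) r"
          using Cons.IH[of p0 "insert (fst cd) S"] Cons.prems Suc neq by auto
        then show ?thesis using False Suc by (intro exI[of _ "Suc p'"]) auto
      qed
    qed
  qed
qed simp

text \<open>With n states a memory is a list of at most 2^n pairs of subsets. There are at most (4^n
  + 1)^(2^n) such lists, and the factor n accounts for the product with the states.\<close>

definition bnd :: "nat \<Rightarrow> nat" where
  "bnd n = n * (2 ^ n * 2 ^ n + 1) ^ (2 ^ n)"

lemma bnd_mono: assumes "a \<le> b" shows "bnd a \<le> bnd b"
proof -
  have "(2::nat) ^ a \<le> 2 ^ b" using assms by (intro power_increasing) auto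
  then have "(2::nat) ^ a * 2 ^ a + 1 \<le> 2 ^ b * 2 ^ b + 1" by (intro add_mono mult_mono) auto
  then have "(2 ^ a * 2 ^ a + 1) ^ (2 ^ a) \<le> (2 ^ b * 2 ^ b + 1 :: nat) ^ (2 ^ a)" by (intro power_mono) auto
  also have "\<dots> \<le> (2 ^ b * 2 ^ b + 1) ^ (2 ^ b)" using \<open>(2::nat) ^ a \<le> 2 ^ b\<close> by (intro power_increasing) auto
  finally show ?thesis unfolding bnd_def using assms by (intro mult_mono) auto
qed

text \<open>In the intended game Player I picks x in X, Player II answers with y in
  \<open>Y x\<close>, and she wants every run of the automaton along the play to be marked finitely
  often. The mark belongs to the state from which the \<open>tr\<close> step leaves;
  \<open>ep\<close> steps happen between moves.\<close>

locale budget_game =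
  fixes Q :: "'q set" and ep :: "'q \<Rightarrow> 'q \<Rightarrow> bool" and tr :: "'x \<Rightarrow> 'y \<Rightarrow> 'q \<Rightarrow> 'q \<Rightarrow> bool"
    and mk :: "'x \<Rightarrow> 'q \<Rightarrow> bool" and X :: "'x set" and Y :: "'x \<Rightarrow> 'y set"
  assumes finQ: "finite Q" and epQ: "ep q q' \<Longrightarrow> q' \<in> Q" and trQ: "tr x y q q' \<Longrightarrow> q' \<in> Q"
begin

text \<open>A budget vector assigns to each state one more than the number of marks still allowed;
  the value 0 means that the state must not be reached.\<close>

definition eps_ok :: "('q \<Rightarrow> nat) \<Rightarrow> bool" where
  "eps_ok g \<longleftrightarrow> (\<forall>q q'. 0 < g q \<and> ep q q' \<longrightarrow> 0 < g q' \<and> g q' \<le> g q)"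

definition move_ok :: "('q \<Rightarrow> nat) \<Rightarrow> 'x \<Rightarrow> 'y \<Rightarrow> ('q \<Rightarrow> nat) \<Rightarrow> bool" where
  "move_ok g x y g' \<longleftrightarrow> (\<forall>q q'. 0 < g q \<and> tr x y q q' \<longrightarrow> 0 < g' q' \<and> g' q' + of_bool (mk x q) \<le> g q)"

text \<open>A winning certificate for Player II: along her answers the budget of a run never rises
  and each mark lowers it, so marks cannot go on forever.\<close>

definition closed_fam :: "('q \<Rightarrow> nat) set \<Rightarrow> bool" where
  "closed_fam G \<longleftrightarrow> (\<forall>g\<in>G. eps_ok g \<and> (\<forall>x\<in>X. \<exists>y\<in>Y x. \<exists>g'\<in>G. move_ok g x y g'))"

definition st :: "'x \<Rightarrow> 'y \<Rightarrow> 'q \<Rightarrow> bool \<Rightarrow> 'q \<Rightarrow> bool" where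
  "st x y q f q' \<longleftrightarrow> (\<exists>q1. ep\<^sup>*\<^sup>* q q1 \<and> tr x y q1 q' \<and> f = mk x q1)"

lemma st_budget:
  assumes "eps_ok g" "move_ok g x y g'" "0 < g q" "st x y q f q'"
  shows "0 < g' q' \<and> g' q' + of_bool f \<le> g q"
proof -
  obtain q1 where q1: "ep\<^sup>*\<^sup>* q q1" "tr x y q1 q'" "f = mk x q1" using assms(4) unfolding st_def by blast
  from q1(1) have "0 < g q1 \<and> g q1 \<le> g q"
    by induction (use assms(1,3) in \<open>auto simp: eps_ok_def intro: order_trans\<close>)
  then show ?thesis using assms(2) q1(2,3) unfolding move_ok_def by (meson order_trans)
qed

definition pst :: "'x \<Rightarrow> 'y \<Rightarrow> 'q set \<Rightarrow> 'q set" where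
  "pst x y C = {q'. \<exists>q\<in>C. \<exists>f. st x y q f q'}"

definition pm :: "'x \<Rightarrow> 'y \<Rightarrow> 'q set \<Rightarrow> 'q set" where
  "pm x y C = {q'. \<exists>q\<in>C. st x y q True q'}"

text \<open>The breakpoint condition: each state of the successor of C is reached by some tracked
  run that was marked since D was last emptied.\<close>

definition flash :: "'x \<Rightarrow> 'y \<Rightarrow> 'q set \<times> 'q set \<Rightarrow> bool" where
  "flash x y cd \<longleftrightarrow> pst x y (snd cd) \<union> pm x y (fst cd) = pst x y (fst cd)"

definition upd :: "'x \<Rightarrow> 'y \<Rightarrow> 'q set \<times> 'q set \<Rightarrow> 'q set \<times> 'q set" where
  "upd x y cd = (pst x y (fst cd), if flash x y cd then {} else pst x y (snd cd) \<union> pm x y (fst cd))"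

text \<open>New sets go to the end, so positions reflect age. At a breakpoint the copy of D is empty
  and disappears in \<open>nrm\<close>.\<close>

definition nxt :: "'x \<Rightarrow> 'y \<Rightarrow> ('q set \<times> 'q set) list \<Rightarrow> ('q set \<times> 'q set) list" where
  "nxt x y \<tau> = nrm {} (map (upd x y) \<tau> @ map (\<lambda>cd. (snd (upd x y cd), {})) \<tau>)"

definition wfm :: "('q set \<times> 'q set) list \<Rightarrow> bool" where
  "wfm \<tau> \<longleftrightarrow> (\<forall>cd\<in>set \<tau>. fst cd \<subseteq> Q \<and> snd cd \<subseteq> fst cd \<and> fst cd \<noteq> {}) \<and> distinct (map fst \<tau>)"

definition fits :: "('q \<Rightarrow> nat) \<Rightarrow> ('q set \<times> 'q set) list \<Rightarrow> bool" where
  "fits g \<tau> \<longleftrightarrow> (\<forall>cd\<in>set \<tau>. \<forall>q\<in>fst cd. 0 < g q)"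

text \<open>The extra 1 on D offsets a mark that has already been paid for, so the value still does
  not rise. At a breakpoint all states have paid, D is emptied, and taking the bonus back makes the
  value drop strictly.\<close>

definition val :: "('q \<Rightarrow> nat) \<Rightarrow> 'q set \<times> 'q set \<Rightarrow> nat" where
  "val g cd = Max ((\<lambda>q. g q + of_bool (q \<in> snd cd)) ` fst cd)"

lemma st_Q: "st x y q f q' \<Longrightarrow> q' \<in> Q"
  unfolding st_def using trQ by blast

lemma pst_Q: "pst x y C \<subseteq> Q"
  unfolding pst_def using st_Q by blast

lemma pst_mono: "C \<subseteq> C' \<Longrightarrow> pst x y C \<subseteq> pst x y C'"
  unfolding pst_def by blast

lemma pm_pst: "pm x y C \<subseteq> pst x y C"
  unfolding pm_def pst_def by blast

lemma snd_upd: "snd cd \<subseteq> fst cd \<Longrightarrow> snd (upd x y cd) \<subseteq> fst (upd x y cd)"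
  using pm_pst[of x y "fst cd"] pst_mono[of "snd cd" "fst cd" x y] by (auto simp: upd_def)

lemma wfm_nxt: assumes "wfm \<tau>" shows "wfm (nxt x y \<tau>)"
proof -
  have "fst cd' \<subseteq> Q \<and> snd cd' \<subseteq> fst cd' \<and> fst cd' \<noteq> {}" if "cd' \<in> set (nxt x y \<tau>)" for cd'
  proof -
    have "cd' \<in> upd x y ` set \<tau> \<union> (\<lambda>cd. (snd (upd x y cd), {})) ` set \<tau>" "fst cd' \<noteq> {}"
      using that nrm_props(1)[of "{}" "map (upd x y) \<tau> @ map (\<lambda>cd. (snd (upd x y cd), {})) \<tau>"]
      unfolding nxt_def by auto
    moreover have "snd (upd x y cd) \<subseteq> fst (upd x y cd)" "fst (upd x y cd) \<subseteq> Q" if "cd \<in> set \<tau>" for cd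
      using assms that snd_upd pst_Q unfolding wfm_def by (auto simp: upd_def)
    ultimately show ?thesis by fastforce
  qed
  then show ?thesis unfolding wfm_def using nrm_props(2) by (auto simp: nxt_def)
qed

lemma fits_nxt:
  assumes "wfm \<tau>" "fits g \<tau>" "eps_ok g" "move_ok g x y g'"
  shows "fits g' (nxt x y \<tau>)"
  unfolding fits_def
proof (intro ballI)
  fix cd' q' assume a: "cd' \<in> set (nxt x y \<tau>)" "q' \<in> fst cd'"
  have "cd' \<in> upd x y ` set \<tau> \<union> (\<lambda>cd. (snd (upd x y cd), {})) ` set \<tau>"
    using a(1) nrm_props(1)[of "{}" "map (upd x y) \<tau> @ map (\<lambda>cd. (snd (upd x y cd), {})) \<tau>"]
    unfolding nxt_def by auto
  then obtain cd where cd: "cd \<in> set \<tau>" "cd' = upd x y cd \<or> cd' = (snd (upd x y cd), {})" by blast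
  moreover have "snd (upd x y cd) \<subseteq> fst (upd x y cd)"
    using assms(1) cd(1) snd_upd[of cd x y] unfolding wfm_def by blast
  ultimately have cd: "cd \<in> set \<tau>" "q' \<in> fst (upd x y cd)" using a(2) by auto
  then obtain q f where "q \<in> fst cd" "st x y q f q'" by (auto simp: upd_def pst_def)
  then show "0 < g' q'" using st_budget assms cd unfolding fits_def by blast
qed

lemma val_upd:
  assumes cd: "fst cd \<subseteq> Q" "snd cd \<subseteq> fst cd" and g: "\<And>q. q \<in> fst cd \<Longrightarrow> 0 < g q"
    and ok: "eps_ok g" "move_ok g x y g'" and ne: "fst (upd x y cd) \<noteq> {}"
  shows "val g' (upd x y cd) \<le> val g cd" "flash x y cd \<Longrightarrow> val g' (upd x y cd) < val g cd"
proof -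
  have fin: "finite (fst cd)" "finite (fst (upd x y cd))"
    using finite_subset[OF cd(1) finQ] finite_subset[OF pst_Q finQ] by (auto simp: upd_def)
  have vge: "g q + of_bool (q \<in> snd cd) \<le> val g cd" if "q \<in> fst cd" for q
    unfolding val_def using fin that by (intro Max_ge) auto
  have vle: "val g' (upd x y cd) \<le> m" if "\<And>q'. q' \<in> fst (upd x y cd) \<Longrightarrow> g' q' + of_bool (q' \<in> snd (upd x y cd)) \<le> m" for m
    unfolding val_def using fin ne that by (subst Max_le_iff) auto
  have b: "g' q' + of_bool f \<le> g q" if "q \<in> fst cd" "st x y q f q'" for q q' f
    using st_budget[OF ok g[OF that(1)] that(2)] by simp
  \<comment> \<open>A state entering the candidate for the new D either inherits the bonus of a
    predecessor in D or has just paid for a mark itself; in both cases its budget is below the old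
    value.\<close>
  have D: "g' q' + 1 \<le> val g cd" if "q' \<in> pst x y (snd cd) \<union> pm x y (fst cd)" for q'
  proof -
    from that consider q f where "q \<in> snd cd" "st x y q f q'" | q where "q \<in> fst cd" "st x y q True q'"
      unfolding pst_def pm_def by blast
    then show ?thesis
    proof cases
      case 1
      then show ?thesis using b[of q f q'] vge[of q] cd(2) by auto
    next
      case 2
      then show ?thesis using b[of q True q'] vge[of q] by auto
    qed
  qed
  show "val g' (upd x y cd) \<le> val g cd"
  proof (rule vle)
    fix q' assume q': "q' \<in> fst (upd x y cd)"
    show "g' q' + of_bool (q' \<in> snd (upd x y cd)) \<le> val g cd"
    proof (cases "q' \<in> snd (upd x y cd)")
      case True
      then show ?thesis using D[of q'] by (auto simp: upd_def split: if_splits)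
    next
      case False
      obtain q f where "q \<in> fst cd" "st x y q f q'" using q' by (auto simp: upd_def pst_def)
      then show ?thesis using b[of q f q'] vge[of q] False by auto
    qed
  qed
  assume fl: "flash x y cd"
  have "val g' (upd x y cd) \<le> val g cd - 1"
  proof (rule vle)
    fix q' assume "q' \<in> fst (upd x y cd)"
    then have "q' \<in> pst x y (snd cd) \<union> pm x y (fst cd)" using fl by (simp add: upd_def flash_def)
    from D[OF this] show "g' q' + of_bool (q' \<in> snd (upd x y cd)) \<le> val g cd - 1"
      using fl by (simp add: upd_def)
  qed
  \<comment> \<open>The subtraction above is truncated, so the strict drop needs positivity.\<close>
  moreover have "0 < val g cd" using D ne fl by (fastforce simp: upd_def flash_def)
  ultimately show "val g' (upd x y cd) < val g cd" by linarith
qed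

section \<open>The strategy of lexicographically minimal budgets\<close>

context
  fixes G :: "('q \<Rightarrow> nat) set" and gs :: "('q set \<times> 'q set) list \<Rightarrow> 'q \<Rightarrow> nat"
    and ys :: "('q set \<times> 'q set) list \<Rightarrow> 'x \<Rightarrow> 'y" and gn :: "('q set \<times> 'q set) list \<Rightarrow> 'x \<Rightarrow> 'q \<Rightarrow> nat"
  assumes eps: "\<And>g. g \<in> G \<Longrightarrow> eps_ok g"
    and gs: "\<And>\<tau>. \<exists>g\<in>G. fits g \<tau> \<Longrightarrow> gs \<tau> \<in> G \<and> fits (gs \<tau>) \<tau> \<and>
        (\<forall>g\<in>G. fits g \<tau> \<longrightarrow> (\<forall>j<length \<tau>. (\<forall>i<j. val g (\<tau> ! i) = val (gs \<tau>) (\<tau> ! i)) \<longrightarrow> val (gs \<tau>) (\<tau> ! j) \<le> val g (\<tau> ! j)))"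
    and gn: "\<And>\<tau> x. \<exists>g\<in>G. fits g \<tau> \<Longrightarrow> x \<in> X \<Longrightarrow> ys \<tau> x \<in> Y x \<and> gn \<tau> x \<in> G \<and> move_ok (gs \<tau>) x (ys \<tau> x) (gn \<tau> x)"
begin

definition mem_ok :: "('q set \<times> 'q set) list \<Rightarrow> bool" where
  "mem_ok \<tau> \<longleftrightarrow> wfm \<tau> \<and> (\<exists>g\<in>G. fits g \<tau>)"

lemma mem_ok_nxt:
  assumes "mem_ok \<tau>" "x \<in> X"
  shows "mem_ok (nxt x (ys \<tau> x) \<tau>)" "fits (gn \<tau> x) (nxt x (ys \<tau> x) \<tau>)"
proof -
  have g: "\<exists>g\<in>G. fits g \<tau>" using assms unfolding mem_ok_def by blast
  show 1: "fits (gn \<tau> x) (nxt x (ys \<tau> x) \<tau>)"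
    using fits_nxt[of \<tau> "gs \<tau>" x "ys \<tau> x" "gn \<tau> x"] gs[OF g] gn[OF g assms(2)] eps assms(1) unfolding mem_ok_def by blast
  show "mem_ok (nxt x (ys \<tau> x) \<tau>)"
    using 1 gn[OF g assms(2)] wfm_nxt assms(1) unfolding mem_ok_def by blast
qed

text \<open>A tracked run finally sits in an entry that is never removed. By minimality this entry
  has finitely many breakpoints, so from some time on D is a proper subset of C. At the next mark
  the run enters D, a copy of which is tracked from then on. Repeating the argument encloses the run
  in ever smaller sets.\<close>

lemma no_accepting_run:
  assumes \<tau>0: "mem_ok (\<tau> 0)" and x: "\<And>i. x i \<in> X"
    and \<tau>: "\<And>i. \<tau> (Suc i) = nxt (x i) (ys (\<tau> i) (x i)) (\<tau> i)"
    and q: "\<And>i. st (x i) (ys (\<tau> i) (x i)) (q i) (f i) (q (Suc i))"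
    and inf: "\<exists>\<^sub>\<infinity>i. f i" and q0: "cd \<in> set (\<tau> 0)" "q 0 \<in> fst cd"
  shows False
proof -
  define y where "y i = ys (\<tau> i) (x i)" for i
  define C where "C i p = fst (\<tau> i ! p)" for i p
  define U where "U i = upd (x i) (y i)" for i
  \<comment> \<open>Stability at time i means that the entries up to p are exactly the updated ones,
    with nothing removed among them.\<close>
  define stable where "stable i p \<longleftrightarrow> p < length (\<tau> i) \<and> take (Suc p) (\<tau> (Suc i)) = take (Suc p) (map (U i) (\<tau> i))" for i p
  define fl where "fl i p \<longleftrightarrow> flash (x i) (y i) (\<tau> i ! p)" for i p
  have ok: "mem_ok (\<tau> i)" for i
    by (induction i) (use \<tau>0 \<tau> x mem_ok_nxt in auto)
  have qpst: "q (Suc i) \<in> pst (x i) (y i) S" if "q i \<in> S" for i S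
    using q[of i] that unfolding pst_def y_def by blast

  have stableD: "\<tau> (Suc i) ! j = U i (\<tau> i ! j)" "j < length (\<tau> (Suc i))" if "stable i p" "j \<le> p" for i p j
  proof -
    have l: "p < length (\<tau> i)" and t: "take (Suc p) (\<tau> (Suc i)) = take (Suc p) (map (U i) (\<tau> i))"
      using that unfolding stable_def by auto
    have "length (take (Suc p) (\<tau> (Suc i))) = Suc p" unfolding t using l by simp
    then show "j < length (\<tau> (Suc i))" using that(2) by simp
    have "take (Suc p) (\<tau> (Suc i)) ! j = take (Suc p) (map (U i) (\<tau> i)) ! j" unfolding t ..
    then show "\<tau> (Suc i) ! j = U i (\<tau> i ! j)" using that(2) l by simp
  qed

  have follow_raw: "\<exists>p'\<le>p. p' < length (\<tau> (Suc i)) \<and> C (Suc i) p' = fst (l ! p) \<and> (p' = p \<longrightarrow> take (Suc p) (\<tau> (Suc i)) = take (Suc p) l)"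
    if "l = map (U i) (\<tau> i) @ map (\<lambda>cd. (snd (U i cd), {})) (\<tau> i)" "p < length l" "q (Suc i) \<in> fst (l ! p)" for i p l
    using nrm_follow[of p l "{}"] that \<tau>[of i] unfolding C_def U_def nxt_def y_def by auto

  have follow_step: "\<exists>p'\<le>p. p' < length (\<tau> (Suc i)) \<and> C (Suc i) p' = pst (x i) (y i) (C i p) \<and> (p' = p \<longrightarrow> stable i p)"
    if p: "p < length (\<tau> i)" and qi: "q i \<in> C i p" for i p
  proof -
    let ?l = "map (U i) (\<tau> i) @ map (\<lambda>cd. (snd (U i cd), {})) (\<tau> i)"
    have l: "?l ! p = U i (\<tau> i ! p)" using p by (simp add: nth_append)
    have "fst (U i (\<tau> i ! p)) = pst (x i) (y i) (C i p)" by (simp add: U_def upd_def C_def)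
    moreover have "take (Suc p) ?l = take (Suc p) (map (U i) (\<tau> i))" using p by simp
    ultimately show ?thesis using follow_raw[OF refl, of p i] qpst[OF qi] p l unfolding stable_def by auto
  qed

  \<comment> \<open>\<open>B\<close> is a family of sets that successors do not leave. It is
    instantiated with Q at the start and with the sets D in the descent. The position of the run's
    entry can fall only finitely often.\<close>
  have follow: "\<exists>T\<ge>i0. \<exists>p'. \<forall>i\<ge>T. stable i p' \<and> q i \<in> C i p' \<and> C i p' \<subseteq> B i"
    if "\<forall>i\<ge>i0. pst (x i) (y i) (B i) \<subseteq> B (Suc i)" "p < length (\<tau> i0)" "q i0 \<in> C i0 p" "C i0 p \<subseteq> B i0" for i0 p B
    using that
  proof (induction p arbitrary: i0 rule: less_induct)
    case (less p)
    show ?case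
    proof (cases "\<exists>i\<ge>i0. \<exists>p'<p. p' < length (\<tau> i) \<and> q i \<in> C i p' \<and> C i p' \<subseteq> B i")
      case True
      then obtain i p' where i: "i \<ge> i0" "p' < p" "p' < length (\<tau> i)" "q i \<in> C i p'" "C i p' \<subseteq> B i" by blast
      have "\<forall>j\<ge>i. pst (x j) (y j) (B j) \<subseteq> B (Suc j)" using less.prems(1) i(1) by auto
      from less.IH[OF i(2) this i(3-5)] show ?thesis using i(1) order_trans by blast
    next
      case False
      have "p < length (\<tau> i) \<and> q i \<in> C i p \<and> C i p \<subseteq> B i \<and> stable i p" if "i \<ge> i0" for i
        using that
      proof (induction rule: nat_induct_at_least)
        case base
        obtain p' where p': "p' \<le> p" "p' < length (\<tau> (Suc i0))" "C (Suc i0) p' = pst (x i0) (y i0) (C i0 p)" "p' = p \<longrightarrow> stable i0 p"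
          using follow_step[OF less.prems(2,3)] by blast
        have "C (Suc i0) p' \<subseteq> B (Suc i0)" using p'(3) pst_mono[OF less.prems(4)] less.prems(1) by blast
        then have "\<not> p' < p" using False p' qpst[OF less.prems(3)] by (metis le_Suc_eq order_refl)
        then show ?case using p' less.prems by simp
      next
        case (Suc i)
        then have st: "stable i p" and qi: "q i \<in> C i p" and CB: "C i p \<subseteq> B i" by auto
        have eq: "C (Suc i) p = pst (x i) (y i) (C i p)" "p < length (\<tau> (Suc i))"
          using stableD[OF st order_refl] unfolding C_def U_def upd_def by auto
        have 1: "q (Suc i) \<in> C (Suc i) p" using qpst[OF qi] eq by simp
        have 2: "C (Suc i) p \<subseteq> B (Suc i)" using eq pst_mono[OF CB] less.prems(1) Suc by blast
        obtain p' where p': "p' \<le> p" "p' < length (\<tau> (Suc (Suc i)))"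
          "C (Suc (Suc i)) p' = pst (x (Suc i)) (y (Suc i)) (C (Suc i) p)" "p' = p \<longrightarrow> stable (Suc i) p"
          using follow_step[OF eq(2) 1] by blast
        have "C (Suc (Suc i)) p' \<subseteq> B (Suc (Suc i))" using p'(3) pst_mono[OF 2, of "x (Suc i)" "y (Suc i)"] less.prems(1)[rule_format, of "Suc i"] Suc.hyps by simp
        then have "\<not> p' < p" using False p' qpst[OF 1] Suc.hyps by (metis le_Suc_eq)
        then show ?case using p' 1 2 eq by simp
      qed
      then show ?thesis by blast
    qed
  qed

  \<comment> \<open>The successor budget \<open>gn\<close> competes with the budget
    \<open>gs\<close> chosen at the next memory, and by \<open>val_upd\<close> its values are no
    larger than the current ones. So the chosen value vectors on the stable prefix descend
    lexicographically, strictly at a breakpoint unless an older coordinate drops.\<close>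
  have finitely_flashing: "\<exists>T'\<ge>T. \<forall>i\<ge>T'. \<not> fl i p" if st: "\<forall>i\<ge>T. stable i p" for T p
  proof -
    define s where "s i j = val (gs (\<tau> i)) (\<tau> i ! j)" for i j
    define v where "v i j = val (gn (\<tau> i) (x i)) (\<tau> (Suc i) ! j)" for i j
    have ex: "\<exists>g\<in>G. fits g (\<tau> i)" for i using ok unfolding mem_ok_def by blast
    have vs: "v i j \<le> s i j" "fl i j \<Longrightarrow> v i j < s i j" if i: "i \<ge> T" and j: "j \<le> p" for i j
    proof -
      have jl: "j < length (\<tau> i)" using st i j unfolding stable_def by auto
      have e: "\<tau> (Suc i) ! j = upd (x i) (y i) (\<tau> i ! j)" "j < length (\<tau> (Suc i))"
        using stableD[of i p j] st i j unfolding U_def by auto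
      have m: "\<tau> i ! j \<in> set (\<tau> i)" "\<tau> (Suc i) ! j \<in> set (\<tau> (Suc i))" using jl e(2) by auto
      have a: "fst (\<tau> i ! j) \<subseteq> Q" "snd (\<tau> i ! j) \<subseteq> fst (\<tau> i ! j)" "fst (upd (x i) (y i) (\<tau> i ! j)) \<noteq> {}"
        using m ok[of i] ok[of "Suc i"] e(1) unfolding mem_ok_def wfm_def by metis+
      have b: "0 < gs (\<tau> i) r" if "r \<in> fst (\<tau> i ! j)" for r
        using gs[OF ex] m(1) that unfolding fits_def by blast
      have c: "eps_ok (gs (\<tau> i))" "move_ok (gs (\<tau> i)) (x i) (y i) (gn (\<tau> i) (x i))"
        using gs[OF ex] eps gn[OF ex x] unfolding y_def by auto
      from val_upd[OF a(1,2) b c a(3)] show "v i j \<le> s i j" "fl i j \<Longrightarrow> v i j < s i j"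
        unfolding v_def s_def e fl_def by auto
    qed
    have lex: "s (Suc i) j \<le> v i j" if "i \<ge> T" "j \<le> p" "\<forall>j'<j. v i j' = s (Suc i) j'" for i j
    proof -
      have "j < length (\<tau> (Suc i))" using stableD[of i p j] st that by auto
      moreover have "gn (\<tau> i) (x i) \<in> G" using gn[OF ex x] by blast
      moreover have "fits (gn (\<tau> i) (x i)) (\<tau> (Suc i))" using mem_ok_nxt(2)[OF ok x] \<tau> by simp
      ultimately show ?thesis using gs[OF ex, of "Suc i"] that(3) unfolding v_def s_def by blast
    qed
    \<comment> \<open>If the chosen values up to j do not change, \<open>v\<close> is squeezed
      between the next and the present values.\<close>
    have chain: "v i j = s (Suc i) j" if i: "i \<ge> T" and j: "j \<le> p" "\<forall>j'\<le>j. s (Suc i) j' = s i j'" for i j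
      using j
    proof (induction j rule: less_induct)
      case (less j)
      have "\<forall>j'<j. v i j' = s (Suc i) j'"
      proof (intro allI impI)
        fix j' assume "j' < j"
        then show "v i j' = s (Suc i) j'" using less.IH[of j'] less.prems by auto
      qed
      from lex[OF i less.prems(1) this] vs(1)[OF i less.prems(1)] show ?case using less.prems(2) by auto
    qed
    \<comment> \<open>Once all coordinates before j are constant, coordinate j cannot rise any more
      and therefore stabilises too.\<close>
    have const: "\<exists>T'\<ge>T. \<forall>i\<ge>T'. s (Suc i) j = s i j" if "j \<le> p" for j
      using that
    proof (induction j rule: less_induct)
      case (less j)
      have "\<forall>j'\<in>{..<j}. \<exists>T'. \<forall>i\<ge>T'. s (Suc i) j' = s i j'" using less.IH less.prems by fastforce
      then have "\<exists>t. \<forall>j'\<in>{..<j}. \<forall>i\<ge>t j'. s (Suc i) j' = s i j'" by (rule bchoice)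
      then obtain t where t: "\<And>j' i. j' < j \<Longrightarrow> i \<ge> t j' \<Longrightarrow> s (Suc i) j' = s i j'" by blast
      define T' where "T' = T + (\<Sum>j'<j. t j')"
      have tT: "t j' \<le> T'" if "j' < j" for j'
        unfolding T'_def using member_le_sum[of j' "{..<j}" t] that by simp
      have "s (Suc i) j \<le> s i j" if "i \<ge> T'" for i
      proof -
        have i: "i \<ge> T" using that unfolding T'_def by simp
        have "\<forall>j'<j. v i j' = s (Suc i) j'"
        proof (intro allI impI)
          fix j' assume j': "j' < j"
          have "\<forall>j''\<le>j'. s (Suc i) j'' = s i j''" using t tT j' that by (meson le_less_trans order_trans)
          then show "v i j' = s (Suc i) j'" using chain[OF i, of j'] j' less.prems by simp
        qed
        from lex[OF i less.prems this] vs(1)[OF i less.prems] show ?thesis by simp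
      qed
      then show ?case using nat_nonincreasing_stabilises[of T' "\<lambda>i. s i j"] unfolding T'_def
        by (meson add_leE)
    qed
    then have "\<forall>j\<in>{..p}. \<exists>T'. \<forall>i\<ge>T'. s (Suc i) j = s i j" by blast
    then have "\<exists>t. \<forall>j\<in>{..p}. \<forall>i\<ge>t j. s (Suc i) j = s i j" by (rule bchoice)
    then obtain t where t: "\<And>j i. j \<le> p \<Longrightarrow> i \<ge> t j \<Longrightarrow> s (Suc i) j = s i j" by blast
    define T' where "T' = T + (\<Sum>j\<le>p. t j)"
    have tT: "t j \<le> T'" if "j \<le> p" for j
      unfolding T'_def using member_le_sum[of j "{..p}" t] that by simp
    have "\<not> fl i p" if "i \<ge> T'" for i
    proof
      assume f: "fl i p"
      have i: "i \<ge> T" using that unfolding T'_def by simp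
      have "\<forall>j\<le>p. s (Suc i) j = s i j" using t tT that by (meson order_trans)
      then have "v i p = s i p" using chain[OF i order_refl] by simp
      then show False using vs(2)[OF i order_refl f] by simp
    qed
    then show ?thesis unfolding T'_def by (meson le_add1)
  qed

  \<comment> \<open>At d = \<open>card Q\<close> the set around the run would have to be
    empty.\<close>
  have descend: "\<exists>T p. \<forall>i\<ge>T. stable i p \<and> q i \<in> C i p \<and> card (C i p) + d \<le> card Q" for d
  proof (induction d)
    case 0
    obtain p where p: "p < length (\<tau> 0)" "q 0 \<in> C 0 p" using q0 unfolding C_def by (metis in_set_conv_nth)
    have "C 0 p \<subseteq> Q" using p ok[of 0] unfolding mem_ok_def wfm_def C_def by simp
    then obtain T p' where "\<forall>i\<ge>T. stable i p' \<and> q i \<in> C i p' \<and> C i p' \<subseteq> Q"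
      using follow[of 0 "\<lambda>_. Q" p] p pst_Q by auto
    then show ?case using card_mono[OF finQ] by (intro exI[of _ T] exI[of _ p']) auto
  next
    case (Suc d)
    then obtain T p where T: "\<And>i. i \<ge> T \<Longrightarrow> stable i p" "\<And>i. i \<ge> T \<Longrightarrow> q i \<in> C i p" "\<And>i. i \<ge> T \<Longrightarrow> card (C i p) + d \<le> card Q"
      by blast
    obtain T1 where T1: "T1 \<ge> T" "\<And>i. i \<ge> T1 \<Longrightarrow> \<not> fl i p" using finitely_flashing T(1) by blast
    define D where "D i = snd (\<tau> i ! p)" for i
    have D_step: "D (Suc i) = pst (x i) (y i) (D i) \<union> pm (x i) (y i) (C i p)" "D (Suc i) \<noteq> C (Suc i) p" if "i \<ge> T1" for i
    proof -
      have "\<tau> (Suc i) ! p = U i (\<tau> i ! p)" using stableD[of i p p] T(1) T1(1) that by auto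
      moreover have "\<not> fl i p" using T1(2) that by blast
      ultimately show "D (Suc i) = pst (x i) (y i) (D i) \<union> pm (x i) (y i) (C i p)" "D (Suc i) \<noteq> C (Suc i) p"
        unfolding D_def C_def U_def upd_def fl_def flash_def by auto
    qed
    obtain i1 where i1: "i1 > T1" "f i1" using inf unfolding INFM_nat by blast
    have qD: "q (Suc i1) \<in> D (Suc i1)"
      using D_step(1)[of i1] i1 q[of i1] T(2)[of i1] T1(1) unfolding pm_def y_def by auto
    have pl: "p < length (\<tau> i1)" using T(1)[of i1] i1 T1(1) unfolding stable_def by auto
    let ?l = "map (U i1) (\<tau> i1) @ map (\<lambda>cd. (snd (U i1 cd), {})) (\<tau> i1)"
    \<comment> \<open>Before normalisation the copies of the sets D start at position
      \<open>length (\<tau> i1)\<close>, in the order of their parents.\<close>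
    have "?l ! (length (\<tau> i1) + p) = (snd (U i1 (\<tau> i1 ! p)), {})" using pl by (simp add: nth_append)
    also have "snd (U i1 (\<tau> i1 ! p)) = D (Suc i1)"
      using stableD[of i1 p p] T(1) T1(1) i1 unfolding D_def by simp
    finally obtain p1 where p1: "p1 < length (\<tau> (Suc i1))" "C (Suc i1) p1 = D (Suc i1)"
      using follow_raw[OF refl, of "length (\<tau> i1) + p" i1] qD pl by auto
    have "\<forall>i\<ge>Suc i1. pst (x i) (y i) (D i) \<subseteq> D (Suc i)" using D_step(1) i1 by auto
    then obtain T2 p2 where T2: "T2 \<ge> Suc i1" "\<forall>i\<ge>T2. stable i p2 \<and> q i \<in> C i p2 \<and> C i p2 \<subseteq> D i"
      using follow[of "Suc i1" D p1] p1 qD by auto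
    have "card (C i p2) + Suc d \<le> card Q" if i: "i \<ge> T2" for i
    proof -
      obtain i' where i': "i = Suc i'" "i' \<ge> T1" using i T2(1) i1 by (cases i) auto
      have in\<tau>: "\<tau> i ! p \<in> set (\<tau> i)" using T(1)[of i] i' T1(1) unfolding stable_def by auto
      have sub: "D i \<subseteq> C i p" "C i p \<subseteq> Q"
        using in\<tau> ok[of i] unfolding D_def C_def mem_ok_def wfm_def by blast+
      have "D i \<noteq> C i p" using D_step(2)[OF i'(2)] i'(1) by simp
      then have "C i p2 \<subset> C i p" using T2(2) i sub by blast
      then have "card (C i p2) < card (C i p)" using finite_subset[OF sub(2) finQ] by (rule psubset_card_mono[rotated])
      then show ?thesis using T(3)[of i] i' T1(1) by simp
    qed
    then show ?case using T2 by (intro exI[of _ T2] exI[of _ p2]) auto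
  qed
  obtain T p where "\<forall>i\<ge>T. stable i p \<and> q i \<in> C i p \<and> card (C i p) + card Q \<le> card Q" using descend[of "card Q"] by blast
  then have T: "stable T p" "q T \<in> C T p" "card (C T p) = 0" by auto
  have "\<tau> T ! p \<in> set (\<tau> T)" using T(1) unfolding stable_def by simp
  then have "C T p \<subseteq> Q" using ok[of T] unfolding C_def mem_ok_def wfm_def by blast
  then show False using T finite_subset[OF _ finQ] by auto
qed

end

section \<open>Counting memories and bounding the budgets\<close>

lemma card_memories: "finite {\<tau>. wfm \<tau>}" "card {\<tau>. wfm \<tau>} \<le> (2 ^ card Q * 2 ^ card Q + 1) ^ (2 ^ card Q)"
proof -
  let ?A = "Pow Q \<times> Pow Q"
  have sub: "{\<tau>. wfm \<tau>} \<subseteq> {\<tau>. set \<tau> \<subseteq> ?A \<and> length \<tau> \<le> 2 ^ card Q}"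
  proof
    fix \<tau> assume "\<tau> \<in> {\<tau>. wfm \<tau>}"
    then have w: "\<And>cd. cd \<in> set \<tau> \<Longrightarrow> fst cd \<subseteq> Q \<and> snd cd \<subseteq> fst cd" "distinct (map fst \<tau>)"
      unfolding wfm_def by auto
    have "length \<tau> = card (fst ` set \<tau>)" using distinct_card[OF w(2)] by simp
    also have "\<dots> \<le> card (Pow Q)" using w(1) finQ by (intro card_mono) auto
    finally have "length \<tau> \<le> 2 ^ card Q" using finQ by (simp add: card_Pow)
    moreover have "set \<tau> \<subseteq> ?A"
    proof
      fix cd assume "cd \<in> set \<tau>"
      from w(1)[OF this] show "cd \<in> ?A" by (cases cd) auto
    qed
    ultimately show "\<tau> \<in> {\<tau>. set \<tau> \<subseteq> ?A \<and> length \<tau> \<le> 2 ^ card Q}" by simp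
  qed
  have fA: "finite ?A" using finQ by simp
  have f: "finite {\<tau>. set \<tau> \<subseteq> ?A \<and> length \<tau> \<le> 2 ^ card Q}" using finite_lists_length_le[OF fA] .
  show "finite {\<tau>. wfm \<tau>}" using finite_subset[OF sub f] .
  have geo: "(\<Sum>i\<le>m. a ^ i) \<le> (a + 1) ^ m" for a m :: nat
  proof (induction m)
    case (Suc m)
    have "a ^ m \<le> (a + 1) ^ m" by (intro power_mono) auto
    then show ?case using Suc by (simp add: add_mono)
  qed simp
  have "card {\<tau>. wfm \<tau>} \<le> (\<Sum>i\<le>2 ^ card Q. card ?A ^ i)"
    using card_mono[OF f sub] card_lists_length_le[OF fA] by simp
  also have "\<dots> \<le> (card ?A + 1) ^ (2 ^ card Q)" by (rule geo)
  finally show "card {\<tau>. wfm \<tau>} \<le> (2 ^ card Q * 2 ^ card Q + 1) ^ (2 ^ card Q)"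
    using finQ by (simp add: card_Pow card_cartesian_product)
qed

text \<open>The strategy depends on the memory alone, so it can be evaluated in the finite product
  of memories and states. The new budgets are one more than the maximal number of marks on paths
  there. They are positive initially because \<open>no_accepting_run\<close> excludes live initial
  vertices.\<close>

theorem bounded_family:
  assumes cl: "closed_fam G" and g0: "g0 \<in> G" and I: "I \<subseteq> Q" "\<And>q. q \<in> I \<Longrightarrow> 0 < g0 q"
  shows "\<exists>G'. closed_fam G' \<and> (\<exists>g\<in>G'. \<forall>q\<in>I. 0 < g q) \<and> (\<forall>g\<in>G'. \<forall>q. g q \<le> Suc (bnd (card Q)) \<and> (q \<notin> Q \<longrightarrow> g q = 0))"
proof -
  define least where "least \<tau> z \<longleftrightarrow> z \<in> G \<and> fits z \<tau> \<and> (\<forall>g\<in>G. fits g \<tau> \<longrightarrow>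
      (\<forall>j<length \<tau>. (\<forall>i<j. val g (\<tau> ! i) = val z (\<tau> ! i)) \<longrightarrow> val z (\<tau> ! j) \<le> val g (\<tau> ! j)))" for \<tau> z
  have "\<exists>z. least \<tau> z" if "\<exists>g\<in>G. fits g \<tau>" for \<tau>
  proof -
    have "{g \<in> G. fits g \<tau>} \<noteq> {}" using that by blast
    from lexmin_exists[OF this, of "length \<tau>" "\<lambda>g i. val g (\<tau> ! i)"]
    show ?thesis unfolding least_def by auto
  qed
  then obtain gs where "\<And>\<tau>. \<exists>g\<in>G. fits g \<tau> \<Longrightarrow> least \<tau> (gs \<tau>)" by metis
  note gs = this[unfolded least_def]
  have "\<exists>y g'. (\<exists>g\<in>G. fits g \<tau>) \<longrightarrow> x \<in> X \<longrightarrow> y \<in> Y x \<and> g' \<in> G \<and> move_ok (gs \<tau>) x y g'" for \<tau> x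
  proof (cases "(\<exists>g\<in>G. fits g \<tau>) \<and> x \<in> X")
    case True
    then have "gs \<tau> \<in> G" using gs by blast
    then show ?thesis using cl True unfolding closed_fam_def by blast
  qed blast
  then obtain ys gn where gn: "\<And>\<tau> x. \<exists>g\<in>G. fits g \<tau> \<Longrightarrow> x \<in> X \<Longrightarrow> ys \<tau> x \<in> Y x \<and> gn \<tau> x \<in> G \<and> move_ok (gs \<tau>) x (ys \<tau> x) (gn \<tau> x)"
    by metis
  have eps: "\<And>g. g \<in> G \<Longrightarrow> eps_ok g" using cl unfolding closed_fam_def by blast
  let ?ok = "\<lambda>\<tau>. wfm \<tau> \<and> (\<exists>g\<in>G. fits g \<tau>)"
  have okd: "mem_ok G \<tau> = ?ok \<tau>" for \<tau> using mem_ok_def[OF eps gs gn] .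
  have ok_nxt: "?ok (nxt x (ys \<tau> x) \<tau>)" if "?ok \<tau>" "x \<in> X" for x \<tau>
    using mem_ok_nxt(1)[OF eps gs gn, of \<tau> x] that okd by simp
  define V where "V = {\<tau>. wfm \<tau>} \<times> Q"
  define E where "E = (\<lambda>v f u. ?ok (fst v) \<and> (\<exists>x\<in>X. fst u = nxt x (ys (fst v) x) (fst v) \<and> st x (ys (fst v) x) (snd v) f (snd u)))"
  have finV: "finite V" unfolding V_def using card_memories(1) finQ by simp
  have EV: "\<forall>v f u. E v f u \<longrightarrow> u \<in> V" unfolding E_def V_def using wfm_nxt st_Q by (auto simp: mem_Times_iff)
  have cV: "card V \<le> bnd (card Q)"
    unfolding V_def bnd_def card_cartesian_product using card_memories(2) by (simp add: mult.commute)
  define h where "h \<tau> q = (if q \<in> Q \<and> \<not> live E (\<tau>, q) then Suc (maxmarks E (\<tau>, q)) else 0)" for \<tau> q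
  define G' where "G' = {h \<tau> | \<tau>. ?ok \<tau>}"
  \<comment> \<open>The whole initial set is tracked as one entry; a memory may not contain the
    empty set, hence the case distinction.\<close>
  define \<tau>0 where "\<tau>0 = (if I = {} then [] else [(I, {} :: 'q set)])"
  have "fits g0 \<tau>0" using I unfolding \<tau>0_def fits_def by auto
  moreover have "wfm \<tau>0" using I unfolding \<tau>0_def wfm_def by auto
  ultimately have "?ok \<tau>0" using g0 by blast
  have init: "0 < h \<tau>0 q" if q: "q \<in> I" for q
  proof -
    have "\<not> live E (\<tau>0, q)"
    proof
      assume "live E (\<tau>0, q)"
      then obtain s fs where s: "s 0 = (\<tau>0, q)" "\<And>i. E (s i) (fs i) (s (Suc i))" "\<exists>\<^sub>\<infinity>i. fs i" unfolding live_def by blast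
      then obtain x where x: "\<And>i. x i \<in> X" "\<And>i. fst (s (Suc i)) = nxt (x i) (ys (fst (s i)) (x i)) (fst (s i))"
        "\<And>i. st (x i) (ys (fst (s i)) (x i)) (snd (s i)) (fs i) (snd (s (Suc i)))"
        unfolding E_def by metis
      have "mem_ok G (fst (s 0))" using s(1) \<open>?ok \<tau>0\<close> okd by simp
      moreover have "(I, {}) \<in> set (fst (s 0))" "snd (s 0) \<in> fst (I, {})" using s(1) q unfolding \<tau>0_def by auto
      ultimately show False
        using no_accepting_run[OF eps gs gn, of "\<lambda>i. fst (s i)" x "\<lambda>i. snd (s i)" fs] x s(3) by blast
    qed
    then show ?thesis using I q unfolding h_def by auto
  qed
  have "eps_ok (h \<tau>)" if "?ok \<tau>" for \<tau>
    unfolding eps_ok_def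
  proof (intro allI impI)
    fix q q' assume a: "0 < h \<tau> q \<and> ep q q'"
    then have nl: "\<not> live E (\<tau>, q)" "q \<in> Q" unfolding h_def by (auto split: if_splits)
    \<comment> \<open>\<open>st\<close> begins with epsilon steps, so whatever q' can do after the
      step from q to q', q can do as well.\<close>
    have sub: "E (\<tau>, q) f u" if "E (\<tau>, q') f u" for f u
      using that a unfolding E_def st_def by (auto intro: converse_rtranclp_into_rtranclp)
    have "\<not> live E (\<tau>, q')"
    proof
      assume "live E (\<tau>, q')"
      then obtain s fs where s: "s 0 = (\<tau>, q')" "\<And>i. E (s i) (fs i) (s (Suc i))" "\<exists>\<^sub>\<infinity>i. fs i" unfolding live_def by blast
      have "E ((s(0 := (\<tau>, q))) i) (fs i) ((s(0 := (\<tau>, q))) (Suc i))" for i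
        using s(1) s(2)[of i] sub by (cases i) auto
      then show False using nl(1) s(3) unfolding live_def by (metis fun_upd_same)
    qed
    moreover from maxmarks(3)[OF finV EV this] obtain w where "pth E (\<tau>, q') (maxmarks E (\<tau>, q')) w" by blast
    then have "maxmarks E (\<tau>, q') \<le> maxmarks E (\<tau>, q)"
    proof (cases rule: pth.cases)
      case (pth_step f u n)
      have "pth E (\<tau>, q) (n + of_bool f) w" using pth.pth_step[of E "(\<tau>, q)" f u n w] sub pth_step by blast
      then show ?thesis using maxmarks(2)[OF finV EV nl(1)] pth_step by simp
    qed auto
    ultimately show "0 < h \<tau> q' \<and> h \<tau> q' \<le> h \<tau> q" using a epQ nl unfolding h_def by auto
  qed
  moreover have "move_ok (h \<tau>) x (ys \<tau> x) (h (nxt x (ys \<tau> x) \<tau>))" if "?ok \<tau>" "x \<in> X" for \<tau> x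
    unfolding move_ok_def
  proof (intro allI impI)
    fix q q' assume a: "0 < h \<tau> q \<and> tr x (ys \<tau> x) q q'"
    then have nl: "\<not> live E (\<tau>, q)" "q \<in> Q" unfolding h_def by (auto split: if_splits)
    have "E (\<tau>, q) (mk x q) (nxt x (ys \<tau> x) \<tau>, q')" using a that unfolding E_def st_def by auto
    from maxmarks_step[OF finV EV nl(1) this]
    show "0 < h (nxt x (ys \<tau> x) \<tau>) q' \<and> h (nxt x (ys \<tau> x) \<tau>) q' + of_bool (mk x q) \<le> h \<tau> q"
      using a nl trQ unfolding h_def by auto
  qed
  ultimately have "closed_fam G'" unfolding closed_fam_def G'_def using gn ok_nxt by blast
  moreover have "\<exists>g\<in>G'. \<forall>q\<in>I. 0 < g q" unfolding G'_def using \<open>?ok \<tau>0\<close> init by blast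
  moreover have "h \<tau> q \<le> Suc (bnd (card Q)) \<and> (q \<notin> Q \<longrightarrow> h \<tau> q = 0)" for \<tau> q
    unfolding h_def using maxmarks(1)[OF finV EV, of "(\<tau>, q)"] cV by auto
  ultimately show ?thesis by (intro exI[of _ G']) (auto simp: G'_def)
qed

end

section \<open>Clock regions and grid points\<close>

text \<open>Region equivalence with diagonal constraints on the first K coordinates. Constants are
  natural numbers: negative differences arise by exchanging x and y, and negative bounds on single
  clocks are settled by nonnegativity.\<close>

definition req :: "nat \<Rightarrow> nat \<Rightarrow> (nat \<Rightarrow> real) \<Rightarrow> (nat \<Rightarrow> real) \<Rightarrow> bool" where
  "req K c w w' \<longleftrightarrow>
     (\<forall>x<K. \<forall>z\<le>c. (w x < real z \<longleftrightarrow> w' x < real z) \<and> (real z < w x \<longleftrightarrow> real z < w' x)) \<and>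
     (\<forall>x<K. \<forall>y<K. \<forall>z\<le>c. (w x < w y + real z \<longleftrightarrow> w' x < w' y + real z) \<and> (w y + real z < w x \<longleftrightarrow> w' y + real z < w' x))"

definition nonneg :: "(nat \<Rightarrow> real) \<Rightarrow> bool" where
  "nonneg w \<longleftrightarrow> (\<forall>x. 0 \<le> w x)"

definition rst :: "nat set \<Rightarrow> (nat \<Rightarrow> real) \<Rightarrow> nat \<Rightarrow> real" where
  "rst R w = (\<lambda>x. if x \<in> R then 0 else w x)"

lemma req_sym: "req K c w w' \<Longrightarrow> req K c w' w" unfolding req_def by simp

lemma req_trans: "req K c w w' \<Longrightarrow> req K c w' w'' \<Longrightarrow> req K c w w''" unfolding req_def by simp

lemma req1: "req K c w w' \<Longrightarrow> x < K \<Longrightarrow> z \<le> c \<Longrightarrow> (w x < real z \<longleftrightarrow> w' x < real z) \<and> (real z < w x \<longleftrightarrow> real z < w' x)"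
  unfolding req_def by blast

lemma req2: "req K c w w' \<Longrightarrow> x < K \<Longrightarrow> y < K \<Longrightarrow> z \<le> c \<Longrightarrow>
    (w x < w y + real z \<longleftrightarrow> w' x < w' y + real z) \<and> (w y + real z < w x \<longleftrightarrow> w' y + real z < w' x)"
  unfolding req_def by blast

lemma req1_int:
  assumes "req K c w w'" "nonneg w" "nonneg w'" "x < K" "\<bar>z\<bar> \<le> int c"
  shows "(w x < of_int z \<longleftrightarrow> w' x < of_int z) \<and> (of_int z < w x \<longleftrightarrow> of_int z < w' x)"
proof (cases "z \<ge> 0")
  case True
  then obtain n where n: "z = int n" using nonneg_int_cases by blast
  then show ?thesis using req1[OF assms(1,4), of n] assms(5) by simp
next
  case False
  then have "(of_int z :: real) < 0" by simp
  then show ?thesis using assms(2,3) unfolding nonneg_def by (smt (verit))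
qed

lemma req2_int:
  assumes "req K c w w'" "x < K" "y < K" "\<bar>z\<bar> \<le> int c"
  shows "(w x - w y < of_int z \<longleftrightarrow> w' x - w' y < of_int z) \<and> (of_int z < w x - w y \<longleftrightarrow> of_int z < w' x - w' y)"
proof (cases "z \<ge> 0")
  case True
  then obtain n where n: "z = int n" using nonneg_int_cases by blast
  then show ?thesis using req2[OF assms(1,2,3), of n] assms(4) by (simp add: algebra_simps)
next
  case False
  then obtain n where n: "z = - int n" using nonpos_int_cases[of z] by auto
  then show ?thesis using req2[OF assms(1,3,2), of n] assms(4) by (simp add: algebra_simps)
qed

lemma cmp_sem_cong:
  "((a < z) = (a' < z)) \<Longrightarrow> ((z < a) = (z < a')) \<Longrightarrow> cmp_sem c a z = cmp_sem c a' z"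
  by (cases c) auto

lemma sat_req:
  assumes "req K c w w'" "nonneg w" "nonneg w'" "\<And>x. x \<in> cc_clocks \<phi> \<Longrightarrow> k + x < K" "\<And>z. z \<in> cc_consts \<phi> \<Longrightarrow> \<bar>z\<bar> \<le> int c"
  shows "sat \<phi> (\<lambda>x. w (k + x)) = sat \<phi> (\<lambda>x. w' (k + x))"
  using assms(4,5)
proof (induction \<phi>)
  case (Atom1 x cm z)
  then have "k + x < K" "\<bar>z\<bar> \<le> int c" by auto
  from req1_int[OF assms(1-3) this] show ?case unfolding sat.simps by (intro cmp_sem_cong) simp_all
next
  case (Atom2 x y cm z)
  then have "k + x < K" "k + y < K" "\<bar>z\<bar> \<le> int c" by auto
  from req2_int[OF assms(1) this] show ?case unfolding sat.simps by (intro cmp_sem_cong) simp_all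
qed auto

text \<open>A difference with a reset clock becomes a comparison of a single clock, or a statement
  about signs, which nonnegativity decides.\<close>

lemma req_rst:
  assumes "req K c w w'" "nonneg w" "nonneg w'"
  shows "req K c (rst R w) (rst R w')"
proof -
  have 0: "0 \<le> w x" "0 \<le> w' x" for x using assms unfolding nonneg_def by auto
  have 1: "(w x < real z \<longleftrightarrow> w' x < real z) \<and> (real z < w x \<longleftrightarrow> real z < w' x)" if "x < K" "z \<le> c" for x z
    using req1[OF assms(1)] that by blast
  have pos: "(0 < w x) = (0 < w' x)" if "x < K" for x using 1[OF that, of 0] by simp
  have shift: "(0 < w y + real z) = (0 < w' y + real z)" "\<not> w y + real z < 0" "\<not> w' y + real z < 0" if "y < K" for y z
  proof -
    show "(0 < w y + real z) = (0 < w' y + real z)" using pos[OF that] 0[of y] by (cases z) auto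
  qed (use 0[of y] in \<open>auto simp: not_less\<close>)
  show ?thesis unfolding req_def rst_def
    using req1[OF assms(1)] req2[OF assms(1)] shift by auto
qed

text \<open>Clock x meets the integer z after the delay z - w x. The mutual order of these
  thresholds compares clock differences with differences of constants, which lie between -c and c,
  so it is the same for both valuations. It remains to place d' among the thresholds of w' as d lies
  among those of w.\<close>

lemma req_delay:
  assumes r: "req K c w w'" and nn: "nonneg w" "nonneg w'" and d: "0 \<le> d"
  shows "\<exists>d'\<ge>0. req K c (\<lambda>x. w x + d) (\<lambda>x. w' x + d')"
proof -
  define J where "J = {..<K} \<times> {..c}"
  define th where "th v j = real (snd j) - v (fst j)" for v :: "nat \<Rightarrow> real" and j :: "nat \<times> nat"
  have finJ: "finite J" unfolding J_def by simp
  have key: "th w i < th w j \<longleftrightarrow> th w' i < th w' j" if "i \<in> J" "j \<in> J" for i j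
  proof -
    obtain x z y u where ij: "i = (x, z)" "j = (y, u)" by (cases i, cases j)
    have b: "x < K" "y < K" "z \<le> c" "u \<le> c" using that unfolding ij J_def by auto
    show ?thesis
    proof (cases "z \<le> u")
      case True
      then have e: "real u = real z + real (u - z)" by simp
      have "th v i < th v j \<longleftrightarrow> v y < v x + real (u - z)" for v
        unfolding ij th_def fst_conv snd_conv by (rule iffI) (use e in linarith)+
      then show ?thesis using req2[OF r b(2,1), of "u - z"] b by simp
    next
      case False
      then have e: "real z = real u + real (z - u)" by simp
      have "th v i < th v j \<longleftrightarrow> v y + real (z - u) < v x" for v
        unfolding ij th_def fst_conv snd_conv by (rule iffI) (use e in linarith)+
      then show ?thesis using req2[OF r b(1,2), of "z - u"] b by simp
    qed
  qed
  have suff: "req K c (\<lambda>x. w x + d) (\<lambda>x. w' x + d')" if H: "\<And>j. j \<in> J \<Longrightarrow> (d < th w j \<longleftrightarrow> d' < th w' j) \<and> (th w j < d \<longleftrightarrow> th w' j < d')" for d'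
  proof -
    have "(w x + d < real z \<longleftrightarrow> w' x + d' < real z) \<and> (real z < w x + d \<longleftrightarrow> real z < w' x + d')" if a: "x < K" "z \<le> c" for x z
    proof -
      have e: "(d < real z - w x \<longleftrightarrow> d' < real z - w' x) \<and> (real z - w x < d \<longleftrightarrow> real z - w' x < d')"
        using a H[of "(x, z)"]
        unfolding J_def th_def by simp
      have "w x + d < real z \<longleftrightarrow> d < real z - w x" "real z < w x + d \<longleftrightarrow> real z - w x < d"
        "w' x + d' < real z \<longleftrightarrow> d' < real z - w' x" "real z < w' x + d' \<longleftrightarrow> real z - w' x < d'" by linarith+
      with e show ?thesis by blast
    qed
    moreover have "(w x + d < w y + d + real z \<longleftrightarrow> w' x + d' < w' y + d' + real z) \<and> (w y + d + real z < w x + d \<longleftrightarrow> w' y + d' + real z < w' x + d')"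
      if "x < K" "y < K" "z \<le> c" for x y z
    proof -
      have "w x + d < w y + d + real z \<longleftrightarrow> w x < w y + real z" "w y + d + real z < w x + d \<longleftrightarrow> w y + real z < w x"
        "w' x + d' < w' y + d' + real z \<longleftrightarrow> w' x < w' y + real z" "w' y + d' + real z < w' x + d' \<longleftrightarrow> w' y + real z < w' x" by linarith+
      then show ?thesis using req2[OF r that] by blast
    qed
    ultimately show ?thesis unfolding req_def by blast
  qed
  consider "d = 0" | j where "j \<in> J" "th w j = d" | "d > 0" "\<And>j. j \<in> J \<Longrightarrow> th w j \<noteq> d" using d by fastforce
  then show ?thesis
  proof cases
    case 1 then show ?thesis using r by (intro exI[of _ 0]) simp
  next
    case (2 j)
    have "0 \<le> th w' j"
    proof -
      have "\<not> real (snd j) < w (fst j)" using 2 d unfolding th_def by simp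
      then show ?thesis using req1[OF r, of "fst j" "snd j"] 2(1) unfolding th_def J_def by auto
    qed
    moreover have "(d < th w i \<longleftrightarrow> th w' j < th w' i) \<and> (th w i < d \<longleftrightarrow> th w' i < th w' j)" if "i \<in> J" for i
      using key[OF 2(1) that] key[OF that 2(1)] 2(2) by simp
    ultimately show ?thesis using suff[of "th w' j"] by blast
  next
    case 3
    \<comment> \<open>0 is put among the lower bounds so that the chosen delay is
      nonnegative.\<close>
    define Lo where "Lo = insert 0 (th w' ` {j \<in> J. th w j < d})"
    define Hi where "Hi = th w' ` {j \<in> J. d < th w j}"
    have fin: "finite Lo" "finite Hi" unfolding Lo_def Hi_def using finJ by auto
    have lohi: "l < h" if lh: "l \<in> Lo" "h \<in> Hi" for l h
    proof -
      obtain j where j: "j \<in> J" "d < th w j" "h = th w' j" using lh(2) unfolding Hi_def by blast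
      show ?thesis
      proof (cases "l = 0")
        case True
        have "w (fst j) < real (snd j)" using j 3 unfolding th_def by simp
        then have "w' (fst j) < real (snd j)" using req1[OF r, of "fst j" "snd j"] j(1) unfolding J_def by auto
        then show ?thesis using True j unfolding th_def by simp
      next
        case False
        then obtain i where "i \<in> J" "th w i < d" "l = th w' i" using lh(1) unfolding Lo_def by blast
        then show ?thesis using key[of i j] j by simp
      qed
    qed
    define d' where "d' = (if Hi = {} then Max Lo + 1 else (Max Lo + Min Hi) / 2)"
    have "Max Lo \<in> Lo" using fin(1) by (intro Max_in) (auto simp: Lo_def)
    moreover have "Hi \<noteq> {} \<Longrightarrow> Min Hi \<in> Hi" using fin(2) by (intro Min_in)
    ultimately have "Hi \<noteq> {} \<Longrightarrow> Max Lo < Min Hi" using lohi by blast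
    then have d': "Max Lo < d'" "Hi \<noteq> {} \<Longrightarrow> d' < Min Hi" unfolding d'_def by auto
    have lo: "l < d'" if "l \<in> Lo" for l using Max_ge[OF fin(1) that] d'(1) by simp
    have hi: "d' < h" if "h \<in> Hi" for h using Min_le[OF fin(2) that] d'(2) that by fastforce
    have "(d < th w j \<longleftrightarrow> d' < th w' j) \<and> (th w j < d \<longleftrightarrow> th w' j < d')" if j: "j \<in> J" for j
    proof (cases "th w j < d")
      case True
      then have "th w' j < d'" using lo j unfolding Lo_def by blast
      then show ?thesis using True by simp
    next
      case False
      then have "d < th w j" using 3(2)[OF j] by simp
      then have "d' < th w' j" using hi j unfolding Hi_def by blast
      then show ?thesis using \<open>d < th w j\<close> by simp
    qed
    moreover have "0 \<le> d'" using lo[of 0] unfolding Lo_def by simp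
    ultimately show ?thesis using suff by blast
  qed
qed

section \<open>Rational grid points representing regions\<close>

definition rv :: "nat \<Rightarrow> nat list \<Rightarrow> nat \<Rightarrow> real" where
  "rv D p = (\<lambda>x. real (p ! x) / real D)"

lemma nonneg_rv: "nonneg (rv D p)" unfolding nonneg_def rv_def by simp

lemma nonneg_add: "nonneg w \<Longrightarrow> 0 \<le> d \<Longrightarrow> nonneg (\<lambda>x. w x + d)" unfolding nonneg_def by simp

lemma nonneg_rst: "nonneg w \<Longrightarrow> nonneg (rst R w)" unfolding nonneg_def rst_def by simp

text \<open>With even numerators and even D every threshold is an even multiple of 1/D, so an odd e
  can stand for the open interval between two neighbouring even numbers. Delays are cut at c + 1,
  where all clocks have passed c.\<close>

lemma grid_delay:
  assumes ev: "\<And>x. x < K \<Longrightarrow> even (p ! x)" and D: "even D" "0 < D" and d: "0 \<le> d"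
  shows "\<exists>e\<le>D * (c + 1). req K c (\<lambda>x. rv D p x + d) (\<lambda>x. rv D p x + real e / real D)"
proof -
  define u where "u = real D * min d (real c + 1)"
  have "u \<le> real D * (real c + 1)" unfolding u_def by (intro mult_left_mono) auto
  then have u0: "0 \<le> u" "u \<le> real (D * (c + 1))" unfolding u_def using d by (auto simp: algebra_simps)
  have D0: "0 < real D" using D by simp
  have sh: "(a + t < b + t + z \<longleftrightarrow> a < b + z) \<and> (b + t + z < a + t \<longleftrightarrow> b + z < a)" for a b t z :: real by auto
  have 1: "req K c (\<lambda>x. rv D p x + d) (\<lambda>x. rv D p x + u / real D)"
  proof -
    have ud: "u / real D = min d (real c + 1)" unfolding u_def using D by simp
    have "(rv D p x + d < real z \<longleftrightarrow> rv D p x + min d (real c + 1) < real z) \<and>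
        (real z < rv D p x + d \<longleftrightarrow> real z < rv D p x + min d (real c + 1))" if "z \<le> c" for x z
    proof -
      have "0 \<le> rv D p x" "real z \<le> real c" using nonneg_rv that unfolding nonneg_def by auto
      then show ?thesis by (auto simp: min_def)
    qed
    then show ?thesis unfolding req_def ud using sh by blast
  qed
  have "\<exists>e::nat. e \<le> D * (c + 1) \<and> (\<forall>n::int. even n \<longrightarrow> (u < of_int n \<longleftrightarrow> int e < n) \<and> (of_int n < u \<longleftrightarrow> n < int e))"
  proof (cases "\<exists>n::int. even n \<and> u = of_int n")
    case True
    then obtain n :: int where n: "u = of_int n" by blast
    then have "n \<ge> 0" using u0 by simp
    then have "u = real (nat n)" using n by simp
    moreover from this have "nat n \<le> D * (c + 1)" using u0(2) by (simp only: of_nat_le_iff)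
    ultimately show ?thesis using n \<open>n \<ge> 0\<close> by (intro exI[of _ "nat n"]) auto
  next
    case False
    define f where "f = \<lfloor>u / 2\<rfloor>"
    have "of_int f \<le> u / 2" "u / 2 < of_int f + 1" unfolding f_def by linarith+
    moreover have "u \<noteq> of_int (2 * f)" using False by (metis dvd_triv_left)
    ultimately have f: "of_int (2 * f) < u" "u < of_int (2 * f + 2)" by auto
    have "f \<ge> 0" unfolding f_def using u0 by simp
    have n: "(u < of_int n \<longleftrightarrow> 2 * f + 1 < n) \<and> (of_int n < u \<longleftrightarrow> n < 2 * f + 1)" if evn: "even n" for n :: int
    proof -
      obtain m where m: "n = 2 * m" using evn by blast
      have "u < of_int n \<longleftrightarrow> f < m"
      proof
        assume "u < of_int n"
        then have "(of_int (2 * f) :: real) < of_int (2 * m)" using f m by linarith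
        then show "f < m" by simp
      next
        assume "f < m"
        then have "(of_int (2 * f + 2) :: real) \<le> of_int (2 * m)" by (subst of_int_le_iff) simp
        then show "u < of_int n" using f m by linarith
      qed
      moreover have "of_int n < u \<longleftrightarrow> m \<le> f"
      proof
        assume "of_int n < u"
        then have "(of_int (2 * m) :: real) < of_int (2 * f + 2)" using f m by linarith
        then show "m \<le> f" by simp
      next
        assume "m \<le> f"
        then have "(of_int (2 * m) :: real) \<le> of_int (2 * f)" by (subst of_int_le_iff) simp
        then show "of_int n < u" using f m by linarith
      qed
      ultimately show ?thesis using m by auto
    qed
    have "u \<le> of_int (int (D * (c + 1)))" using u0 by simp
    then have "\<not> int (D * (c + 1)) < 2 * f + 1" using n[of "int (D * (c + 1))"] D by (auto simp: not_less)
    then have "nat (2 * f + 1) \<le> D * (c + 1)" by linarith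
    moreover have "int (nat (2 * f + 1)) = 2 * f + 1" using \<open>f \<ge> 0\<close> by simp
    ultimately show ?thesis using n by metis
  qed
  then obtain e where e: "e \<le> D * (c + 1)" "\<And>n. even n \<Longrightarrow> (u < of_int n \<longleftrightarrow> int e < n) \<and> (of_int n < u \<longleftrightarrow> n < int e)" by blast
  have "(rv D p x + u / real D < real z \<longleftrightarrow> rv D p x + real e / real D < real z) \<and>
      (real z < rv D p x + u / real D \<longleftrightarrow> real z < rv D p x + real e / real D)" if x: "x < K" for x z
  proof -
    let ?n = "int (z * D) - int (p ! x)"
    have "even ?n" using ev[OF x] D by simp
    note E = e(2)[OF this]
    have s: "rv D p x + t / real D < real z \<longleftrightarrow> t < of_int ?n" "real z < rv D p x + t / real D \<longleftrightarrow> of_int ?n < t" for t :: real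
    proof -
      have "rv D p x + t / real D = (real (p ! x) + t) / real D" unfolding rv_def by (simp add: add_divide_distrib)
      then show "rv D p x + t / real D < real z \<longleftrightarrow> t < of_int ?n" "real z < rv D p x + t / real D \<longleftrightarrow> of_int ?n < t"
        using D0 by (auto simp: divide_less_eq less_divide_eq)
    qed
    have "(real e < of_int ?n \<longleftrightarrow> int e < ?n) \<and> (of_int ?n < real e \<longleftrightarrow> ?n < int e)" by linarith
    then show ?thesis unfolding s using E by blast
  qed
  then have 2: "req K c (\<lambda>x. rv D p x + u / real D) (\<lambda>x. rv D p x + real e / real D)"
    unfolding req_def using sh by blast
  show ?thesis using req_trans[OF 1 2] e(1) by blast
qed

lemma floor_frac_less:
  fixes a b :: int and f g :: real
  assumes "0 \<le> f" "f < 1" "0 \<le> g" "g < 1"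
  shows "of_int a + f < of_int b + g \<longleftrightarrow> a < b \<or> a = b \<and> f < g"
proof (cases "a < b")
  case True
  then have "(of_int a + 1 :: real) \<le> of_int b" by linarith
  then show ?thesis using True assms by linarith
next
  case False
  show ?thesis
  proof (cases "a = b")
    case neq: False
    then have "(of_int b + 1 :: real) \<le> of_int a" using False by linarith
    then show ?thesis using False neq assms by linarith
  qed simp
qed

text \<open>Each fractional part is replaced by its rank among all fractional parts and 0. Ranks are
  at most K, so twice the rank over 2 * (K + 1) is below 1, has an even numerator, and vanishes
  exactly for integral clocks.\<close>

lemma grid_point_unbounded:
  assumes nn: "nonneg w" and D: "D = 2 * (K + 1)"
  shows "\<exists>p :: nat \<Rightarrow> nat. (\<forall>x. even (p x)) \<and> req K c w (\<lambda>x. real (p x) / real D)"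
proof -
  define FR where "FR = insert 0 ((\<lambda>x. frac (w x)) ` {..<K})"
  define rk where "rk f = card {f' \<in> FR. f' < f}" for f
  have finFR: "finite FR" unfolding FR_def by simp
  have rk_mono: "rk f < rk g \<longleftrightarrow> f < g" if "f \<in> FR" "g \<in> FR" for f g
  proof -
    have *: "rk f < rk g" if "f < g" "f \<in> FR" for f g
      unfolding rk_def using finFR that by (intro psubset_card_mono) auto
    show ?thesis using *[of f g] *[of g f] that by (metis less_asym linorder_neqE_linordered_idom order_less_irrefl)
  qed
  have rk0: "rk 0 = 0" unfolding rk_def FR_def using finFR by (auto simp: frac_lt_1 not_less)
  have rk_le: "rk f \<le> K" if "f \<in> FR" for f
  proof -
    have "rk f \<le> card (FR - {f})" unfolding rk_def using finFR by (intro card_mono) auto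
    also have "\<dots> = card FR - 1" using that finFR by simp
    also have "card FR \<le> Suc K" unfolding FR_def using card_image_le[of "{..<K}" "\<lambda>x. frac (w x)"] card_insert_le_m1
      by (metis card_insert_if card_lessThan finite_imageI finite_lessThan le_Suc_eq Suc_le_mono)
    finally show ?thesis by simp
  qed
  have D0: "0 < D" using D by simp
  define p where "p x = D * nat \<lfloor>w x\<rfloor> + 2 * (if x < K then rk (frac (w x)) else 0)" for x
  define f where "f x = real (2 * rk (frac (w x))) / real D" for x
  have w: "w x = of_int \<lfloor>w x\<rfloor> + frac (w x)" for x by (simp add: frac_def)
  have fl: "\<lfloor>w x\<rfloor> \<ge> 0" for x using nn unfolding nonneg_def by simp
  have pf: "real (p x) / real D = of_int \<lfloor>w x\<rfloor> + f x" if "x < K" for x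
    unfolding p_def f_def using that fl[of x] D0 by (simp add: add_divide_distrib)
  have inFR: "frac (w x) \<in> FR" "0 \<in> FR" if "x < K" for x using that unfolding FR_def by auto
  have f01: "0 \<le> f x" "f x < 1" if "x < K" for x
  proof -
    have "real (2 * rk (frac (w x))) < real D" using rk_le[OF inFR(1)[OF that]] D by simp
    then show "f x < 1" unfolding f_def using D by simp
  qed (simp add: f_def)
  have f_less: "f x < f y \<longleftrightarrow> frac (w x) < frac (w y)" if "x < K" "y < K" for x y
    unfolding f_def rk_mono[OF inFR(1)[OF that(1)] inFR(1)[OF that(2)], symmetric] using D by (simp add: divide_less_cancel)
  have f_pos: "0 < f x \<longleftrightarrow> 0 < frac (w x)" if "x < K" for x
  proof -
    have "0 < f x \<longleftrightarrow> rk 0 < rk (frac (w x))" unfolding f_def rk0 using D0 by (simp add: zero_less_divide_iff)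
    then show ?thesis using rk_mono[OF inFR(2,1)[OF that]] that by simp
  qed
  have 01: "0 \<le> frac (w x)" "frac (w x) < 1" for x by (auto simp: frac_lt_1)
  have "(w x < real z \<longleftrightarrow> real (p x) / real D < real z) \<and> (real z < w x \<longleftrightarrow> real z < real (p x) / real D)" if x: "x < K" for x z
  proof -
    have "w x < of_int (int z) + 0 \<longleftrightarrow> of_int \<lfloor>w x\<rfloor> + f x < of_int (int z) + 0"
      using floor_frac_less[of "frac (w x)" 0 "\<lfloor>w x\<rfloor>" "int z"] floor_frac_less[of "f x" 0 "\<lfloor>w x\<rfloor>" "int z"] w[of x] 01[of x] f01[OF x] by simp
    moreover have "of_int (int z) + 0 < w x \<longleftrightarrow> of_int (int z) + 0 < of_int \<lfloor>w x\<rfloor> + f x"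
      using floor_frac_less[of 0 "frac (w x)" "int z" "\<lfloor>w x\<rfloor>"] floor_frac_less[of 0 "f x" "int z" "\<lfloor>w x\<rfloor>"] w[of x] 01[of x] f01[OF x] f_pos[OF x] by simp
    ultimately show ?thesis unfolding pf[OF x] by simp
  qed
  moreover have "(w x < w y + real z \<longleftrightarrow> real (p x) / real D < real (p y) / real D + real z) \<and>
      (w y + real z < w x \<longleftrightarrow> real (p y) / real D + real z < real (p x) / real D)" if xy: "x < K" "y < K" for x y z
  proof -
    have e: "w y + real z = of_int (\<lfloor>w y\<rfloor> + int z) + frac (w y)" using w[of y] by simp
    have e': "real (p y) / real D + real z = of_int (\<lfloor>w y\<rfloor> + int z) + f y" unfolding pf[OF xy(2)] by simp
    have "w x < w y + real z \<longleftrightarrow> real (p x) / real D < real (p y) / real D + real z"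
      unfolding e e' pf[OF xy(1)] using floor_frac_less[OF 01[of x] 01[of y]] floor_frac_less[OF f01[OF xy(1)] f01[OF xy(2)]] f_less[OF xy] w[of x] by metis
    moreover have "w y + real z < w x \<longleftrightarrow> real (p y) / real D + real z < real (p x) / real D"
      unfolding e e' pf[OF xy(1)] using floor_frac_less[OF 01[of y] 01[of x]] floor_frac_less[OF f01[OF xy(2)] f01[OF xy(1)]] f_less[OF xy(2,1)] w[of x] by metis
    ultimately show ?thesis by blast
  qed
  ultimately have "req K c w (\<lambda>x. real (p x) / real D)" unfolding req_def by blast
  moreover have "even (p x)" for x unfolding p_def D by simp
  ultimately show ?thesis by blast
qed

text \<open>Choose a representative with the least coordinate sum. A coordinate that is too large
  leaves below it an empty interval of c + 1 time units. Everything above it can slide down by one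
  unit: differences across the interval still exceed c, so the region is the same and the sum is
  smaller.\<close>

lemma grid_point:
  assumes nn: "nonneg w" and D: "D = 2 * (K + 1)"
  shows "\<exists>p. length p = K \<and> (\<forall>x<K. even (p ! x) \<and> p ! x \<le> K * ((c + 1) * D)) \<and> req K c w (rv D p)"
proof -
  define S where "S = {p :: nat \<Rightarrow> nat. (\<forall>x. even (p x)) \<and> req K c w (\<lambda>x. real (p x) / real D)}"
  obtain p0 where "p0 \<in> S" using grid_point_unbounded[OF nn D] unfolding S_def by blast
  then obtain p where p: "p \<in> S" "\<And>p'. p' \<in> S \<Longrightarrow> (\<Sum>x<K. p x) \<le> (\<Sum>x<K. p' x)"
    using ex_has_least_nat[of "\<lambda>p. p \<in> S" p0 "\<lambda>p. \<Sum>x<K. p x"] by blast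
  have D0: "0 < real D" "D > 0" using D by auto
  let ?g = "(c + 1) * D"
  have "p x0 \<le> K * ?g" if x0: "x0 < K" for x0
  proof (rule ccontr)
    assume big: "\<not> ?thesis"
    \<comment> \<open>Pigeonhole: the other clocks cannot meet all of the intervals below, so some gap can be shortened.\<close>
    define bl where "bl x = (p x - 1) div ?g" for x
    have "\<exists>j<K. \<forall>x<K. x \<noteq> x0 \<longrightarrow> bl x \<noteq> j"
    proof (rule ccontr)
      assume "\<not> ?thesis"
      then have "{..<K} \<subseteq> bl ` ({..<K} - {x0})" by auto
      then have "card {..<K} \<le> card ({..<K} - {x0})" using surj_card_le by blast
      then show False using x0 by simp
    qed
    then obtain j where j: "j < K" "\<And>x. x < K \<Longrightarrow> x \<noteq> x0 \<Longrightarrow> bl x \<noteq> j" by blast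
    have gap: "p x \<le> j * ?g \<or> Suc j * ?g < p x" if x: "x < K" for x
    proof (cases "x = x0")
      case True
      have "Suc j * ?g \<le> K * ?g" using j(1) by (intro mult_right_mono) auto
      then show ?thesis using big True by simp
    next
      case False
      show ?thesis
      proof (rule ccontr)
        assume "\<not> ?thesis"
        then have "j * ?g \<le> p x - 1" "p x - 1 < Suc j * ?g" by auto
        then have "bl x = j" unfolding bl_def by (intro div_nat_eqI) (auto simp: mult.commute)
        then show False using j(2)[OF x False] by simp
      qed
    qed
    define up where "up x \<longleftrightarrow> Suc j * ?g < p x" for x
    define p' where "p' x = (if up x then p x - D else p x)" for x
    \<comment> \<open>Even the lowest gap reaches up to (c + 1) * D, so a coordinate above the gap
      remains above c after losing one unit.\<close>
    have ge: "c * D + D < p x" if "up x" for x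
    proof -
      have "?g \<le> Suc j * ?g" by simp
      then show ?thesis using that unfolding up_def by (simp add: algebra_simps)
    qed
    have p'r: "real (p' x) = (if up x then real (p x) - real D else real (p x))" for x
      using ge[of x] unfolding p'_def by (auto simp: of_nat_diff)
    have up1: "real c < real (p x) / real D" "real c < real (p' x) / real D" if "up x" for x
    proof -
      have "real (c * D + D) < real (p x)" using ge[OF that] by (simp only: of_nat_less_iff)
      then have "real c * real D + real D < real (p x)" by simp
      then show "real c < real (p x) / real D" "real c < real (p' x) / real D"
        using that D0 unfolding p'r by (simp_all add: less_divide_eq)
    qed
    have up2: "real (p y) / real D + real c < real (p x) / real D" "real (p' y) / real D + real c < real (p' x) / real D"
      if ux: "up x" and uy: "\<not> up y" and y: "y < K" for x y
    proof -
      have "p y \<le> j * ?g" using gap[OF y] uy unfolding up_def by blast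
      moreover have "Suc j * ?g < p x" using ux unfolding up_def .
      ultimately have "p y + c * D + D < p x" by (simp add: algebra_simps)
      then have "real (p y + c * D + D) < real (p x)" by (simp only: of_nat_less_iff)
      then have "real (p y) + real c * real D + real D < real (p x)" by simp
      then have "real (p y) + real c * real D < real (p x)" "real (p y) + real c * real D < real (p x) - real D" using D0 by auto
      moreover have "a / real D + real c < b / real D" if "a + real c * real D < b" for a b
        using divide_strict_right_mono[OF that D0(1)] D0 by (simp add: add_divide_distrib)
      ultimately show "real (p y) / real D + real c < real (p x) / real D" "real (p' y) / real D + real c < real (p' x) / real D"
        using ux uy unfolding p'r by simp_all
    qed
    have "req K c (\<lambda>x. real (p x) / real D) (\<lambda>x. real (p' x) / real D)"
      unfolding req_def
    proof (intro conjI allI impI)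
      fix x z :: nat assume xz: "x < K" "z \<le> c"
      have zc: "real z \<le> real c" using xz by simp
      show "real (p x) / real D < real z \<longleftrightarrow> real (p' x) / real D < real z"
      proof (cases "up x")
        case True then show ?thesis using up1[OF True] zc by auto
      qed (simp add: p'_def)
      show "real z < real (p x) / real D \<longleftrightarrow> real z < real (p' x) / real D"
      proof (cases "up x")
        case True then show ?thesis using up1[OF True] zc by auto
      qed (simp add: p'_def)
    next
      fix x y z :: nat assume xyz: "x < K" "y < K" "z \<le> c"
      have zc: "0 \<le> real z" "real z \<le> real c" using xyz by auto
      have same: "real (p' x) / real D - real (p' y) / real D = real (p x) / real D - real (p y) / real D" if "up x = up y"
        using that unfolding p'r by (simp add: diff_divide_distrib)
      show "real (p x) / real D < real (p y) / real D + real z \<longleftrightarrow> real (p' x) / real D < real (p' y) / real D + real z"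
        using same up2[of x y] up2[of y x] xyz(1,2) zc by (smt (verit))
      show "real (p y) / real D + real z < real (p x) / real D \<longleftrightarrow> real (p' y) / real D + real z < real (p' x) / real D"
        using same up2[of x y] up2[of y x] xyz(1,2) zc by (smt (verit))
    qed
    then have "req K c w (\<lambda>x. real (p' x) / real D)" using p(1) req_trans unfolding S_def by blast
    moreover have "even (p' x)" for x using p(1) D unfolding S_def p'_def by auto
    ultimately have "p' \<in> S" unfolding S_def by blast
    moreover have "(\<Sum>x<K. p' x) < (\<Sum>x<K. p x)"
    proof (rule sum_strict_mono_ex1)
      show "\<forall>x\<in>{..<K}. p' x \<le> p x" unfolding p'_def by simp
      have "up x0" using gap[OF x0] big j(1) unfolding up_def
        by (meson le_trans less_imp_le_nat mult_le_mono1)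
      then have "p' x0 < p x0" using ge[of x0] D0 unfolding p'_def by simp
      then show "\<exists>x\<in>{..<K}. p' x < p x" using x0 by blast
    qed simp
    ultimately show False using p(2) by (meson not_less)
  qed
  moreover have "req K c (\<lambda>x. real (p x) / real D) (rv D (map p [0..<K]))"
    unfolding req_def rv_def by simp
  then have "req K c w (rv D (map p [0..<K]))" using p(1) req_trans unfolding S_def by blast
  ultimately show ?thesis using p(1) unfolding S_def by (intro exI[of _ "map p [0..<K]"]) simp
qed

section \<open>The tick game\<close>

text \<open>A state of the game automaton is a tuple (tag, location, active controller clocks, grid point, bit).
  States with tag 0 follow a run of the timed automaton; the clock with index x < k of the grid point holds the
  time since the last tick of the controller clock x, and the index k + x stands for the clock x of the automaton.
  The bit records a visit to a final location since the last letter.  States with tag Suc j watch that the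
  controller clock j is not kept active forever; j = k guesses the clock to be watched.
  A move (0, Z) of Player I lets the clocks in Z tick, a move (Suc a, Z) plays the letter a at a moment when exactly
  the active clocks in Z are integral.  Player II answers (b, Y, P): the letter b, the reset clocks Y, and the
  clocks P which she wants to remain active.\<close>

type_synonym gstate = "nat \<times> nat \<times> nat list \<times> nat list \<times> nat"
type_synonym gmove = "nat \<times> nat list"
type_synonym gresp = "nat \<times> nat list \<times> nat list"

abbreviation tg :: "gstate \<Rightarrow> nat" where "tg q \<equiv> fst q"
abbreviation lc :: "gstate \<Rightarrow> nat" where "lc q \<equiv> fst (snd q)"
abbreviation ac :: "gstate \<Rightarrow> nat list" where "ac q \<equiv> fst (snd (snd q))"
abbreviation vl :: "gstate \<Rightarrow> nat list" where "vl q \<equiv> fst (snd (snd (snd q)))"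
abbreviation bt :: "gstate \<Rightarrow> nat" where "bt q \<equiv> snd (snd (snd (snd q)))"

text \<open>Clock sets are represented by subsequences of one fixed list, which makes states, moves
  and answers range over finitely many lists.\<close>

definition Sub :: "nat \<Rightarrow> nat list list" where "Sub k = subseqs [0..<k]"

lemma Sub_D: assumes "l \<in> set (Sub k)" shows "set l \<subseteq> {..<k}"
proof -
  have "set l \<in> set ` set (subseqs [0..<k])" using assms unfolding Sub_def by blast
  then show ?thesis unfolding subseqs_powset by auto
qed

lemma Sub_ex: "S \<subseteq> {..<k} \<Longrightarrow> \<exists>l\<in>set (Sub k). set l = S"
proof -
  assume "S \<subseteq> {..<k}"
  then have "S \<in> set ` set (subseqs [0..<k])" unfolding subseqs_powset by auto
  then show ?thesis unfolding Sub_def by auto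
qed

definition zl :: "nat \<Rightarrow> nat set \<Rightarrow> nat list" where "zl k S = (SOME l. l \<in> set (Sub k) \<and> set l = S)"

lemma zl: "S \<subseteq> {..<k} \<Longrightarrow> zl k S \<in> set (Sub k) \<and> set (zl k S) = S"
  unfolding zl_def by (rule someI_ex) (use Sub_ex in blast)

definition watch :: "nat \<Rightarrow> gstate" where "watch j = (Suc j, 0, [], [], 0)"

text \<open>A single number c bounds clock names, locations and guard constants, so the automaton
  clocks occupy the coordinates k, ..., k + c - 1. The condition 1 \<le> c lets regions see the
  value 1, at which a clock ticks.\<close>

locale synth_game =
  fixes A B :: "nat list" and T :: ta and k c :: nat
  assumes wf: "wf_ta A B T" and clk: "\<And>x. x \<in> set (clks T) \<Longrightarrow> x < c" and loc: "\<And>l. l \<in> set (locs T) \<Longrightarrow> l < c"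
    and cst: "\<And>r z. r \<in> set (rules T) \<Longrightarrow> z \<in> cc_consts (r_guard r) \<Longrightarrow> \<bar>z\<bar> \<le> int c" and c1: "1 \<le> c"
begin

definition K where "K = k + c"
definition D where "D = 2 * (K + 1)"

text \<open>A delay, a test and a reset on grid points. The target is reached only up to region
  equivalence, because an odd delay leaves the even grid and the result has to be replaced by a
  representative.\<close>

definition stp :: "((nat \<Rightarrow> real) \<Rightarrow> bool) \<Rightarrow> nat set \<Rightarrow> nat list \<Rightarrow> nat list \<Rightarrow> bool" where
  "stp P R p p' \<longleftrightarrow> (\<exists>e\<le>D * (c + 1). P (\<lambda>x. rv D p x + real e / real D) \<and>
     req K c (rv D p') (rst R (\<lambda>x. rv D p x + real e / real D)))"

definition inv_pred :: "((nat \<Rightarrow> real) \<Rightarrow> bool) \<Rightarrow> bool" where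
  "inv_pred P \<longleftrightarrow> (\<forall>w w'. nonneg w \<longrightarrow> nonneg w' \<longrightarrow> req K c w w' \<longrightarrow> P w = P w')"

definition gP :: "rule \<Rightarrow> (nat \<Rightarrow> real) \<Rightarrow> bool" where "gP r w \<longleftrightarrow> sat (r_guard r) (\<lambda>x. w (k + x))"
definition tP :: "nat set \<Rightarrow> nat set \<Rightarrow> (nat \<Rightarrow> real) \<Rightarrow> bool" where
  "tP Act Z w \<longleftrightarrow> (\<forall>x\<in>Act. w x \<le> 1) \<and> Z = {x \<in> Act. w x = 1}"
text \<open>Ticks due at the moment of a letter are made before it, so active clocks are below 1 and
  the integral ones show 0. Announcing Z tells Player II which clocks are integral, information that
  her region needs.\<close>

definition lP :: "nat set \<Rightarrow> nat set \<Rightarrow> (nat \<Rightarrow> real) \<Rightarrow> bool" where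
  "lP Act Z w \<longleftrightarrow> (\<forall>x\<in>Act. w x < 1) \<and> Z = {x \<in> Act. w x = 0}"
definition rR :: "rule \<Rightarrow> nat set" where "rR r = (\<lambda>x. k + x) ` set (r_resets r)"

lemma inv_gP: assumes "r \<in> set (rules T)" shows "inv_pred (gP r)"
  unfolding inv_pred_def gP_def
proof (intro allI impI)
  fix w w' assume w: "nonneg w" "nonneg w'" "req K c w w'"
  have "k + x < K" if "x \<in> cc_clocks (r_guard r)" for x
  proof -
    have "x \<in> set (clks T)" using that assms wf unfolding wf_ta_def by blast
    then show ?thesis using clk unfolding K_def by simp
  qed
  then show "sat (r_guard r) (\<lambda>x. w (k + x)) = sat (r_guard r) (\<lambda>x. w' (k + x))"
    using sat_req[OF w(3,1,2)] cst[OF assms] by blast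
qed

lemma req_01:
  assumes "req K c w w'" "x < k"
  shows "w x < 1 \<longleftrightarrow> w' x < 1" "1 < w x \<longleftrightarrow> 1 < w' x" "w x < 0 \<longleftrightarrow> w' x < 0" "0 < w x \<longleftrightarrow> 0 < w' x"
  using req1[OF assms(1), of x 1] req1[OF assms(1), of x 0] assms(2) c1 by (auto simp: K_def)

lemma inv_tP: assumes "Act \<subseteq> {..<k}" shows "inv_pred (tP Act Z)"
  unfolding inv_pred_def
proof (intro allI impI)
  fix w w' assume r: "req K c w w'"
  have 1: "w x \<le> 1 \<longleftrightarrow> w' x \<le> 1" "w x = 1 \<longleftrightarrow> w' x = 1" if "x \<in> Act" for x
    using req_01[OF r, of x] that assms by auto
  have "{x \<in> Act. w x = 1} = {x \<in> Act. w' x = 1}" using 1 by blast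
  then show "tP Act Z w = tP Act Z w'" unfolding tP_def using 1 by simp
qed

lemma inv_lP: assumes "Act \<subseteq> {..<k}" shows "inv_pred (lP Act Z)"
  unfolding inv_pred_def
proof (intro allI impI)
  fix w w' assume r: "req K c w w'"
  have 1: "w x < 1 \<longleftrightarrow> w' x < 1" "w x = 0 \<longleftrightarrow> w' x = 0" if "x \<in> Act" for x
    using req_01[OF r, of x] that assms by auto
  have "{x \<in> Act. w x = 0} = {x \<in> Act. w' x = 0}" using 1 by blast
  then show "lP Act Z w = lP Act Z w'" unfolding lP_def using 1 by simp
qed

lemma inv_conj: "inv_pred P \<Longrightarrow> inv_pred P' \<Longrightarrow> inv_pred (\<lambda>w. P w \<and> P' w)"
  unfolding inv_pred_def by blast

text \<open>Turns symbolic runs into real ones: \<open>req_delay\<close> transports the grid delay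
  to any valuation in the region of p.\<close>

lemma stp_conc:
  assumes "stp P R p p'" "inv_pred P" "nonneg w" "req K c w (rv D p)"
  shows "\<exists>d\<ge>0. P (\<lambda>x. w x + d) \<and> req K c (rst R (\<lambda>x. w x + d)) (rv D p')"
proof -
  obtain e where e: "P (\<lambda>x. rv D p x + real e / real D)" "req K c (rv D p') (rst R (\<lambda>x. rv D p x + real e / real D))"
    using assms(1) unfolding stp_def by blast
  let ?u = "\<lambda>x. rv D p x + real e / real D"
  have nu: "nonneg ?u" by (intro nonneg_add nonneg_rv) simp
  obtain d where d: "0 \<le> d" "req K c ?u (\<lambda>x. w x + d)"
    using req_delay[OF req_sym[OF assms(4)] nonneg_rv assms(3), of "real e / real D"] by auto
  have nw: "nonneg (\<lambda>x. w x + d)" using nonneg_add assms(3) d(1) .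
  have "P (\<lambda>x. w x + d)" using assms(2) nu nw d(2) e(1) unfolding inv_pred_def by blast
  moreover have "req K c (rst R (\<lambda>x. w x + d)) (rv D p')"
    using req_trans[OF req_sym[OF req_rst[OF d(2) nu nw]] req_sym[OF e(2)]] .
  ultimately show ?thesis using d(1) by blast
qed

text \<open>Lets the game follow a real run: the real delay is first moved to p and then rounded by
  \<open>grid_delay\<close>, which needs even coordinates; \<open>grid_point\<close> restores
  evenness for the next step.\<close>

lemma stp_abs:
  assumes "P (\<lambda>x. w x + d)" "0 \<le> d" "inv_pred P" "nonneg w" "req K c w (rv D p)" "\<And>x. x < K \<Longrightarrow> even (p ! x)"
  shows "\<exists>p'. stp P R p p' \<and> length p' = K \<and> (\<forall>x<K. even (p' ! x) \<and> p' ! x \<le> K * ((c + 1) * D)) \<and>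
     req K c (rst R (\<lambda>x. w x + d)) (rv D p')"
proof -
  obtain d' where d': "0 \<le> d'" "req K c (\<lambda>x. w x + d) (\<lambda>x. rv D p x + d')"
    using req_delay[OF assms(5,4) nonneg_rv assms(2)] by blast
  obtain e where e: "e \<le> D * (c + 1)" "req K c (\<lambda>x. rv D p x + d') (\<lambda>x. rv D p x + real e / real D)"
    using grid_delay[of K p D d' c] assms(6) d'(1) unfolding D_def by auto
  let ?u = "\<lambda>x. rv D p x + real e / real D"
  have wu: "req K c (\<lambda>x. w x + d) ?u" using req_trans[OF d'(2) e(2)] .
  have nu: "nonneg ?u" by (intro nonneg_add nonneg_rv) simp
  have nw: "nonneg (\<lambda>x. w x + d)" using nonneg_add assms(4,2) .
  have "P ?u" using assms(1,3) nu nw wu unfolding inv_pred_def by blast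
  have r: "req K c (rst R (\<lambda>x. w x + d)) (rst R ?u)" using req_rst[OF wu nw nu] .
  obtain p' where p': "length p' = K" "\<forall>x<K. even (p' ! x) \<and> p' ! x \<le> K * ((c + 1) * D)"
    "req K c (rst R (\<lambda>x. w x + d)) (rv D p')"
    using grid_point[OF nonneg_rst[OF nw] D_def] by blast
  have "req K c (rv D p') (rst R ?u)" using req_trans[OF req_sym[OF p'(3)] r] .
  then show ?thesis using p' e(1) \<open>P ?u\<close> unfolding stp_def by blast
qed

definition Qs :: "gstate set" where
  "Qs = {q. tg q = 0 \<and> lc q < c \<and> ac q \<in> set (Sub k) \<and> length (vl q) = K \<and> (\<forall>x<K. vl q ! x \<le> K * ((c + 1) * D)) \<and> bt q < 2}
    \<union> {watch j | j. j \<le> k}"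

definition ep :: "gstate \<Rightarrow> gstate \<Rightarrow> bool" where
  "ep q q' \<longleftrightarrow> q \<in> Qs \<and> q' \<in> Qs \<and> tg q = 0 \<and> tg q' = 0 \<and> ac q' = ac q \<and>
     (\<exists>r\<in>set (rules T). r_lab r = None \<and> r_src r = lc q \<and> r_tgt r = lc q' \<and>
        bt q' = (if bt q = 1 \<or> lc q' \<in> set (finals T) then 1 else 0) \<and> stp (gP r) (rR r) (vl q) (vl q'))"

definition tr_tick :: "nat list \<Rightarrow> nat list \<Rightarrow> gstate \<Rightarrow> gstate \<Rightarrow> bool" where
  "tr_tick Z P q q' \<longleftrightarrow> tg q = 0 \<and> tg q' = 0 \<and> lc q' = lc q \<and> bt q' = bt q \<and>
     set (ac q') = set (ac q) \<inter> set P \<and> Z \<noteq> [] \<and> stp (tP (set (ac q)) (set Z)) (set Z) (vl q) (vl q')"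

definition tr_letter :: "nat \<Rightarrow> nat list \<Rightarrow> gresp \<Rightarrow> gstate \<Rightarrow> gstate \<Rightarrow> bool" where
  "tr_letter a Z y q q' \<longleftrightarrow> tg q = 0 \<and> tg q' = 0 \<and> set (ac q') = set (snd (snd y)) \<inter> (set (ac q) \<union> set (fst (snd y))) \<and>
     (\<exists>r\<in>set (rules T). r_lab r = Some (a, fst y) \<and> r_src r = lc q \<and> r_tgt r = lc q' \<and>
        bt q' = (if lc q' \<in> set (finals T) then 1 else 0) \<and>
        stp (\<lambda>w. gP r w \<and> lP (set (ac q)) (set Z) w) (set (fst (snd y)) \<union> rR r) (vl q) (vl q'))"

text \<open>The guessing state has tag \<open>Suc k\<close> and may begin watching any clock at any
  time. A watching run dies as soon as its clock is reset or dropped, so it survives forever only if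
  the clock stays active without reset.\<close>

definition tr_watch :: "gresp \<Rightarrow> gstate \<Rightarrow> gstate \<Rightarrow> bool" where
  "tr_watch y q q' \<longleftrightarrow> 0 < tg q \<and> 0 < tg q' \<and>
     (tg q = Suc k \<or> tg q' = tg q \<and> tg q - 1 \<in> set (snd (snd y)) \<and> tg q - 1 \<notin> set (fst (snd y)))"

definition tr :: "gmove \<Rightarrow> gresp \<Rightarrow> gstate \<Rightarrow> gstate \<Rightarrow> bool" where
  "tr x y q q' \<longleftrightarrow> q \<in> Qs \<and> q' \<in> Qs \<and>
     (fst x = 0 \<and> tr_tick (snd x) (snd (snd y)) q q' \<or> 0 < fst x \<and> tr_letter (fst x - 1) (snd x) y q q' \<or> tr_watch y q q')"

text \<open>Final visits are charged at letters only, so a run reading finitely many letters is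
  marked finitely often; the bit carries visits during epsilon steps to the next letter. A watching
  state is charged for each tick of its clock.\<close>

definition mk :: "gmove \<Rightarrow> gstate \<Rightarrow> bool" where
  "mk x q \<longleftrightarrow> tg q = 0 \<and> 0 < fst x \<and> bt q = 1 \<or> 0 < tg q \<and> fst x = 0 \<and> tg q - 1 \<in> set (snd x)"

definition Xm :: "gmove set" where
  "Xm = {x. (fst x = 0 \<or> fst x - 1 \<in> set A) \<and> snd x \<in> set (Sub k)}"

definition Yr :: "gmove \<Rightarrow> gresp set" where
  "Yr x = {y. (if fst x = 0 then y \<in> {0} \<times> {[]} \<times> set (Sub k) else y \<in> set B \<times> set (Sub k) \<times> set (Sub k))}"

text \<open>All watching states are initial, because every controller clock is active from the
  beginning.\<close>

definition Init :: "gstate set" where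
  "Init = {q \<in> Qs. tg q = 0 \<longrightarrow> lc q \<in> set (inits T) \<and> set (ac q) = {..<k} \<and> vl q = replicate K 0 \<and> bt q = 0}"

lemma watch_Qs: "j \<le> k \<Longrightarrow> watch j \<in> Qs"
  unfolding Qs_def by blast

lemma finite_Qs: "finite Qs"
proof -
  have "Qs \<subseteq> {0} \<times> {..<c} \<times> set (Sub k) \<times> {p. set p \<subseteq> {..K * ((c + 1) * D)} \<and> length p = K} \<times> {..<2} \<union> watch ` {..k}"
    unfolding Qs_def by (auto simp: in_set_conv_nth)
  moreover have f: "finite {p. set p \<subseteq> {..K * ((c + 1) * D)} \<and> length p = K}"
    by (rule finite_lists_length_eq) simp
  ultimately show ?thesis by (elim finite_subset) (use f in auto)
qed

sublocale bg: budget_game Qs ep tr mk Xm Yr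
  by standard (use finite_Qs in \<open>auto simp: ep_def tr_def\<close>)

lemma Qs_T: "q \<in> Qs \<Longrightarrow> tg q = 0 \<Longrightarrow> lc q < c \<and> ac q \<in> set (Sub k) \<and> set (ac q) \<subseteq> {..<k} \<and> length (vl q) = K \<and> bt q < 2"
  unfolding Qs_def watch_def using Sub_D by auto

lemma in_Qs: "l < c \<Longrightarrow> a \<in> set (Sub k) \<Longrightarrow> length p = K \<Longrightarrow> (\<forall>x<K. p ! x \<le> K * ((c + 1) * D)) \<Longrightarrow> b < 2 \<Longrightarrow> (0, l, a, p, b) \<in> Qs"
  unfolding Qs_def by simp

lemma rule_tgt_less: "r \<in> set (rules T) \<Longrightarrow> r_tgt r < c"
  using wf loc unfolding wf_ta_def by blast

lemma rule_resets_K: "r \<in> set (rules T) \<Longrightarrow> rR r \<subseteq> {k..<K}"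
  using wf clk unfolding wf_ta_def rR_def K_def by fastforce

end

section \<open>From budget families to controllers\<close>

lemma region_atom1:
  assumes "region_equiv X m v v'" "x \<in> X" "\<bar>z\<bar> \<le> int m"
  shows "of_int z \<le> v x \<longleftrightarrow> of_int z \<le> v' x" "v x = of_int z \<longleftrightarrow> v' x = of_int z"
proof -
  have *: "sat \<phi> v = sat \<phi> v'" if "cc_clocks \<phi> \<subseteq> X \<and> (\<forall>z\<in>cc_consts \<phi>. \<bar>z\<bar> \<le> int m)" for \<phi>
    using assms(1) that unfolding region_equiv_def by blast
  show "of_int z \<le> v x \<longleftrightarrow> of_int z \<le> v' x" using *[of "Atom1 x CGe z"] assms(2,3) by simp
  show "v x = of_int z \<longleftrightarrow> v' x = of_int z" using *[of "Atom1 x CEq z"] assms(2,3) by simp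
qed

lemma region_atom2:
  assumes "region_equiv X m v v'" "x \<in> X" "y \<in> X" "\<bar>z\<bar> \<le> int m"
  shows "v x - v y \<le> of_int z \<longleftrightarrow> v' x - v' y \<le> of_int z"
proof -
  have *: "sat \<phi> v = sat \<phi> v'" if "cc_clocks \<phi> \<subseteq> X \<and> (\<forall>z\<in>cc_consts \<phi>. \<bar>z\<bar> \<le> int m)" for \<phi>
    using assms(1) that unfolding region_equiv_def by blast
  show ?thesis using *[of "Atom2 x y CLe z"] assms(2-4) by simp
qed

text \<open>The current budget vector, the active clocks, and for each active clock its number of
  ticks since the last reset.\<close>

type_synonym mstate = "(gstate \<Rightarrow> nat) \<times> nat set \<times> (nat \<Rightarrow> nat)"

abbreviation m_act :: "mstate \<Rightarrow> nat set" where "m_act s \<equiv> fst (snd s)"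
abbreviation m_cnt :: "mstate \<Rightarrow> nat \<Rightarrow> nat" where "m_cnt s \<equiv> snd (snd s)"

definition pend :: "valuation \<Rightarrow> mstate \<Rightarrow> bool" where
  "pend v s \<longleftrightarrow> (\<exists>x\<in>m_act s. real (m_cnt s x) + 1 \<le> v x)"

text \<open>The excess over the tick count is largest for the clocks that reached their next integer
  earliest.\<close>

definition tz :: "valuation \<Rightarrow> mstate \<Rightarrow> nat set" where
  "tz v s = {x \<in> m_act s. \<forall>y\<in>m_act s. v y - real (m_cnt s y) \<le> v x - real (m_cnt s x)}"

locale winning_family = synth_game +
  fixes G :: "(gstate \<Rightarrow> nat) set" and bb :: nat and yx :: "(gstate \<Rightarrow> nat) \<Rightarrow> gmove \<Rightarrow> gresp"
    and gx :: "(gstate \<Rightarrow> nat) \<Rightarrow> gmove \<Rightarrow> gstate \<Rightarrow> nat" and g0 :: "gstate \<Rightarrow> nat"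
  assumes eps: "\<And>g. g \<in> G \<Longrightarrow> bg.eps_ok g"
    and yx: "\<And>g x. g \<in> G \<Longrightarrow> x \<in> Xm \<Longrightarrow> yx g x \<in> Yr x" and gx: "\<And>g x. g \<in> G \<Longrightarrow> x \<in> Xm \<Longrightarrow> gx g x \<in> G"
    and mv: "\<And>g x. g \<in> G \<Longrightarrow> x \<in> Xm \<Longrightarrow> bg.move_ok g x (yx g x) (gx g x)"
    and bb: "\<And>g q. g \<in> G \<Longrightarrow> g q \<le> bb" and supp: "\<And>g q. g \<in> G \<Longrightarrow> q \<notin> Qs \<Longrightarrow> g q = 0"
    and g0: "g0 \<in> G" "\<And>q. q \<in> Init \<Longrightarrow> 0 < g0 q"
begin

text \<open>Each tick is paid from the budget of the watching state, so tick count plus remaining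
  budget stays at most \<open>bb\<close>. This keeps the counts, and with them the constants of the
  controller, bounded. The guessing state must keep a positive budget because a reset starts a new
  watch.\<close>

definition minv :: "mstate \<Rightarrow> bool" where
  "minv s \<longleftrightarrow> fst s \<in> G \<and> m_act s \<subseteq> {..<k} \<and> 0 < fst s (watch k) \<and>
     (\<forall>x\<in>m_act s. 0 < fst s (watch x) \<and> m_cnt s x + fst s (watch x) \<le> bb) \<and> (\<forall>x. x \<notin> m_act s \<longrightarrow> m_cnt s x = 0)"

section \<open>Replaying the ticks between two letters\<close>

definition tmove :: "valuation \<Rightarrow> mstate \<Rightarrow> gmove" where "tmove v s = (0, zl k (tz v s))"

definition tact :: "valuation \<Rightarrow> mstate \<Rightarrow> nat set" where
  "tact v s = m_act s \<inter> set (snd (snd (yx (fst s) (tmove v s))))"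

definition tk :: "valuation \<Rightarrow> mstate \<Rightarrow> mstate" where
  "tk v s = (if pend v s then (gx (fst s) (tmove v s), tact v s,
      \<lambda>x. if x \<in> tact v s then (if x \<in> tz v s then Suc (m_cnt s x) else m_cnt s x) else 0) else s)"

lemma tz_sub: "minv s \<Longrightarrow> tz v s \<subseteq> {..<k}"
  unfolding minv_def tz_def by auto

lemma tmove_Xm: "minv s \<Longrightarrow> tmove v s \<in> Xm"
  unfolding tmove_def Xm_def using zl[OF tz_sub] by auto

lemma set_tmove: "minv s \<Longrightarrow> set (snd (tmove v s)) = tz v s"
  unfolding tmove_def using zl[OF tz_sub] by simp

lemma tz_ne: assumes "minv s" "pend v s" shows "tz v s \<noteq> {}"
proof -
  have fin: "finite (m_act s)" using assms(1) finite_subset unfolding minv_def by blast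
  have ne: "m_act s \<noteq> {}" using assms(2) unfolding pend_def by auto
  define f where "f x = v x - real (m_cnt s x)" for x
  have "Max (f ` m_act s) \<in> f ` m_act s" using fin ne by (intro Max_in) auto
  then obtain x where x: "x \<in> m_act s" "f x = Max (f ` m_act s)" by auto
  have "f y \<le> f x" if "y \<in> m_act s" for y unfolding x(2) using fin that by (intro Max_ge) auto
  then have "x \<in> tz v s" using x(1) unfolding tz_def f_def by blast
  then show ?thesis by blast
qed

text \<open>The case \<open>j = k\<close> starts a watch by guessing; the other one continues the
  watch of a clock that is kept active.\<close>

lemma watch_step:
  assumes g: "g \<in> G" and x: "x \<in> Xm" and j: "j \<le> k" "0 < g (watch j)" and j': "j' \<le> k"
    and t: "j = k \<or> j' = j \<and> j \<in> set (snd (snd (yx g x))) \<and> j \<notin> set (fst (snd (yx g x)))"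
  shows "0 < gx g x (watch j')" "gx g x (watch j') + of_bool (fst x = 0 \<and> j \<in> set (snd x)) \<le> g (watch j)"
proof -
  have "tr_watch (yx g x) (watch j) (watch j')" using t unfolding tr_watch_def watch_def by simp
  then have "tr x (yx g x) (watch j) (watch j')" unfolding tr_def using watch_Qs j j' by blast
  then have "0 < gx g x (watch j') \<and> gx g x (watch j') + of_bool (mk x (watch j)) \<le> g (watch j)"
    using mv[OF g x] j(2) unfolding bg.move_ok_def by blast
  moreover have "mk x (watch j) = (fst x = 0 \<and> j \<in> set (snd x))" unfolding mk_def watch_def by simp
  ultimately show "0 < gx g x (watch j')" "gx g x (watch j') + of_bool (fst x = 0 \<and> j \<in> set (snd x)) \<le> g (watch j)" by auto
qed

lemma tk_inv: assumes "minv s" shows "minv (tk v s)"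
proof (cases "pend v s")
  case True
  let ?x = "tmove v s"
  have g: "fst s \<in> G" and a: "m_act s \<subseteq> {..<k}" and w: "0 < fst s (watch k)" and
    wx: "\<And>x. x \<in> m_act s \<Longrightarrow> 0 < fst s (watch x) \<and> m_cnt s x + fst s (watch x) \<le> bb" using assms unfolding minv_def by auto
  have X: "?x \<in> Xm" using tmove_Xm[OF assms] .
  have Y: "fst (snd (yx (fst s) ?x)) = []" using yx[OF g X] unfolding Yr_def tmove_def by auto
  have 1: "0 < gx (fst s) ?x (watch k)" using watch_step(1)[OF g X _ w, of k] by simp
  have 2: "0 < gx (fst s) ?x (watch x) \<and> gx (fst s) ?x (watch x) + of_bool (x \<in> tz v s) \<le> fst s (watch x)" if "x \<in> tact v s" for x
  proof -
    have x: "x \<in> m_act s" "x \<in> set (snd (snd (yx (fst s) ?x)))" "x \<le> k" using that a unfolding tact_def by auto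
    show ?thesis using watch_step[OF g X x(3) _ x(3)] wx[OF x(1)] x(2) Y set_tmove[OF assms, of v]
      unfolding tmove_def by auto
  qed
  have "m_cnt (tk v s) x + gx (fst s) ?x (watch x) \<le> bb" if x: "x \<in> tact v s" for x
    using 2[OF x] wx[of x] x True unfolding tk_def tact_def by auto
  then show ?thesis using True 1 2 gx[OF g X] a unfolding minv_def tk_def tact_def by auto
qed (use assms in \<open>simp add: tk_def\<close>)

text \<open>The number of ticks the active clocks can still afford; it proves that replaying ticks
  terminates.\<close>

definition pot :: "mstate \<Rightarrow> nat" where "pot s = (\<Sum>x\<in>m_act s. bb - m_cnt s x)"

lemma pot_tk: assumes "minv s" "pend v s" shows "pot (tk v s) < pot s"
proof -
  have fin: "finite (m_act s)" using assms(1) finite_subset unfolding minv_def by blast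
  have n: "m_cnt s x < bb" if "x \<in> m_act s" for x using assms(1) that unfolding minv_def by fastforce
  let ?f = "\<lambda>x. if x \<in> tact v s then bb - m_cnt (tk v s) x else 0"
  have "pot (tk v s) = (\<Sum>x\<in>tact v s. bb - m_cnt (tk v s) x)" using assms(2) unfolding pot_def tk_def by simp
  also have "\<dots> = (\<Sum>x\<in>m_act s \<inter> tact v s. bb - m_cnt (tk v s) x)"
    by (rule sum.cong) (auto simp: tact_def)
  also have "\<dots> = (\<Sum>x\<in>m_act s. ?f x)" using fin by (rule sum.inter_restrict)
  also have "\<dots> < pot s" unfolding pot_def
  proof (rule sum_strict_mono_ex1[OF fin])
    show "\<forall>x\<in>m_act s. ?f x \<le> bb - m_cnt s x" using assms(2) unfolding tk_def by auto
    obtain z where z: "z \<in> tz v s" using tz_ne[OF assms] by blast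
    then have "z \<in> m_act s" unfolding tz_def by simp
    moreover from this have "?f z < bb - m_cnt s z" using n[of z] z assms(2) unfolding tk_def by auto
    ultimately show "\<exists>x\<in>m_act s. ?f x < bb - m_cnt s x" by blast
  qed
  finally show ?thesis .
qed

lemma funpow_tk_inv: "minv s \<Longrightarrow> minv ((tk v ^^ N) s)"
  by (induction N) (auto intro: tk_inv)

lemma funpow_tk_fixed: "\<not> pend v s \<Longrightarrow> (tk v ^^ N) s = s"
  by (induction N) (auto simp: tk_def)

lemma tk_terminates: "minv s \<Longrightarrow> pot s < N \<Longrightarrow> \<not> pend v ((tk v ^^ N) s)"
proof (induction N arbitrary: s)
  case (Suc N)
  show ?case
  proof (cases "pend v s")
    case True
    then have "pot (tk v s) < N" using pot_tk[OF Suc.prems(1) True] Suc.prems(2) by simp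
    then show ?thesis using Suc.IH[OF tk_inv[OF Suc.prems(1)]] by (simp add: funpow_swap1)
  next
    case False
    then show ?thesis unfolding funpow_tk_fixed[OF False] .
  qed
qed simp

lemma pot_bound: assumes "minv s" shows "pot s \<le> k * bb"
proof -
  have a: "m_act s \<subseteq> {..<k}" using assms unfolding minv_def by blast
  have "pot s \<le> card (m_act s) * bb" unfolding pot_def by (rule order_trans[OF sum_bounded_above[of _ _ bb]]) auto
  also have "\<dots> \<le> k * bb" using card_mono[OF _ a] by (intro mult_right_mono) auto
  finally show ?thesis .
qed

text \<open>The controller acts at letters only, so it makes up for all ticks since the previous
  letter at once. \<open>pot\<close> is at most \<open>k * bb\<close>, and surplus iterations change
  nothing.\<close>

definition settle :: "valuation \<Rightarrow> mstate \<Rightarrow> mstate" where "settle v s = (tk v ^^ Suc (k * bb)) s"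

lemma settle: assumes "minv s" shows "minv (settle v s)" "\<not> pend v (settle v s)"
proof -
  show "minv (settle v s)" unfolding settle_def using funpow_tk_inv[OF assms] .
  have "pot s < Suc (k * bb)" using pot_bound[OF assms] by simp
  then show "\<not> pend v (settle v s)" unfolding settle_def using tk_terminates[OF assms] by blast
qed

text \<open>Needed because the correctness proof interleaves ticks with epsilon steps and so arrives
  at a settled state after some other number of iterations.\<close>

lemma settle_unique: assumes "minv s" "\<not> pend v ((tk v ^^ j) s)" shows "settle v s = (tk v ^^ j) s"
proof (cases "j \<le> Suc (k * bb)")
  case True
  then have "settle v s = (tk v ^^ (Suc (k * bb) - j)) ((tk v ^^ j) s)" unfolding settle_def
    by (metis funpow_add le_add_diff_inverse2 o_apply)
  then show ?thesis using funpow_tk_fixed[OF assms(2)] by simp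
next
  case False
  then have "(tk v ^^ j) s = (tk v ^^ (j - Suc (k * bb))) (settle v s)" unfolding settle_def
    by (metis funpow_add le_add_diff_inverse2 nat_le_linear o_apply)
  then show ?thesis using funpow_tk_fixed[OF settle(2)[OF assms(1)]] by simp
qed

section \<open>Answering a letter\<close>

definition lmove :: "nat \<Rightarrow> valuation \<Rightarrow> mstate \<Rightarrow> gmove" where
  "lmove a v s = (Suc a, zl k {x \<in> m_act s. v x = real (m_cnt s x)})"

definition lresp :: "nat \<Rightarrow> valuation \<Rightarrow> mstate \<Rightarrow> gresp" where "lresp a v s = yx (fst s) (lmove a v s)"

definition lact :: "nat \<Rightarrow> valuation \<Rightarrow> mstate \<Rightarrow> nat set" where
  "lact a v s = set (snd (snd (lresp a v s))) \<inter> (m_act s \<union> set (fst (snd (lresp a v s))))"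

definition lt :: "nat \<Rightarrow> valuation \<Rightarrow> mstate \<Rightarrow> mstate" where
  "lt a v s = (gx (fst s) (lmove a v s), lact a v s,
     \<lambda>x. if x \<in> lact a v s \<and> x \<notin> set (fst (snd (lresp a v s))) then m_cnt s x else 0)"

lemma lmove_Xm: assumes "minv s" "a \<in> set A" shows "lmove a v s \<in> Xm" "set (snd (lmove a v s)) = {x \<in> m_act s. v x = real (m_cnt s x)}"
proof -
  have "{x \<in> m_act s. v x = real (m_cnt s x)} \<subseteq> {..<k}" using assms(1) unfolding minv_def by auto
  from zl[OF this] show "lmove a v s \<in> Xm" "set (snd (lmove a v s)) = {x \<in> m_act s. v x = real (m_cnt s x)}"
    using assms(2) unfolding lmove_def Xm_def by auto
qed

lemma lresp_Yr: assumes "minv s" "a \<in> set A"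
  shows "fst (lresp a v s) \<in> set B" "set (fst (snd (lresp a v s))) \<subseteq> {..<k}"
proof -
  have "lresp a v s \<in> Yr (lmove a v s)" unfolding lresp_def using yx lmove_Xm(1)[OF assms] assms(1) unfolding minv_def by blast
  then show "fst (lresp a v s) \<in> set B" "set (fst (snd (lresp a v s))) \<subseteq> {..<k}"
    unfolding Yr_def lmove_def using Sub_D by (auto simp: mem_Times_iff)
qed

lemma lt_inv: assumes "minv s" "a \<in> set A" shows "minv (lt a v s)"
proof -
  let ?x = "lmove a v s"
  have g: "fst s \<in> G" and a: "m_act s \<subseteq> {..<k}" and w: "0 < fst s (watch k)" and
    wx: "\<And>x. x \<in> m_act s \<Longrightarrow> 0 < fst s (watch x) \<and> m_cnt s x + fst s (watch x) \<le> bb" using assms unfolding minv_def by auto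
  have X: "?x \<in> Xm" using lmove_Xm(1)[OF assms] .
  have 1: "0 < gx (fst s) ?x (watch k)" using watch_step(1)[OF g X _ w, of k] by simp
  have 2: "0 < gx (fst s) ?x (watch x) \<and> m_cnt (lt a v s) x + gx (fst s) ?x (watch x) \<le> bb" if x: "x \<in> lact a v s" for x
  proof -
    have xk: "x < k" using x a lresp_Yr(2)[OF assms, of v] unfolding lact_def by auto
    show ?thesis
    proof (cases "x \<in> set (fst (snd (lresp a v s)))")
      case True
      then show ?thesis using watch_step(1)[OF g X _ w, of x] xk bb[OF gx[OF g X]] unfolding lt_def by simp
    next
      case False
      then have "x \<in> m_act s" "x \<in> set (snd (snd (yx (fst s) ?x)))" using x unfolding lact_def lresp_def by auto
      then show ?thesis using watch_step[OF g X _ _, of x x] xk wx[of x] False x unfolding lt_def lresp_def by auto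
    qed
  qed
  have "lact a v s \<subseteq> {..<k}" using a lresp_Yr(2)[OF assms, of v] unfolding lact_def by auto
  then show ?thesis using 1 2 gx[OF g X] unfolding minv_def lt_def by auto
qed

lemma finite_minv: "finite {s. minv s}"
proof -
  let ?F = "{g. \<forall>q. (q \<in> Qs \<longrightarrow> g q \<in> {..bb}) \<and> (q \<notin> Qs \<longrightarrow> g q = 0)}"
  let ?N = "{n. \<forall>x. (x \<in> {..<k} \<longrightarrow> n x \<in> {..bb}) \<and> (x \<notin> {..<k} \<longrightarrow> n x = (0::nat))}"
  have "finite ?F" using finite_set_of_finite_funs[OF finite_Qs, of "{..bb}" 0] by simp
  moreover have "finite ?N" using finite_set_of_finite_funs[of "{..<k}" "{..bb}" 0] by simp
  moreover have "{s. minv s} \<subseteq> ?F \<times> Pow {..<k} \<times> ?N"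
  proof
    fix s assume "s \<in> {s. minv s}"
    then have s: "minv s" by simp
    have "m_cnt s x \<le> bb" for x using s unfolding minv_def by (cases "x \<in> m_act s") fastforce+
    moreover have "m_cnt s x = 0" if "x \<notin> {..<k}" for x using s that unfolding minv_def by blast
    ultimately have "m_cnt s \<in> ?N" by simp
    moreover have "fst s \<in> ?F" "m_act s \<in> Pow {..<k}" using s bb supp unfolding minv_def by auto
    ultimately show "s \<in> ?F \<times> Pow {..<k} \<times> ?N" by (simp add: mem_Times_iff)
  qed
  ultimately show ?thesis by (meson finite_Pow_iff finite_SigmaI finite_lessThan finite_subset)
qed

text \<open>Replaying compares a clock with its count or the next integer, and clock differences
  with differences of counts. Counts are at most \<open>bb\<close>, so constants up to
  \<open>bb + 1\<close> suffice.\<close>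

lemma tk_region:
  assumes "minv s" "region_equiv {..<k} (bb + 1) v v'"
  shows "tk v s = tk v' s" "{x \<in> m_act s. v x = real (m_cnt s x)} = {x \<in> m_act s. v' x = real (m_cnt s x)}"
proof -
  have a: "x < k" "m_cnt s x \<le> bb" if "x \<in> m_act s" for x
    using assms(1) that unfolding minv_def by fastforce+
  have e1: "pend v s = pend v' s" unfolding pend_def
  proof (rule bex_cong[OF refl])
    fix x assume x: "x \<in> m_act s"
    show "(real (m_cnt s x) + 1 \<le> v x) = (real (m_cnt s x) + 1 \<le> v' x)"
      using region_atom1(1)[OF assms(2), of x "int (m_cnt s x + 1)"] a[OF x] by (simp add: add.commute)
  qed
  have e2: "tz v s = tz v' s"
  proof -
    have "v y - real (m_cnt s y) \<le> v x - real (m_cnt s x) \<longleftrightarrow> v' y - real (m_cnt s y) \<le> v' x - real (m_cnt s x)"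
      if xy: "x \<in> m_act s" "y \<in> m_act s" for x y
    proof -
      have "v y - v x \<le> of_int (int (m_cnt s y) - int (m_cnt s x)) \<longleftrightarrow> v' y - v' x \<le> of_int (int (m_cnt s y) - int (m_cnt s x))"
        by (rule region_atom2[OF assms(2)]) (use a[OF xy(1)] a[OF xy(2)] in auto)
      then show ?thesis by (simp add: algebra_simps)
    qed
    then show ?thesis unfolding tz_def by auto
  qed
  show "tk v s = tk v' s" unfolding tk_def tact_def tmove_def e1 e2 ..
  show "{x \<in> m_act s. v x = real (m_cnt s x)} = {x \<in> m_act s. v' x = real (m_cnt s x)}"
  proof (rule Collect_cong, rule conj_cong[OF refl])
    fix x assume x: "x \<in> m_act s"
    show "(v x = real (m_cnt s x)) = (v' x = real (m_cnt s x))"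
      using region_atom1(2)[OF assms(2), of x "int (m_cnt s x)"] a[OF x] by simp
  qed
qed

lemma settle_region: assumes "minv s" "region_equiv {..<k} (bb + 1) v v'" shows "settle v s = settle v' s"
proof -
  have "(tk v ^^ N) s = (tk v' ^^ N) s" for N
    by (induction N) (use tk_region(1)[OF funpow_tk_inv[OF assms(1)] assms(2)] in auto)
  then show ?thesis unfolding settle_def .
qed

lemma lt_region: assumes "minv s" "region_equiv {..<k} (bb + 1) v v'" shows "lmove a v s = lmove a v' s" "lresp a v s = lresp a v' s" "lt a v s = lt a v' s"
proof -
  show l: "lmove a v s = lmove a v' s" using tk_region(2)[OF assms] unfolding lmove_def by simp
  then show r: "lresp a v s = lresp a v' s" unfolding lresp_def by simp
  show "lt a v s = lt a v' s" unfolding lt_def lact_def l r ..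
qed

text \<open>Controller memory consists of natural numbers; any injective numbering of the finitely
  many memory states will do.\<close>

definition code :: "mstate \<Rightarrow> nat" where "code = (SOME f. inj_on f {s. minv s})"
definition dcd :: "nat \<Rightarrow> mstate" where "dcd = inv_into {s. minv s} code"

lemma dcd_code: "minv s \<Longrightarrow> dcd (code s) = s"
proof -
  obtain f :: "mstate \<Rightarrow> nat" and n where "f ` {s. minv s} = {i. i < n}" "inj_on f {s. minv s}"
    using finite_imp_inj_to_nat_seg[OF finite_minv] by blast
  then have "inj_on code {s. minv s}" unfolding code_def by (metis someI_ex)
  then show "minv s \<Longrightarrow> dcd (code s) = s" unfolding dcd_def by simp
qed

definition ctl :: ctrl_fun where
  "ctl l a v = (let s = settle v (dcd l) in (code (lt a v s), fst (lresp a v s), set (fst (snd (lresp a v s)))))"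

definition s0 :: mstate where "s0 = (g0, {..<k}, \<lambda>_. 0)"

lemma s0_inv: "minv s0"
proof -
  have "0 < g0 (watch j) \<and> g0 (watch j) \<le> bb" if "j \<le> k" for j
  proof -
    have "watch j \<in> Init" unfolding Init_def using watch_Qs[OF that] by (simp add: watch_def)
    then show ?thesis using g0 bb by blast
  qed
  then show ?thesis unfolding minv_def s0_def using g0(1) by auto
qed

lemma ctl_is_controller: "is_controller A B k (bb + 1) (code ` {s. minv s}) (code s0) ctl"
proof -
  have "\<forall>l\<in>code ` {s. minv s}. \<forall>a\<in>set A. \<forall>v. (let (l', b, Y) = ctl l a v in l' \<in> code ` {s. minv s} \<and> b \<in> set B \<and> Y \<subseteq> {..<k})"
  proof (intro ballI allI)
    fix l a v assume l: "l \<in> code ` {s. minv s}" and a: "a \<in> set A"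
    then obtain s where s: "minv s" "dcd l = s" using dcd_code by auto
    show "let (l', b, Y) = ctl l a v in l' \<in> code ` {s. minv s} \<and> b \<in> set B \<and> Y \<subseteq> {..<k}"
      unfolding ctl_def Let_def using lt_inv[OF settle(1)[OF s(1)] a] lresp_Yr[OF settle(1)[OF s(1)] a] s(2) by simp
  qed
  moreover have "\<forall>l\<in>code ` {s. minv s}. \<forall>a\<in>set A. \<forall>v v'. region_equiv {..<k} (bb + 1) v v' \<longrightarrow> ctl l a v = ctl l a v'"
  proof (intro ballI allI impI)
    fix l a v v' assume l: "l \<in> code ` {s. minv s}" and r: "region_equiv {..<k} (bb + 1) v v'"
    then obtain s where s: "minv s" "dcd l = s" using dcd_code by auto
    show "ctl l a v = ctl l a v'"
      unfolding ctl_def s(2) settle_region[OF s(1) r] Let_def using lt_region[OF settle(1)[OF s(1)] r] by simp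
  qed
  ultimately show ?thesis unfolding is_controller_def using finite_minv s0_inv by blast
qed

text \<open>An accepting run on the play is followed inside the tick game, with its epsilon steps
  and the ticks ordered by time. The budget of the accompanying game state never rises and drops in
  every round with a final visit, which cannot happen infinitely often.\<close>

lemma ctl_wins:
  assumes aA: "\<And>n. a n \<in> set A" and t0: "0 \<le> t 0" and tmono: "\<And>n. t n \<le> t (Suc n)"
  shows "(\<lambda>n. ((a n, ctrl_answer ctl (code s0) a t n), t n)) \<notin> ta_lang T"
proof
  assume "(\<lambda>n. ((a n, ctrl_answer ctl (code s0) a t n), t n)) \<in> ta_lang T"
  then obtain rs ts e where run: "is_run T rs ts" and acc: "is_accepting T rs" and e: "strict_mono e"
    and range_e: "range e = {i. r_lab (rs i) \<noteq> None}"
    and word: "\<And>n. ((a n, ctrl_answer ctl (code s0) a t n), t n) = (the (r_lab (rs (e n))), ts (e n))"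
    unfolding ta_lang_def by blast
  have R: "r_src (rs 0) \<in> set (inits T)" "0 \<le> ts 0" "rs i \<in> set (rules T)" "r_tgt (rs i) = r_src (rs (Suc i))"
      "ts i \<le> ts (Suc i)" "sat (r_guard (rs i)) (run_val rs ts i)" for i
    using run unfolding is_run_def by auto
  have tsm: "ts i \<le> ts j" if "i \<le> j" for i j using lift_Suc_mono_le[of ts, OF R(5)] that .
  define cf where "cf n = ctrl_conf ctl (code s0) a t n" for n
  define v where "v n = ctrl_val ctl (code s0) a t n" for n
  define tp where "tp n = (if n = 0 then 0 else t (n - 1))" for n
  define S where "S n = dcd (fst (cf n))" for n
  have v: "v n = (\<lambda>x. snd (cf n) x + (t n - tp n))" for n unfolding v_def cf_def ctrl_val_def tp_def by simp
  have cf_Suc: "cf (Suc n) = (fst (ctl (fst (cf n)) (a n) (v n)), \<lambda>x. if x \<in> snd (snd (ctl (fst (cf n)) (a n) (v n))) then 0 else v n x)" for n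
    unfolding v tp_def cf_def ctrl_conf.simps(2) Let_def split_beta by simp
  have cfS: "cf (Suc n) = (code (lt (a n) (v n) (settle (v n) (S n))),
      \<lambda>x. if x \<in> set (fst (snd (lresp (a n) (v n) (settle (v n) (S n))))) then 0 else v n x)" for n
    unfolding cf_Suc ctl_def Let_def S_def by simp
  have Sinv: "minv (S n)" and SSuc: "S (Suc n) = lt (a n) (v n) (settle (v n) (S n))" for n
  proof -
    have "minv (S n) \<and> fst (cf n) = code (S n)"
    proof (induction n)
      case 0
      have "fst (cf 0) = code s0" unfolding cf_def by simp
      then show ?case using s0_inv dcd_code unfolding S_def by simp
    next
      case (Suc n)
      have "minv (lt (a n) (v n) (settle (v n) (S n)))" using Suc lt_inv settle(1) aA by blast
      then show ?case using dcd_code unfolding S_def[of "Suc n"] cfS by simp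
    qed
    then show "minv (S n)" by blast
    have "minv (lt (a n) (v n) (settle (v n) (S n)))" using \<open>minv (S n)\<close> lt_inv settle(1) aA by blast
    then show "S (Suc n) = lt (a n) (v n) (settle (v n) (S n))" using dcd_code unfolding S_def[of "Suc n"] cfS by simp
  qed
  have S0: "S 0 = s0" unfolding S_def cf_def using s0_inv dcd_code by simp
  have ans: "ctrl_answer ctl (code s0) a t n = fst (lresp (a n) (v n) (settle (v n) (S n)))" for n
    unfolding ctrl_answer_def S_def cf_def v_def ctl_def Let_def by simp
  have lab: "r_lab (rs (e n)) = Some (a n, fst (lresp (a n) (v n) (settle (v n) (S n))))" "ts (e n) = t n" for n
  proof -
    have "e n \<in> {i. r_lab (rs i) \<noteq> None}" using range_e by blast
    then show "r_lab (rs (e n)) = Some (a n, fst (lresp (a n) (v n) (settle (v n) (S n))))"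
      using word[of n] ans[of n] by auto
    show "ts (e n) = t n" using word[of n] by simp
  qed
  define F where "F j \<longleftrightarrow> r_tgt (rs j) \<in> set (finals T)" for j
  \<comment> \<open>The previous letter is included: the target of its rule is the first location
    recorded by the new bit.\<close>
  define lo where "lo n = (if n = 0 then 0 else e (n - 1))" for n
  \<comment> \<open>Here s is the current time in round n, i the next rule of the run, and w a real
    valuation in the region of q. Since \<open>v n x - (t n - s)\<close> is the value of controller
    clock x at time s, w x is that value minus the ticks made so far.\<close>
  define J where "J n s i st q \<longleftrightarrow> minv st \<and> q \<in> Qs \<and> tg q = 0 \<and> 0 < fst st q \<and> set (ac q) = m_act st \<and> lc q = r_src (rs i) \<and>
      (\<forall>x<K. even (vl q ! x)) \<and>
      (\<exists>w. nonneg w \<and> req K c w (rv D (vl q)) \<and> (\<forall>x\<in>m_act st. w x = v n x - (t n - s) - real (m_cnt st x)) \<and>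
         (\<forall>x. w (k + x) = s - last_reset rs ts i x)) \<and>
      (\<forall>x\<in>m_act st. v n x - (t n - s) - real (m_cnt st x) \<le> 1) \<and> s \<le> t n \<and> s \<le> ts i \<and> lo n \<le> i \<and> i \<le> e n \<and>
      (\<forall>j. lo n \<le> j \<and> j < i \<and> F j \<longrightarrow> bt q = 1)" for n s i and st :: mstate and q :: gstate

  have eps_adv: "\<exists>q'. J n (ts i) (Suc i) st q' \<and> fst st q' \<le> fst st q"
    if J: "J n s i st q" and lt: "i < e n" and nl: "r_lab (rs i) = None"
      and le1: "\<forall>x\<in>m_act st. v n x - (t n - ts i) - real (m_cnt st x) \<le> 1" for n s i st q
  proof -
    obtain w where w: "nonneg w" "req K c w (rv D (vl q))" "\<And>x. x \<in> m_act st \<Longrightarrow> w x = v n x - (t n - s) - real (m_cnt st x)"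
      "\<And>x. w (k + x) = s - last_reset rs ts i x" using J unfolding J_def by blast
    have q: "minv st" "q \<in> Qs" "tg q = 0" "0 < fst st q" "set (ac q) = m_act st" "lc q = r_src (rs i)" "\<And>x. x < K \<Longrightarrow> even (vl q ! x)"
      "s \<le> ts i" "lo n \<le> i" "\<And>j. lo n \<le> j \<Longrightarrow> j < i \<Longrightarrow> F j \<Longrightarrow> bt q = 1" using J unfolding J_def by auto
    let ?d = "ts i - s" and ?r = "rs i"
    have "gP ?r (\<lambda>x. w x + ?d)" using R(6)[of i] unfolding gP_def run_val_def w(4) by simp
    then obtain p' where p': "stp (gP ?r) (rR ?r) (vl q) p'" "length p' = K" "\<forall>x<K. even (p' ! x) \<and> p' ! x \<le> K * ((c + 1) * D)"
      "req K c (rst (rR ?r) (\<lambda>x. w x + ?d)) (rv D p')"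
      using stp_abs[of "gP ?r" w ?d "vl q" "rR ?r"] q(7,8) inv_gP[OF R(3)] w(1,2) by auto
    define b' where "b' = (if bt q = 1 \<or> r_tgt ?r \<in> set (finals T) then 1 else 0 :: nat)"
    define q' where "q' = (0 :: nat, r_tgt ?r, ac q, p', b')"
    have Q': "q' \<in> Qs" unfolding q'_def by (rule in_Qs) (use rule_tgt_less[OF R(3)] Qs_T[OF q(2,3)] p' in \<open>auto simp: b'_def\<close>)
    have "ep q q'" unfolding ep_def using q Q' R(3)[of i] nl p'(1) by (auto simp: q'_def b'_def)
    then have g: "0 < fst st q' \<and> fst st q' \<le> fst st q" using eps[of "fst st"] q(1,4) unfolding bg.eps_ok_def minv_def by blast
    have disj: "x \<notin> rR ?r" if "x \<in> m_act st" for x using that q(1) rule_resets_K[OF R(3)] unfolding minv_def by fastforce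
    have "\<exists>w'. nonneg w' \<and> req K c w' (rv D (vl q')) \<and> (\<forall>x\<in>m_act st. w' x = v n x - (t n - ts i) - real (m_cnt st x)) \<and>
         (\<forall>x. w' (k + x) = ts i - last_reset rs ts (Suc i) x)"
    proof (intro exI conjI)
      show "nonneg (rst (rR ?r) (\<lambda>x. w x + ?d))" using nonneg_rst nonneg_add w(1) q(8) by simp
      show "req K c (rst (rR ?r) (\<lambda>x. w x + ?d)) (rv D (vl q'))" using p'(4) unfolding q'_def by simp
      show "\<forall>x\<in>m_act st. rst (rR ?r) (\<lambda>x. w x + ?d) x = v n x - (t n - ts i) - real (m_cnt st x)"
        using disj w(3) unfolding rst_def by simp
      show "\<forall>x. rst (rR ?r) (\<lambda>x. w x + ?d) (k + x) = ts i - last_reset rs ts (Suc i) x"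
        using w(4) unfolding rst_def rR_def by auto
    qed
    moreover have "ts i \<le> t n" using tsm[of i "e n"] lt lab(2) by simp
    moreover have "bt q' = 1" if "lo n \<le> j" "j < Suc i" "F j" for j
      using that q(10)[of j] unfolding q'_def b'_def F_def by (cases "j = i") auto
    ultimately have "J n (ts i) (Suc i) st q'"
      unfolding J_def using q Q' g R(4,5) le1 lt p'(3) by (auto simp: q'_def)
    then show ?thesis using g by blast
  qed

  \<comment> \<open>s' is the moment when z reached its next integer, computed backwards from its
    value at time \<open>t n\<close>.\<close>
  have tick_adv: "\<exists>q'. J n s' i (tk (v n) st) q' \<and> fst (tk (v n) st) q' \<le> fst st q"
    if J: "J n s i st q" and pe: "pend (v n) st" and z: "z \<in> tz (v n) st" and s': "s' = t n - (v n z - real (m_cnt st z) - 1)"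
      and sle: "s' \<le> ts i" for n s i st q z s'
  proof -
    obtain w where w: "nonneg w" "req K c w (rv D (vl q))" "\<And>x. x \<in> m_act st \<Longrightarrow> w x = v n x - (t n - s) - real (m_cnt st x)"
      "\<And>x. w (k + x) = s - last_reset rs ts i x" using J unfolding J_def by blast
    have q: "minv st" "q \<in> Qs" "tg q = 0" "0 < fst st q" "set (ac q) = m_act st" "lc q = r_src (rs i)" "\<And>x. x < K \<Longrightarrow> even (vl q ! x)"
      "\<And>x. x \<in> m_act st \<Longrightarrow> v n x - (t n - s) - real (m_cnt st x) \<le> 1" using J unfolding J_def by auto
    let ?d = "s' - s" and ?Z = "tz (v n) st" and ?x = "tmove (v n) st"
    have zA: "z \<in> m_act st" and zmax: "\<And>y. y \<in> m_act st \<Longrightarrow> v n y - real (m_cnt st y) \<le> v n z - real (m_cnt st z)"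
      using z unfolding tz_def by auto
    have Zeq: "x \<in> ?Z \<longleftrightarrow> v n x - real (m_cnt st x) = v n z - real (m_cnt st z)" if "x \<in> m_act st" for x
      using that zmax zA unfolding tz_def by (auto intro: antisym)
    have d0: "0 \<le> ?d" using q(8)[OF zA] s' by simp
    have stn: "s' \<le> t n"
    proof -
      obtain y where "y \<in> m_act st" "real (m_cnt st y) + 1 \<le> v n y" using pe unfolding pend_def by blast
      then show ?thesis using zmax[of y] s' by simp
    qed
    have wd: "w x + ?d = 1 + (v n x - real (m_cnt st x)) - (v n z - real (m_cnt st z))" if "x \<in> m_act st" for x
      using w(3)[OF that] s' by simp
    have "tP (m_act st) ?Z (\<lambda>x. w x + ?d)" unfolding tP_def
    proof
      show "\<forall>x\<in>m_act st. w x + ?d \<le> 1" using wd zmax by fastforce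
      have "?Z \<subseteq> m_act st" unfolding tz_def by blast
      then show "?Z = {x \<in> m_act st. w x + ?d = 1}" using wd Zeq by auto
    qed
    moreover have actk: "m_act st \<subseteq> {..<k}" using q(1) unfolding minv_def by blast
    ultimately obtain p' where p': "stp (tP (m_act st) ?Z) ?Z (vl q) p'" "length p' = K" "\<forall>x<K. even (p' ! x) \<and> p' ! x \<le> K * ((c + 1) * D)"
      "req K c (rst ?Z (\<lambda>x. w x + ?d)) (rv D p')"
      using stp_abs[of "tP (m_act st) ?Z" w ?d "vl q" ?Z] q(7) inv_tP w(1,2) d0 by auto
    have tk: "fst (tk (v n) st) = gx (fst st) ?x" "m_act (tk (v n) st) = tact (v n) st"
      "\<And>x. m_cnt (tk (v n) st) x = (if x \<in> tact (v n) st then (if x \<in> ?Z then Suc (m_cnt st x) else m_cnt st x) else 0)"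
      using pe unfolding tk_def by auto
    have tactk: "tact (v n) st \<subseteq> {..<k}" using actk unfolding tact_def by blast
    define q' where "q' = (0 :: nat, lc q, zl k (tact (v n) st), p', bt q)"
    have Q': "q' \<in> Qs" unfolding q'_def by (rule in_Qs) (use zl[OF tactk] Qs_T[OF q(2,3)] p' in auto)
    have X: "?x \<in> Xm" using tmove_Xm[OF q(1)] .
    have "tr_tick (snd ?x) (snd (snd (yx (fst st) ?x))) q q'"
      unfolding tr_tick_def using q(3,5) p'(1) zl[OF tactk] set_tmove[OF q(1), of "v n"] z
      by (auto simp: q'_def tact_def)
    then have "tr ?x (yx (fst st) ?x) q q'" unfolding tr_def using q(2) Q' by (simp add: tmove_def)
    then have g: "0 < gx (fst st) ?x q' \<and> gx (fst st) ?x q' \<le> fst st q"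
      using mv[OF _ X, of "fst st"] q(1,4) unfolding bg.move_ok_def minv_def by (metis add_leE)
    have "\<exists>w'. nonneg w' \<and> req K c w' (rv D (vl q')) \<and>
        (\<forall>x\<in>m_act (tk (v n) st). w' x = v n x - (t n - s') - real (m_cnt (tk (v n) st) x)) \<and>
         (\<forall>x. w' (k + x) = s' - last_reset rs ts i x)"
    proof (intro exI conjI)
      show "nonneg (rst ?Z (\<lambda>x. w x + ?d))" using nonneg_rst nonneg_add w(1) d0 by simp
      show "req K c (rst ?Z (\<lambda>x. w x + ?d)) (rv D (vl q'))" using p'(4) unfolding q'_def by simp
      show "\<forall>x\<in>m_act (tk (v n) st). rst ?Z (\<lambda>x. w x + ?d) x = v n x - (t n - s') - real (m_cnt (tk (v n) st) x)"
      proof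
        fix x assume x: "x \<in> m_act (tk (v n) st)"
        then have "x \<in> m_act st" "x \<in> tact (v n) st" unfolding tk tact_def by auto
        then show "rst ?Z (\<lambda>x. w x + ?d) x = v n x - (t n - s') - real (m_cnt (tk (v n) st) x)"
          unfolding rst_def tk using Zeq[of x] s' wd[of x] by auto
      qed
      have "k + x \<notin> ?Z" for x using tz_sub[OF q(1), of "v n"] by force
      then show "\<forall>x. rst ?Z (\<lambda>x. w x + ?d) (k + x) = s' - last_reset rs ts i x"
        using w(4) unfolding rst_def by simp
    qed
    moreover have "v n x - (t n - s') - real (m_cnt (tk (v n) st) x) \<le> 1" if "x \<in> m_act (tk (v n) st)" for x
    proof -
      have "x \<in> m_act st" using that unfolding tk tact_def by auto
      then have "v n x - (t n - s') - real (m_cnt st x) \<le> 1" using zmax[of x] s' by simp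
      moreover have "m_cnt st x \<le> m_cnt (tk (v n) st) x" using that unfolding tk by auto
      ultimately show ?thesis by simp
    qed
    ultimately have "J n s' i (tk (v n) st) q'"
      using J tk_inv[OF q(1)] Q' g p'(3) zl[OF tactk] stn sle q(6) unfolding J_def by (auto simp: q'_def tk)
    then show ?thesis using g unfolding tk by blast
  qed

  \<comment> \<open>Always process the earlier event, a tick winning ties. Either a rule is consumed
    or \<open>pot\<close> drops. The condition on \<open>lo n\<close> keeps the previous letter from
    being taken for an epsilon rule.\<close>
  have settle_adv: "\<exists>s' q' j. J n s' (e n) ((tk (v n) ^^ j) st) q' \<and> \<not> pend (v n) ((tk (v n) ^^ j) st) \<and> fst ((tk (v n) ^^ j) st) q' \<le> fst st q"
    if "J n s i st q" "lo n \<le> i" "n = 0 \<or> lo n < i" for n s i st q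
    using that
  proof (induction "(e n - i) + pot st" arbitrary: s i st q rule: less_induct)
    case less
    have eps_none: "r_lab (rs i) = None" if lt: "i < e n"
    proof (rule ccontr)
      assume "\<not> ?thesis"
      then have "i \<in> range e" using range_e by blast
      then obtain m where m: "i = e m" by blast
      then have "m < n" using lt e by (simp add: strict_mono_less)
      then have "e m \<le> e (n - 1)" using e by (simp add: strict_mono_less_eq)
      then show False using less.prems(3) \<open>m < n\<close> m unfolding lo_def by auto
    qed
    have inv: "minv st" and ile: "i \<le> e n" and act1: "\<And>x. x \<in> m_act st \<Longrightarrow> v n x - (t n - s) - real (m_cnt st x) \<le> 1"
      using less.prems(1) unfolding J_def by auto
    show ?case
    proof (cases "pend (v n) st")
      case True
      obtain z where z: "z \<in> tz (v n) st" using tz_ne[OF inv True] by blast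
      define s' where "s' = t n - (v n z - real (m_cnt st z) - 1)"
      have stn: "s' \<le> t n"
      proof -
        obtain y where "y \<in> m_act st" "real (m_cnt st y) + 1 \<le> v n y" using True unfolding pend_def by blast
        then show ?thesis using z unfolding tz_def s'_def by fastforce
      qed
      show ?thesis
      proof (cases "i < e n \<and> ts i < s'")
        case ad: True
        have "\<forall>x\<in>m_act st. v n x - (t n - ts i) - real (m_cnt st x) \<le> 1"
          using z ad unfolding tz_def s'_def by fastforce
        then obtain q1 where q1: "J n (ts i) (Suc i) st q1" "fst st q1 \<le> fst st q"
          using eps_adv[OF less.prems(1) _ eps_none] ad by blast
        have "\<exists>s' q' j. J n s' (e n) ((tk (v n) ^^ j) st) q' \<and> \<not> pend (v n) ((tk (v n) ^^ j) st) \<and> fst ((tk (v n) ^^ j) st) q' \<le> fst st q1"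
          by (rule less.hyps[OF _ q1(1)]) (use ad less.prems in auto)
        then show ?thesis using q1(2) order_trans by blast
      next
        case False
        have "s' \<le> ts i"
        proof (cases "i < e n")
          case True then show ?thesis using False by simp
        next
          case False
          then have "i = e n" using ile by simp
          then show ?thesis using stn lab(2) by simp
        qed
        then obtain q1 where q1: "J n s' i (tk (v n) st) q1" "fst (tk (v n) st) q1 \<le> fst st q"
          using tick_adv[OF less.prems(1) True z s'_def] by blast
        have "\<exists>s' q' j. J n s' (e n) ((tk (v n) ^^ j) (tk (v n) st)) q' \<and> \<not> pend (v n) ((tk (v n) ^^ j) (tk (v n) st)) \<and>
            fst ((tk (v n) ^^ j) (tk (v n) st)) q' \<le> fst (tk (v n) st) q1"
          by (rule less.hyps[OF _ q1(1)]) (use pot_tk[OF inv True] less.prems in auto)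
        then obtain s'' q' j where "J n s'' (e n) ((tk (v n) ^^ Suc j) st) q'" "\<not> pend (v n) ((tk (v n) ^^ Suc j) st)"
            "fst ((tk (v n) ^^ Suc j) st) q' \<le> fst (tk (v n) st) q1"
          by (auto simp: funpow_swap1)
        then show ?thesis using q1(2) order_trans by blast
      qed
    next
      case False
      show ?thesis
      proof (cases "i < e n")
        case True
        have "v n x - (t n - ts i) - real (m_cnt st x) \<le> 1" if "x \<in> m_act st" for x
        proof -
          have "v n x < real (m_cnt st x) + 1" using False that unfolding pend_def by fastforce
          moreover have "ts i \<le> t n" using tsm[of i "e n"] True lab(2) by simp
          ultimately show ?thesis by simp
        qed
        then obtain q1 where q1: "J n (ts i) (Suc i) st q1" "fst st q1 \<le> fst st q"
          using eps_adv[OF less.prems(1) True eps_none[OF True]] by blast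
        have "\<exists>s' q' j. J n s' (e n) ((tk (v n) ^^ j) st) q' \<and> \<not> pend (v n) ((tk (v n) ^^ j) st) \<and> fst ((tk (v n) ^^ j) st) q' \<le> fst st q1"
          by (rule less.hyps[OF _ q1(1)]) (use True less.prems in auto)
        then show ?thesis using q1(2) order_trans by blast
      next
        case eq: False
        then have "i = e n" using ile by simp
        then show ?thesis using less.prems(1) False
          by (intro exI[of _ s] exI[of _ q] exI[of _ 0]) simp
      qed
    qed
  qed

  define Fn where "Fn n \<longleftrightarrow> (\<exists>j. lo n \<le> j \<and> j < e n \<and> F j)" for n
  define I where "I n = (if n = 0 then 0 else Suc (e (n - 1)))" for n
  have round: "\<exists>q'. J (Suc n) (tp (Suc n)) (I (Suc n)) (S (Suc n)) q' \<and> fst (S (Suc n)) q' + of_bool (Fn n) \<le> fst (S n) q"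
    if J0: "J n (tp n) (I n) (S n) q" for n q
  proof -
    have "lo n \<le> I n" "n = 0 \<or> lo n < I n" unfolding lo_def I_def by auto
    from settle_adv[OF J0 this] obtain s q1 j where q1: "J n s (e n) ((tk (v n) ^^ j) (S n)) q1" "\<not> pend (v n) ((tk (v n) ^^ j) (S n))"
      "fst ((tk (v n) ^^ j) (S n)) q1 \<le> fst (S n) q" by blast
    define st where "st = settle (v n) (S n)"
    have "(tk (v n) ^^ j) (S n) = st" unfolding st_def using settle_unique[OF Sinv q1(2)] by simp
    then have J: "J n s (e n) st q1" and np: "\<not> pend (v n) st" and gle: "fst st q1 \<le> fst (S n) q" using q1 by auto
    obtain w where w: "nonneg w" "req K c w (rv D (vl q1))" "\<And>x. x \<in> m_act st \<Longrightarrow> w x = v n x - (t n - s) - real (m_cnt st x)"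
      "\<And>x. w (k + x) = s - last_reset rs ts (e n) x" using J unfolding J_def by blast
    have q: "minv st" "q1 \<in> Qs" "tg q1 = 0" "0 < fst st q1" "set (ac q1) = m_act st" "lc q1 = r_src (rs (e n))" "\<And>x. x < K \<Longrightarrow> even (vl q1 ! x)"
      "s \<le> t n" "\<And>j. lo n \<le> j \<Longrightarrow> j < e n \<Longrightarrow> F j \<Longrightarrow> bt q1 = 1" using J unfolding J_def by auto
    let ?d = "t n - s" and ?r = "rs (e n)" and ?x = "lmove (a n) (v n) st" and ?y = "lresp (a n) (v n) st"
    let ?Z = "{x \<in> m_act st. v n x = real (m_cnt st x)}"
    have X: "?x \<in> Xm" "set (snd ?x) = ?Z" using lmove_Xm[OF q(1) aA] by auto
    have lab': "r_lab ?r = Some (a n, fst ?y)" using lab(1)[of n] unfolding st_def by simp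
    have wd: "w x + ?d = v n x - real (m_cnt st x)" if "x \<in> m_act st" for x using w(3)[OF that] by simp
    have "gP ?r (\<lambda>x. w x + ?d)" using R(6)[of "e n"] lab(2)[of n] unfolding gP_def run_val_def w(4) by simp
    moreover have "lP (m_act st) ?Z (\<lambda>x. w x + ?d)" unfolding lP_def
    proof
      show "\<forall>x\<in>m_act st. w x + ?d < 1" using wd np unfolding pend_def by fastforce
      show "?Z = {x \<in> m_act st. w x + ?d = 0}" using wd by auto
    qed
    moreover have actk: "m_act st \<subseteq> {..<k}" using q(1) unfolding minv_def by blast
    ultimately obtain p' where p': "stp (\<lambda>w. gP ?r w \<and> lP (m_act st) ?Z w) (set (fst (snd ?y)) \<union> rR ?r) (vl q1) p'" "length p' = K"
      "\<forall>x<K. even (p' ! x) \<and> p' ! x \<le> K * ((c + 1) * D)" "req K c (rst (set (fst (snd ?y)) \<union> rR ?r) (\<lambda>x. w x + ?d)) (rv D p')"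
      using stp_abs[of "\<lambda>w. gP ?r w \<and> lP (m_act st) ?Z w" w ?d "vl q1" "set (fst (snd ?y)) \<union> rR ?r"] q(7,8) inv_conj[OF inv_gP[OF R(3)] inv_lP] w(1,2) by auto
    have Yk: "set (fst (snd ?y)) \<subseteq> {..<k}" using lresp_Yr(2)[OF q(1) aA] .
    have lactk: "lact (a n) (v n) st \<subseteq> {..<k}" using actk Yk unfolding lact_def by blast
    define b' where "b' = (if r_tgt ?r \<in> set (finals T) then 1 else 0 :: nat)"
    define q' where "q' = (0 :: nat, r_tgt ?r, zl k (lact (a n) (v n) st), p', b')"
    have Q': "q' \<in> Qs" unfolding q'_def by (rule in_Qs) (use zl[OF lactk] rule_tgt_less[OF R(3)] p' in \<open>auto simp: b'_def\<close>)
    have "tr_letter (a n) (snd ?x) ?y q1 q'"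
      unfolding tr_letter_def using q(3,5,6) p'(1) zl[OF lactk] X(2) lab' R(3)[of "e n"]
      by (auto simp: q'_def b'_def lact_def)
    then have "tr ?x ?y q1 q'" unfolding tr_def using q(2) Q' by (simp add: lmove_def)
    then have "0 < gx (fst st) ?x q' \<and> gx (fst st) ?x q' + of_bool (mk ?x q1) \<le> fst st q1"
      using mv[OF _ X(1), of "fst st"] q(1,4) unfolding bg.move_ok_def minv_def lresp_def by blast
    moreover have "mk ?x q1" if "Fn n" using that q(3,9) unfolding mk_def Fn_def lmove_def by auto
    ultimately have g: "0 < gx (fst st) ?x q' \<and> gx (fst st) ?x q' + of_bool (Fn n) \<le> fst st q1" by (cases "Fn n") auto
    have S': "S (Suc n) = lt (a n) (v n) st" using SSuc[of n] unfolding st_def .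
    have Sc: "fst (S (Suc n)) = gx (fst st) ?x" "m_act (S (Suc n)) = lact (a n) (v n) st"
      "\<And>x. m_cnt (S (Suc n)) x = (if x \<in> lact (a n) (v n) st \<and> x \<notin> set (fst (snd ?y)) then m_cnt st x else 0)"
      unfolding S' lt_def by auto
    have vS: "v (Suc n) x - (t (Suc n) - t n) = (if x \<in> set (fst (snd ?y)) then 0 else v n x)" for x
      unfolding v[of "Suc n"] cfS tp_def st_def by simp
    have rel: "rst (set (fst (snd ?y)) \<union> rR ?r) (\<lambda>x. w x + ?d) x = v (Suc n) x - (t (Suc n) - t n) - real (m_cnt (S (Suc n)) x)"
      if x: "x \<in> m_act (S (Suc n))" for x
    proof -
      have "x < k" using x lactk unfolding Sc by auto
      then have nr: "x \<notin> rR ?r" using rule_resets_K[OF R(3), of "e n"] by auto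
      show ?thesis
      proof (cases "x \<in> set (fst (snd ?y))")
        case True then show ?thesis unfolding vS rst_def Sc by simp
      next
        case False
        then have "x \<in> m_act st" using x unfolding Sc lact_def by auto
        then show ?thesis using False nr wd x unfolding vS rst_def Sc by simp
      qed
    qed
    have "\<exists>w'. nonneg w' \<and> req K c w' (rv D (vl q')) \<and>
        (\<forall>x\<in>m_act (S (Suc n)). w' x = v (Suc n) x - (t (Suc n) - t n) - real (m_cnt (S (Suc n)) x)) \<and>
         (\<forall>x. w' (k + x) = t n - last_reset rs ts (Suc (e n)) x)"
    proof (intro exI conjI)
      show "nonneg (rst (set (fst (snd ?y)) \<union> rR ?r) (\<lambda>x. w x + ?d))" using nonneg_rst nonneg_add w(1) q(8) by simp
      show "req K c (rst (set (fst (snd ?y)) \<union> rR ?r) (\<lambda>x. w x + ?d)) (rv D (vl q'))" using p'(4) unfolding q'_def by simp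
      show "\<forall>x\<in>m_act (S (Suc n)). rst (set (fst (snd ?y)) \<union> rR ?r) (\<lambda>x. w x + ?d) x = v (Suc n) x - (t (Suc n) - t n) - real (m_cnt (S (Suc n)) x)"
        using rel by blast
      show "\<forall>x. rst (set (fst (snd ?y)) \<union> rR ?r) (\<lambda>x. w x + ?d) (k + x) = t n - last_reset rs ts (Suc (e n)) x"
        using w(4) lab(2)[of n] Yk unfolding rst_def rR_def by force
    qed
    moreover have "v (Suc n) x - (t (Suc n) - t n) - real (m_cnt (S (Suc n)) x) \<le> 1" if x: "x \<in> m_act (S (Suc n))" for x
    proof (cases "x \<in> set (fst (snd ?y))")
      case True then show ?thesis unfolding vS by simp
    next
      case False
      then have "x \<in> m_act st" "m_cnt (S (Suc n)) x = m_cnt st x" using x unfolding Sc lact_def by auto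
      then show ?thesis using False np unfolding vS pend_def by fastforce
    qed
    moreover have "bt q' = 1" if "lo (Suc n) \<le> j" "j < Suc (e n)" "F j" for j
    proof -
      have "j = e n" using that unfolding lo_def by simp
      then show ?thesis using that(3) unfolding q'_def b'_def F_def by simp
    qed
    moreover have "t n \<le> ts (Suc (e n))" using R(5)[of "e n"] lab(2) by simp
    moreover have "Suc (e n) \<le> e (Suc n)" using e by (simp add: strict_mono_Suc_iff Suc_leI)
    ultimately have "J (Suc n) (t n) (Suc (e n)) (S (Suc n)) q'"
      unfolding J_def using Sinv[of "Suc n"] Q' g p'(3) zl[OF lactk] R(4)[of "e n"] tmono[of n]
      by (auto simp: q'_def Sc lo_def)
    then show ?thesis using g gle unfolding I_def tp_def Sc by fastforce
  qed
  have J_init: "\<exists>q. J 0 (tp 0) (I 0) (S 0) q"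
  proof -
    define q where "q = (0 :: nat, r_src (rs 0), zl k {..<k}, replicate K (0 :: nat), 0 :: nat)"
    have z: "zl k {..<k} \<in> set (Sub k)" "set (zl k {..<k}) = {..<k}" using zl[of "{..<k}" k] by auto
    have "r_src (rs 0) < c" using R(1) wf loc unfolding wf_ta_def by blast
    then have Q: "q \<in> Qs" unfolding q_def by (intro in_Qs) (use z in auto)
    then have "q \<in> Init" unfolding Init_def using R(1) z by (simp add: q_def)
    then have g: "0 < g0 q" using g0 by blast
    have rz: "req K c (\<lambda>x. 0) (rv D (vl q))" unfolding req_def rv_def q_def by simp
    have v0: "v 0 x - t 0 = 0" for x unfolding v cf_def tp_def by simp
    have "J 0 0 0 s0 q" unfolding J_def
      using s0_inv Q g z rz t0 R(2) v0 e
      by (auto simp: q_def s0_def lo_def nonneg_def intro!: exI[of _ "\<lambda>x. 0"])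
    then show ?thesis unfolding tp_def I_def S0 by (intro exI[of _ q]) simp
  qed
  obtain q where q: "\<And>n. J n (tp n) (I n) (S n) (q n)" "\<And>n. fst (S (Suc n)) (q (Suc n)) + of_bool (Fn n) \<le> fst (S n) (q n)"
    using dependent_nat_choice[of "\<lambda>n q. J n (tp n) (I n) (S n) q" "\<lambda>n q q'. fst (S (Suc n)) q' + of_bool (Fn n) \<le> fst (S n) q"] J_init round by metis
  define h where "h n = fst (S n) (q n)" for n
  have "h (Suc n) \<le> h n" for n using q(2)[of n] unfolding h_def by simp
  then obtain N where N: "\<And>n. n \<ge> N \<Longrightarrow> h (Suc n) = h n" using nat_nonincreasing_stabilises[of 0 h] by blast
  obtain j where j: "j > e N" "F j" using acc unfolding is_accepting_def INFM_nat F_def by blast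
  \<comment> \<open>A visit at rule j is charged by the first letter after it.\<close>
  define n where "n = (LEAST n. j < e n)"
  have ex: "j < e (Suc j)" using strict_mono_imp_increasing[OF e, of "Suc j"] by simp
  have "j < e n" unfolding n_def using LeastI[of "\<lambda>n. j < e n", OF ex] .
  then have "N < n" using j e by (metis less_trans strict_mono_less)
  then have "\<not> j < e (n - 1)" using not_less_Least[of "n - 1" "\<lambda>n. j < e n"] unfolding n_def by simp
  then have "Fn n" unfolding Fn_def lo_def using \<open>N < n\<close> \<open>j < e n\<close> j(2) by (intro exI[of _ j]) auto
  then show False using q(2)[of n] N[of n] \<open>N < n\<close> unfolding h_def by simp
qed

theorem family_imp_controller: "has_winning_controller A B (ta_lang T) k (bb + 1)"
  unfolding has_winning_controller_def winning_controller_def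
  using ctl_is_controller ctl_wins by blast

end

section \<open>From controllers to budget families\<close>

type_synonym ctype = "(nat \<times> nat) set \<times> (nat \<times> nat) set \<times> (nat \<times> nat \<times> int) set \<times> (nat \<times> nat \<times> int) set"

text \<open>Strictly inside a unit cell, comparisons with integers depend on the cell alone.\<close>

lemma open_cell:
  fixes a :: real and f :: int and z :: nat
  assumes "of_int f < a" "a < of_int f + 1"
  shows "a < real z \<longleftrightarrow> f < int z" "a \<noteq> real z"
proof -
  show 1: "a < real z \<longleftrightarrow> f < int z"
  proof
    assume "a < real z"
    then have "of_int f < (of_int (int z) :: real)" using assms by simp
    then show "f < int z" by (simp only: of_int_less_iff)
  next
    assume "f < int z"
    then have "of_int (f + 1) \<le> (of_int (int z) :: real)" by (subst of_int_le_iff) simp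
    then show "a < real z" using assms by simp
  qed
  show "a \<noteq> real z"
  proof
    assume a: "a = real z"
    then have "\<not> f < int z" using 1 by simp
    then have "of_int (int z) \<le> (of_int f :: real)" by (simp only: of_int_le_iff not_less)
    then show False using a assms by simp
  qed
qed

locale winning_ctrl = synth_game +
  fixes m :: nat and L :: "nat set" and l0 :: nat and \<delta> :: ctrl_fun
  assumes win: "winning_controller A B (ta_lang T) k m L l0 \<delta>"
begin

section \<open>Types of controller valuations\<close>

lemma ctrl: "finite L" "l0 \<in> L" "l \<in> L \<Longrightarrow> a \<in> set A \<Longrightarrow> fst (\<delta> l a v) \<in> L" "l \<in> L \<Longrightarrow> a \<in> set A \<Longrightarrow> fst (snd (\<delta> l a v)) \<in> set B"
  "l \<in> L \<Longrightarrow> a \<in> set A \<Longrightarrow> snd (snd (\<delta> l a v)) \<subseteq> {..<k}"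
  "l \<in> L \<Longrightarrow> a \<in> set A \<Longrightarrow> region_equiv {..<k} m v v' \<Longrightarrow> \<delta> l a v = \<delta> l a v'"
  using win unfolding winning_controller_def is_controller_def Let_def split_beta by blast+

text \<open>From m + 1 on a clock's comparisons with constants up to m are fixed. Cutting at m + 1
  rather than just above m makes a clock expire exactly when it reaches an integer, that is, at a
  tick.\<close>

definition act :: "valuation \<Rightarrow> nat set" where "act v = {x. x < k \<and> v x < real (m + 1)}"

text \<open>The region for constants up to m, refined by whether a clock is below m + 1. Differences
  are recorded for inactive clocks too, since diagonal constraints can still observe them.\<close>

definition tp :: "valuation \<Rightarrow> ctype" where
  "tp v = ({(x, z). x < k \<and> z \<le> m + 1 \<and> v x < real z}, {(x, z). x < k \<and> z \<le> m \<and> v x = real z},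
     {(x, y, z). x < k \<and> y < k \<and> \<bar>z\<bar> \<le> int m \<and> v x - v y < of_int z}, {(x, y, z). x < k \<and> y < k \<and> \<bar>z\<bar> \<le> int m \<and> v x - v y = of_int z})"

definition TT :: "ctype set" where
  "TT = Pow ({..<k} \<times> {..m + 1}) \<times> Pow ({..<k} \<times> {..m}) \<times> Pow ({..<k} \<times> {..<k} \<times> {- int m..int m}) \<times> Pow ({..<k} \<times> {..<k} \<times> {- int m..int m})"

lemma finite_TT: "finite TT" unfolding TT_def by simp

lemma tp_TT: "tp v \<in> TT"
proof -
  have "a \<subseteq> {..<k} \<times> {..m + 1}" if "a = {(x, z). x < k \<and> z \<le> m + 1 \<and> v x < real z}" for a using that by auto
  moreover have "a \<subseteq> {..<k} \<times> {..m}" if "a = {(x, z). x < k \<and> z \<le> m \<and> v x = real z}" for a using that by auto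
  moreover have "{(x, y, z). x < k \<and> y < k \<and> \<bar>z\<bar> \<le> int m \<and> P x y z} \<subseteq> {..<k} \<times> {..<k} \<times> {- int m..int m}" for P by auto
  ultimately show ?thesis unfolding TT_def tp_def by simp
qed

lemma tp1: "tp v = tp v' \<Longrightarrow> x < k \<Longrightarrow> z \<le> m + 1 \<Longrightarrow> v x < real z \<longleftrightarrow> v' x < real z"
proof -
  assume a: "tp v = tp v'" "x < k" "z \<le> m + 1"
  have "(x, z) \<in> fst (tp v) \<longleftrightarrow> (x, z) \<in> fst (tp v')" using a(1) by simp
  then show ?thesis using a(2,3) by (simp add: tp_def)
qed

lemma tp2: "tp v = tp v' \<Longrightarrow> x < k \<Longrightarrow> z \<le> m \<Longrightarrow> v x = real z \<longleftrightarrow> v' x = real z"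
proof -
  assume a: "tp v = tp v'" "x < k" "z \<le> m"
  have "(x, z) \<in> fst (snd (tp v)) \<longleftrightarrow> (x, z) \<in> fst (snd (tp v'))" using a(1) by simp
  then show ?thesis using a(2,3) by (simp add: tp_def)
qed

lemma tp3: "tp v = tp v' \<Longrightarrow> x < k \<Longrightarrow> y < k \<Longrightarrow> \<bar>u\<bar> \<le> int m \<Longrightarrow> v x - v y < of_int u \<longleftrightarrow> v' x - v' y < of_int u"
proof -
  assume a: "tp v = tp v'" "x < k" "y < k" "\<bar>u\<bar> \<le> int m"
  have "(x, y, u) \<in> fst (snd (snd (tp v))) \<longleftrightarrow> (x, y, u) \<in> fst (snd (snd (tp v')))" using a(1) by simp
  then show ?thesis using a(2-4) by (simp add: tp_def)
qed

lemma tp4: "tp v = tp v' \<Longrightarrow> x < k \<Longrightarrow> y < k \<Longrightarrow> \<bar>u\<bar> \<le> int m \<Longrightarrow> v x - v y = of_int u \<longleftrightarrow> v' x - v' y = of_int u"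
proof -
  assume a: "tp v = tp v'" "x < k" "y < k" "\<bar>u\<bar> \<le> int m"
  have "(x, y, u) \<in> snd (snd (snd (tp v))) \<longleftrightarrow> (x, y, u) \<in> snd (snd (snd (tp v')))" using a(1) by simp
  then show ?thesis using a(2-4) by (simp add: tp_def)
qed

lemma tp_eqI:
  assumes "\<And>x z. x < k \<Longrightarrow> z \<le> m + 1 \<Longrightarrow> v x < real z \<longleftrightarrow> v' x < real z"
    and "\<And>x z. x < k \<Longrightarrow> z \<le> m \<Longrightarrow> v x = real z \<longleftrightarrow> v' x = real z"
    and "\<And>x y u. x < k \<Longrightarrow> y < k \<Longrightarrow> \<bar>u\<bar> \<le> int m \<Longrightarrow> v x - v y < of_int u \<longleftrightarrow> v' x - v' y < of_int u"
    and "\<And>x y u. x < k \<Longrightarrow> y < k \<Longrightarrow> \<bar>u\<bar> \<le> int m \<Longrightarrow> v x - v y = of_int u \<longleftrightarrow> v' x - v' y = of_int u"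
  shows "tp v = tp v'"
  unfolding tp_def by (intro arg_cong2[where f = Pair] Collect_cong) (auto simp: assms)

text \<open>Types record only nonnegative constants for single clocks; nonnegativity of the
  valuations decides the negative ones.\<close>

lemma tp_region:
  assumes e: "tp v = tp v'" and nn: "nonneg v" "nonneg v'"
  shows "region_equiv {..<k} m v v'"
proof -
  have c: "cmp_sem cm a z = cmp_sem cm a' z" if "(a < z) = (a' < z)" "(a = z) = (a' = z)" for cm and a a' z :: real
    using that by (cases cm) auto
  have "sat \<phi> v = sat \<phi> v'" if "cc_clocks \<phi> \<subseteq> {..<k}" "\<forall>z\<in>cc_consts \<phi>. \<bar>z\<bar> \<le> int m" for \<phi>
    using that
  proof (induction \<phi>)
    case (Atom1 x cm z)
    then have x: "x < k" "\<bar>z\<bar> \<le> int m" by auto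
    have "(v x < of_int z) = (v' x < of_int z)" "(v x = of_int z) = (v' x = of_int z)"
    proof (atomize(full), cases "z \<ge> 0")
      case True
      then obtain n where "z = int n" using nonneg_int_cases by blast
      then show "(v x < of_int z) = (v' x < of_int z) \<and> (v x = of_int z) = (v' x = of_int z)"
        using tp1[OF e x(1), of n] tp2[OF e x(1), of n] x(2) by simp
    next
      case False
      then have "(of_int z :: real) < 0" by simp
      moreover have "0 \<le> v x" "0 \<le> v' x" using nn unfolding nonneg_def by auto
      ultimately show "(v x < of_int z) = (v' x < of_int z) \<and> (v x = of_int z) = (v' x = of_int z)" by linarith
    qed
    then show ?case unfolding sat.simps by (rule c)
  next
    case (Atom2 x y cm z)
    then have x: "x < k" "y < k" "\<bar>z\<bar> \<le> int m" by auto
    show ?case unfolding sat.simps by (rule c) (use tp3[OF e x] tp4[OF e x] in auto)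
  qed auto
  then show ?thesis unfolding region_equiv_def by blast
qed

lemma tp_act: "tp v = tp v' \<Longrightarrow> act v = act v'"
  unfolding act_def using tp1[of v v' _ "m + 1"] by (intro Collect_cong conj_cong) auto

lemma tp_floor:
  assumes e: "tp v = tp v'" and nn: "nonneg v" and x: "x \<in> act v"
  shows "\<lfloor>v x\<rfloor> = \<lfloor>v' x\<rfloor>"
proof -
  have x': "x < k" "v x < real (m + 1)" "0 \<le> v x" using x nn unfolding act_def nonneg_def by auto
  then obtain f where f: "\<lfloor>v x\<rfloor> = int f" using nonneg_int_cases by (metis zero_le_floor)
  then have vf: "real f \<le> v x" "v x < real (f + 1)" by linarith+
  then have fm: "f \<le> m" using x'(2) by linarith
  have "real f \<le> v' x" "v' x < real (f + 1)" using vf tp1[OF e x'(1), of f] tp1[OF e x'(1), of "f + 1"] fm by auto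
  then have "\<lfloor>v' x\<rfloor> = int f" by linarith
  then show ?thesis using f by simp
qed

text \<open>A delay preserves differences, and inactive clocks remain at m + 1 or more, so only the
  active clocks need to be compared.\<close>

lemma tp_add:
  assumes e: "tp v = tp v'" and d: "0 \<le> d" "0 \<le> d'"
    and cell: "\<And>x z. x \<in> act v \<Longrightarrow> (v x + d < real z \<longleftrightarrow> v' x + d' < real z) \<and> (v x + d = real z \<longleftrightarrow> v' x + d' = real z)"
  shows "tp (\<lambda>x. v x + d) = tp (\<lambda>x. v' x + d')"
proof (rule tp_eqI)
  have big: "real (m + 1) \<le> v x" "real (m + 1) \<le> v' x" if "x \<notin> act v" "x < k" for x
  proof -
    have "x \<notin> act v'" using that tp_act[OF e] by simp
    then show "real (m + 1) \<le> v x" "real (m + 1) \<le> v' x" using that unfolding act_def by auto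
  qed
  fix x z :: nat assume x: "x < k"
  { assume z: "z \<le> m + 1"
    have zz: "real z \<le> real (m + 1)" using z by (simp only: of_nat_le_iff)
    show "v x + d < real z \<longleftrightarrow> v' x + d' < real z"
      using cell[of x z] big[OF _ x] d zz by (cases "x \<in> act v") auto }
  { assume z: "z \<le> m"
    have zz: "real z < real (m + 1)" using z by simp
    show "v x + d = real z \<longleftrightarrow> v' x + d' = real z"
      using cell[of x z] big[OF _ x] d zz by (cases "x \<in> act v") auto }
next
  fix x y and u :: int assume "x < k" "y < k" "\<bar>u\<bar> \<le> int m"
  then show "v x + d - (v y + d) < of_int u \<longleftrightarrow> v' x + d' - (v' y + d') < of_int u"
    "v x + d - (v y + d) = of_int u \<longleftrightarrow> v' x + d' - (v' y + d') = of_int u"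
    using tp3[OF e] tp4[OF e] by simp_all
qed

lemma tp_rst:
  assumes e: "tp v = tp v'" and nn: "nonneg v" "nonneg v'"
  shows "tp (rst Y v) = tp (rst Y v')"
proof -
  have neg: "(- v y < of_int u \<longleftrightarrow> - v' y < of_int u) \<and> (- v y = of_int u \<longleftrightarrow> - v' y = of_int u)" if y: "y < k" "\<bar>u\<bar> \<le> int m" for y u
  proof (cases "u \<le> 0")
    case True
    then obtain n where n: "u = - int n" using nonpos_int_cases by blast
    then have "n \<le> m" using y(2) by simp
    then show ?thesis using n tp1[OF e y(1), of n] tp2[OF e y(1), of n] by auto
  next
    case False
    moreover have "0 \<le> v y" "0 \<le> v' y" using nn unfolding nonneg_def by auto
    ultimately show ?thesis by auto
  qed
  have pos: "(v y < of_int u \<longleftrightarrow> v' y < of_int u) \<and> (v y = of_int u \<longleftrightarrow> v' y = of_int u)" if y: "y < k" "\<bar>u\<bar> \<le> int m" for y u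
  proof (cases "u \<ge> 0")
    case True
    then obtain n where n: "u = int n" using nonneg_int_cases by blast
    then show ?thesis using y(2) tp1[OF e y(1), of n] tp2[OF e y(1), of n] by auto
  next
    case False
    moreover have "0 \<le> v y" "0 \<le> v' y" using nn unfolding nonneg_def by auto
    ultimately show ?thesis by auto
  qed
  show ?thesis
  proof (rule tp_eqI)
    show "rst Y v x < real z \<longleftrightarrow> rst Y v' x < real z" if "x < k" "z \<le> m + 1" for x z
      using tp1[OF e that] unfolding rst_def by simp
    show "rst Y v x = real z \<longleftrightarrow> rst Y v' x = real z" if "x < k" "z \<le> m" for x z
      using tp2[OF e that] unfolding rst_def by simp
    show "rst Y v x - rst Y v y < of_int u \<longleftrightarrow> rst Y v' x - rst Y v' y < of_int u" if "x < k" "y < k" "\<bar>u\<bar> \<le> int m" for x y u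
      using tp3[OF e that] neg[OF that(2,3)] pos[OF that(1,3)] unfolding rst_def by simp
    show "rst Y v x - rst Y v y = of_int u \<longleftrightarrow> rst Y v' x - rst Y v' y = of_int u" if "x < k" "y < k" "\<bar>u\<bar> \<le> int m" for x y u
      using tp4[OF e that] neg[OF that(2,3)] pos[OF that(1,3)] unfolding rst_def by simp
  qed
qed

text \<open>Here v is the valuation at the last tick or letter and d the time since then; up to the
  next tick each active clock stays in its unit cell.\<close>

definition tickc :: "valuation \<Rightarrow> real \<Rightarrow> nat set \<Rightarrow> bool" where
  "tickc v d Z \<longleftrightarrow> nonneg v \<and> 0 \<le> d \<and> Z \<noteq> {} \<and> (\<forall>x\<in>act v. v x + d \<le> of_int \<lfloor>v x\<rfloor> + 1) \<and> Z = {x \<in> act v. v x + d = of_int \<lfloor>v x\<rfloor> + 1}"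

definition letc :: "valuation \<Rightarrow> real \<Rightarrow> nat set \<Rightarrow> bool" where
  "letc v d Z \<longleftrightarrow> nonneg v \<and> 0 \<le> d \<and> (\<forall>x\<in>act v. v x + d < of_int \<lfloor>v x\<rfloor> + 1) \<and> Z = {x \<in> act v. v x + d = of_int \<lfloor>v x\<rfloor>}"

lemma tickc_open:
  assumes t: "tickc v d Z" and x: "x \<in> act v" "x \<notin> Z"
  shows "of_int \<lfloor>v x\<rfloor> < v x + d" "v x + d < of_int \<lfloor>v x\<rfloor> + 1"
proof -
  obtain y where "y \<in> Z" using t unfolding tickc_def by blast
  then have "v y + d = of_int \<lfloor>v y\<rfloor> + 1" using t unfolding tickc_def by blast
  then have "0 < d" by linarith
  then show "of_int \<lfloor>v x\<rfloor> < v x + d" by linarith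
  have "v x + d \<le> of_int \<lfloor>v x\<rfloor> + 1" "v x + d \<noteq> of_int \<lfloor>v x\<rfloor> + 1" using t x unfolding tickc_def by auto
  then show "v x + d < of_int \<lfloor>v x\<rfloor> + 1" by linarith
qed

text \<open>Clocks in Z are at their next integer. Since Z is nonempty, the delay is positive, so
  every other active clock is strictly inside its cell; together with the type this fixes all
  comparisons.\<close>

lemma tick_det:
  assumes e: "tp v = tp v'" and t: "tickc v d Z" "tickc v' d' Z"
  shows "tp (\<lambda>x. v x + d) = tp (\<lambda>x. v' x + d')"
proof (rule tp_add[OF e])
  show "0 \<le> d" "0 \<le> d'" using t unfolding tickc_def by auto
  fix x z assume x: "x \<in> act v"
  have nn: "nonneg v" using t unfolding tickc_def by blast
  note fl = tp_floor[OF e nn x]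
  have x': "x \<in> act v'" using tp_act[OF e] x by simp
  show "(v x + d < real z \<longleftrightarrow> v' x + d' < real z) \<and> (v x + d = real z \<longleftrightarrow> v' x + d' = real z)"
  proof (cases "x \<in> Z")
    case True
    have "v x + d = of_int \<lfloor>v x\<rfloor> + 1" "v' x + d' = of_int \<lfloor>v' x\<rfloor> + 1" using t True unfolding tickc_def by blast+
    then show ?thesis using fl by simp
  next
    case False
    show ?thesis using open_cell[OF tickc_open[OF t(1) x False], of z] open_cell[OF tickc_open[OF t(2) x' False], of z] fl by simp
  qed
qed

lemma letc_open:
  assumes t: "letc v d Z" and x: "x \<in> act v" "x \<notin> Z"
  shows "of_int \<lfloor>v x\<rfloor> < v x + d" "v x + d < of_int \<lfloor>v x\<rfloor> + 1"
proof -
  have "0 \<le> d" "v x + d \<noteq> of_int \<lfloor>v x\<rfloor>" using t x unfolding letc_def by auto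
  then show "of_int \<lfloor>v x\<rfloor> < v x + d" by linarith
  show "v x + d < of_int \<lfloor>v x\<rfloor> + 1" using t x unfolding letc_def by auto
qed

lemma let_det:
  assumes e: "tp v = tp v'" and t: "letc v d Z" "letc v' d' Z"
  shows "tp (\<lambda>x. v x + d) = tp (\<lambda>x. v' x + d')"
proof (rule tp_add[OF e])
  show "0 \<le> d" "0 \<le> d'" using t unfolding letc_def by auto
  fix x z assume x: "x \<in> act v"
  have nn: "nonneg v" using t unfolding letc_def by blast
  note fl = tp_floor[OF e nn x]
  have x': "x \<in> act v'" using tp_act[OF e] x by simp
  show "(v x + d < real z \<longleftrightarrow> v' x + d' < real z) \<and> (v x + d = real z \<longleftrightarrow> v' x + d' = real z)"
  proof (cases "x \<in> Z")
    case True
    have "v x + d = of_int \<lfloor>v x\<rfloor>" "v' x + d' = of_int \<lfloor>v' x\<rfloor>" using t True unfolding letc_def by blast+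
    then show ?thesis using fl by simp
  next
    case False
    show ?thesis using open_cell[OF letc_open[OF t(1) x False], of z] open_cell[OF letc_open[OF t(2) x' False], of z] fl by simp
  qed
qed

section \<open>The finite machine obtained from a controller\<close>

type_synonym mach = "(nat \<times> ctype) option"

definition pickt :: "ctype \<Rightarrow> nat set \<Rightarrow> valuation \<times> real" where
  "pickt \<kappa> Z = (SOME p. tp (fst p) = \<kappa> \<and> tickc (fst p) (snd p) Z)"

definition pickl :: "ctype \<Rightarrow> nat set \<Rightarrow> valuation \<times> real" where
  "pickl \<kappa> Z = (SOME p. tp (fst p) = \<kappa> \<and> letc (fst p) (snd p) Z)"

definition after :: "valuation \<times> real \<Rightarrow> valuation" where "after p = (\<lambda>x. fst p x + snd p)"

lemma pickt: assumes "tickc v d Z" shows "tp (fst (pickt (tp v) Z)) = tp v" "tickc (fst (pickt (tp v) Z)) (snd (pickt (tp v) Z)) Z"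
  using someI[of "\<lambda>p. tp (fst p) = tp v \<and> tickc (fst p) (snd p) Z" "(v, d)"] assms unfolding pickt_def by auto

lemma pickl: assumes "letc v d Z" shows "tp (fst (pickl (tp v) Z)) = tp v" "letc (fst (pickl (tp v) Z)) (snd (pickl (tp v) Z)) Z"
  using someI[of "\<lambda>p. tp (fst p) = tp v \<and> letc (fst p) (snd p) Z" "(v, d)"] assms unfolding pickl_def by auto

text \<open>Moves that no valuation can realise still require an answer. Dropping all clocks ends
  every watch of a particular clock, and the guessing state alone is never marked.\<close>

definition sink_out :: "gmove \<Rightarrow> gresp" where
  "sink_out x = (if fst x = 0 then (0, [], zl k {}) else (fst (snd (\<delta> l0 (fst x - 1) (\<lambda>_. 0))), zl k {}, zl k {}))"

text \<open>The controller is evaluated at a chosen representative; \<open>tick_det\<close>,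
  \<open>let_det\<close> and the region invariance of \<open>\<delta>\<close> make the choice
  immaterial. The clocks declared active are exactly those below m + 1.\<close>

definition live_out :: "nat \<Rightarrow> ctype \<Rightarrow> gmove \<Rightarrow> mach \<times> gresp" where
  "live_out l \<kappa> x = (if fst x = 0 then let v = after (pickt \<kappa> (set (snd x))) in (Some (l, tp v), (0, [], zl k (act v)))
     else let v = after (pickl \<kappa> (set (snd x))); r = \<delta> l (fst x - 1) v; v' = rst (snd (snd r)) v
       in (Some (fst r, tp v'), (fst (snd r), zl k (snd (snd r)), zl k (act v'))))"

definition possible :: "ctype \<Rightarrow> gmove \<Rightarrow> bool" where
  "possible \<kappa> x \<longleftrightarrow> (\<exists>v d. tp v = \<kappa> \<and> (if fst x = 0 then tickc v d (set (snd x)) else letc v d (set (snd x))))"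

text \<open>A live state is a memory value with the type at the last tick or letter;
  \<open>None\<close> is a sink for impossible moves.\<close>

definition mstep :: "mach \<Rightarrow> gmove \<Rightarrow> mach \<times> gresp" where
  "mstep s x = (case s of None \<Rightarrow> (None, sink_out x) | Some (l, \<kappa>) \<Rightarrow> if possible \<kappa> x then live_out l \<kappa> x else (None, sink_out x))"

definition MS :: "mach set" where "MS = insert None (Some ` (L \<times> TT))"

lemma act_sub: "act v \<subseteq> {..<k}" unfolding act_def by auto

lemma Xm_A: "x \<in> Xm \<Longrightarrow> fst x \<noteq> 0 \<Longrightarrow> fst x - 1 \<in> set A" unfolding Xm_def by auto

lemma mstep_ok: assumes s: "s \<in> MS" and x: "x \<in> Xm" shows "fst (mstep s x) \<in> MS" "snd (mstep s x) \<in> Yr x"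
proof -
  have z: "zl k {} \<in> set (Sub k)" "zl k (act v) \<in> set (Sub k)" for v using zl[of "{}" k] zl[OF act_sub] by auto
  have so: "sink_out x \<in> Yr x" using z ctrl(2) ctrl(4)[OF ctrl(2) Xm_A[OF x]] unfolding sink_out_def Yr_def by auto
  have lo: "fst (live_out l \<kappa> x) \<in> MS \<and> snd (live_out l \<kappa> x) \<in> Yr x" if "l \<in> L" for l \<kappa>
    using z that tp_TT ctrl(3-5)[OF that Xm_A[OF x]] zl unfolding live_out_def Yr_def MS_def by (auto simp: Let_def)
  show "fst (mstep s x) \<in> MS" "snd (mstep s x) \<in> Yr x"
  proof (atomize(full), cases s)
    case None
    then show "fst (mstep s x) \<in> MS \<and> snd (mstep s x) \<in> Yr x" using so unfolding mstep_def MS_def by simp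
  next
    case (Some p)
    obtain l \<kappa> where p: "p = (l, \<kappa>)" by (cases p)
    then have "l \<in> L" using s Some unfolding MS_def by auto
    have "None \<in> MS" unfolding MS_def by simp
    then show "fst (mstep s x) \<in> MS \<and> snd (mstep s x) \<in> Yr x"
      using so lo[OF \<open>l \<in> L\<close>, of \<kappa>] unfolding mstep_def Some p by (cases "possible \<kappa> x") simp_all
  qed
qed

definition E :: "mach \<times> gstate \<Rightarrow> bool \<Rightarrow> mach \<times> gstate \<Rightarrow> bool" where
  "E v f u \<longleftrightarrow> fst v \<in> MS \<and> (fst u = fst v \<and> \<not> f \<and> ep (snd v) (snd u) \<or>
     (\<exists>x\<in>Xm. fst u = fst (mstep (fst v) x) \<and> f = mk x (snd v) \<and> tr x (snd (mstep (fst v) x)) (snd v) (snd u)))"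

definition gg :: "mach \<Rightarrow> gstate \<Rightarrow> nat" where
  "gg s q = (if q \<in> Qs \<and> \<not> live E (s, q) then Suc (maxmarks E (s, q)) else 0)"

lemma closed_gg: "bg.closed_fam (gg ` MS)"
proof -
  have fin: "finite (MS \<times> Qs)" using ctrl(1) finite_TT finite_Qs unfolding MS_def by simp
  have EV: "\<forall>v f u. E v f u \<longrightarrow> u \<in> MS \<times> Qs"
  proof (intro allI impI)
    fix v f u assume "E v f u"
    then show "u \<in> MS \<times> Qs" unfolding E_def using mstep_ok(1) by (auto simp: mem_Times_iff ep_def tr_def)
  qed
  have "bg.eps_ok (gg s)" if s: "s \<in> MS" for s
    unfolding bg.eps_ok_def
  proof (intro allI impI)
    fix q q' assume a: "0 < gg s q \<and> ep q q'"
    then have nl: "\<not> live E (s, q)" "q \<in> Qs" unfolding gg_def by (auto split: if_splits)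
    have "E (s, q) False (s, q')" using a s unfolding E_def by simp
    from maxmarks_step[OF fin EV nl(1) this] show "0 < gg s q' \<and> gg s q' \<le> gg s q"
      using a nl unfolding gg_def ep_def by auto
  qed
  moreover have "bg.move_ok (gg s) x (snd (mstep s x)) (gg (fst (mstep s x)))" if s: "s \<in> MS" "x \<in> Xm" for s x
    unfolding bg.move_ok_def
  proof (intro allI impI)
    fix q q' assume a: "0 < gg s q \<and> tr x (snd (mstep s x)) q q'"
    then have nl: "\<not> live E (s, q)" "q \<in> Qs" unfolding gg_def by (auto split: if_splits)
    have "E (s, q) (mk x q) (fst (mstep s x), q')" using a s unfolding E_def by auto
    from maxmarks_step[OF fin EV nl(1) this] show "0 < gg (fst (mstep s x)) q' \<and> gg (fst (mstep s x)) q' + of_bool (mk x q) \<le> gg s q"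
      using a nl unfolding gg_def tr_def by auto
  qed
  ultimately show ?thesis unfolding bg.closed_fam_def using mstep_ok by (blast intro: imageI)
qed

text \<open>From its first mark on the run watches one clock j, which is neither reset nor dropped.
  Each further tick raises the integer part of j by one, but an active clock has integer part at
  most m.\<close>

lemma watch_not_live:
  assumes S: "\<And>i. E (S i, Q i) (fs i) (S (Suc i), Q (Suc i))" and inf: "\<exists>\<^sub>\<infinity>i. fs i" and Q0: "0 < tg (Q 0)"
  shows False
proof -
  have nep: "\<not> ep q q'" if "0 < tg q" for q q' using that unfolding ep_def by simp
  have step: "\<exists>x\<in>Xm. S (Suc i) = fst (mstep (S i) x) \<and> fs i = mk x (Q i) \<and> tr_watch (snd (mstep (S i) x)) (Q i) (Q (Suc i)) \<and> Q (Suc i) \<in> Qs"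
    if "0 < tg (Q i)" for i
    using S[of i] that nep unfolding E_def tr_def tr_tick_def tr_letter_def by auto
  have pos: "0 < tg (Q i)" for i
    by (induction i) (use Q0 step in \<open>auto simp: tr_watch_def\<close>)
  obtain x where x: "\<And>i. x i \<in> Xm" "\<And>i. S (Suc i) = fst (mstep (S i) (x i))" "\<And>i. fs i = mk (x i) (Q i)"
    "\<And>i. tr_watch (snd (mstep (S i) (x i))) (Q i) (Q (Suc i))" "\<And>i. Q (Suc i) \<in> Qs" using step[OF pos] by metis
  have Zk: "set (snd (x i)) \<subseteq> {..<k}" for i using x(1)[of i] Sub_D unfolding Xm_def by auto
  obtain i0 where i0: "i0 > 0" "fs i0" using inf unfolding INFM_nat by blast
  define j where "j = tg (Q i0) - 1"
  have jZ: "j \<in> set (snd (x i0))" using i0(2) x(3) pos[of i0] unfolding mk_def j_def by auto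
  then have jk: "j < k" using Zk by blast
  have tgj: "tg (Q i) = Suc j" if "i \<ge> i0" for i
    using that
  proof (induction rule: nat_induct_at_least)
    case base show ?case using pos[of i0] unfolding j_def by simp
  next
    case (Suc i)
    then show ?case using x(4)[of i] jk unfolding tr_watch_def by auto
  qed
  have keep: "j \<in> set (snd (snd (snd (mstep (S i) (x i)))))" "j \<notin> set (fst (snd (snd (mstep (S i) (x i)))))" if "i \<ge> i0" for i
    using x(4)[of i] tgj[OF that] jk unfolding tr_watch_def by auto
  \<comment> \<open>The machine stores only a type; by \<open>tp_floor\<close> all its nonnegative
    valuations agree on the integer part of an active clock.\<close>
  define W where "W i z \<longleftrightarrow> (\<exists>l v. nonneg v \<and> S i = Some (l, tp v) \<and> j \<in> act v \<and> \<lfloor>v j\<rfloor> = z)" for i z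
  have W_bound: "0 \<le> z \<and> z \<le> int m" if "W i z" for i z
    using that unfolding W_def nonneg_def act_def by (auto simp: floor_le_iff)
  have sinkW: "set (snd (snd (sink_out y))) = {}" for y using zl[of "{}" k] unfolding sink_out_def by auto
  have live: "\<exists>l \<kappa>. S i = Some (l, \<kappa>) \<and> possible \<kappa> (x i) \<and> mstep (S i) (x i) = live_out l \<kappa> (x i)" if "i \<ge> i0" for i
  proof (cases "S i")
    case None
    then show ?thesis using keep(1)[OF that] sinkW unfolding mstep_def by simp
  next
    case (Some p)
    obtain l \<kappa> where p: "p = (l, \<kappa>)" by (cases p)
    show ?thesis
    proof (cases "possible \<kappa> (x i)")
      case True then show ?thesis using Some p unfolding mstep_def by simp
    next
      case False
      then have "mstep (S i) (x i) = (None, sink_out (x i))" using Some p unfolding mstep_def by simp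
      then show ?thesis using keep(1)[OF that] sinkW by simp
    qed
  qed
  have W_live: "\<exists>p :: valuation \<times> real. (\<forall>v. nonneg v \<longrightarrow> tp v = \<kappa> \<longrightarrow> j \<in> act v \<longrightarrow> \<lfloor>fst p j\<rfloor> = \<lfloor>v j\<rfloor>) \<and> W (Suc i) (\<lfloor>fst p j\<rfloor> + of_bool (fs i))"
    if i: "i \<ge> i0" and Si: "S i = Some (l, \<kappa>)" for i l \<kappa>
  proof -
    have po: "possible \<kappa> (x i)" and ms: "mstep (S i) (x i) = live_out l \<kappa> (x i)" using live[OF i] Si by auto
    show ?thesis
    proof (cases "fst (x i) = 0")
      case True
      let ?Z = "set (snd (x i))" and ?p = "pickt \<kappa> (set (snd (x i)))"
      have p: "tp (fst ?p) = \<kappa>" "tickc (fst ?p) (snd ?p) ?Z" using po pickt True unfolding possible_def by auto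
      have lo: "S (Suc i) = Some (l, tp (after ?p))" "set (snd (snd (snd (mstep (S i) (x i))))) = act (after ?p)"
        using x(2)[of i] ms True zl[OF act_sub] unfolding live_out_def by (auto simp: Let_def)
      have ja: "j \<in> act (after ?p)" using keep(1)[OF i] lo(2) by simp
      have d: "0 \<le> snd ?p" "nonneg (fst ?p)" using p(2) unfolding tickc_def by auto
      have ja': "j \<in> act (fst ?p)" using ja d unfolding act_def after_def by auto
      have nn: "nonneg (after ?p)" using nonneg_add[OF d(2,1)] unfolding after_def .
      have fsi: "fs i = (j \<in> ?Z)" using x(3)[of i] tgj[OF i] True unfolding mk_def by simp
      have "\<lfloor>after ?p j\<rfloor> = \<lfloor>fst ?p j\<rfloor> + of_bool (fs i)"
      proof (cases "j \<in> ?Z")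
        case jz: True
        then have "after ?p j = of_int \<lfloor>fst ?p j\<rfloor> + 1" using p(2) unfolding tickc_def after_def by auto
        then show ?thesis using jz fsi by simp
      next
        case jz: False
        then have "\<lfloor>after ?p j\<rfloor> = \<lfloor>fst ?p j\<rfloor>" using tickc_open[OF p(2) ja' jz] unfolding after_def by linarith
        then show ?thesis using jz fsi by simp
      qed
      then have Wp: "W (Suc i) (\<lfloor>fst ?p j\<rfloor> + of_bool (fs i))" unfolding W_def using nn lo(1) ja by blast
      have fe: "\<lfloor>fst ?p j\<rfloor> = \<lfloor>v j\<rfloor>" if "nonneg v" "tp v = \<kappa>" "j \<in> act v" for v
        using tp_floor[of v "fst ?p" j] that p(1) by simp
      show ?thesis by (rule exI[of _ ?p]) (use fe Wp in simp)
    next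
      case False
      let ?Z = "set (snd (x i))" and ?p = "pickl \<kappa> (set (snd (x i)))"
      have p: "tp (fst ?p) = \<kappa>" "letc (fst ?p) (snd ?p) ?Z" using po pickl False unfolding possible_def by auto
      define Y where "Y = snd (snd (\<delta> l (fst (x i) - 1) (after ?p)))"
      have "l \<in> L" using S[of i] Si unfolding E_def MS_def by auto
      then have Yk: "Y \<subseteq> {..<k}" unfolding Y_def using ctrl(5) Xm_A[OF x(1) False] by blast
      have lo: "\<exists>l'. S (Suc i) = Some (l', tp (rst Y (after ?p)))" "set (snd (snd (snd (mstep (S i) (x i))))) = act (rst Y (after ?p))"
        "set (fst (snd (snd (mstep (S i) (x i))))) = Y"
        using x(2)[of i] ms False zl[OF act_sub] zl[OF Yk] unfolding live_out_def Y_def by (auto simp: Let_def)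
      have ja: "j \<in> act (rst Y (after ?p))" "j \<notin> Y" using keep[OF i] lo by auto
      have d: "0 \<le> snd ?p" "nonneg (fst ?p)" using p(2) unfolding letc_def by auto
      have ja': "j \<in> act (fst ?p)" using ja d unfolding act_def after_def rst_def by auto
      have nn: "nonneg (rst Y (after ?p))" using nonneg_rst[OF nonneg_add[OF d(2,1)]] unfolding after_def .
      have fsi: "\<not> fs i" using x(3)[of i] tgj[OF i] False unfolding mk_def by simp
      have "v j + d < of_int \<lfloor>v j\<rfloor> + 1" "of_int \<lfloor>v j\<rfloor> \<le> v j + d" if "v = fst ?p" "d = snd ?p" for v d
        using p(2) ja' d that unfolding letc_def by (blast, linarith)
      then have "\<lfloor>rst Y (after ?p) j\<rfloor> = \<lfloor>fst ?p j\<rfloor>" using ja(2) unfolding after_def rst_def by (simp add: floor_eq_iff)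
      then have Wp: "W (Suc i) (\<lfloor>fst ?p j\<rfloor> + of_bool (fs i))" unfolding W_def using nn lo(1) ja fsi by auto
      have fe: "\<lfloor>fst ?p j\<rfloor> = \<lfloor>v j\<rfloor>" if "nonneg v" "tp v = \<kappa>" "j \<in> act v" for v
        using tp_floor[of v "fst ?p" j] that p(1) by simp
      show ?thesis by (rule exI[of _ ?p]) (use fe Wp in simp)
    qed
  qed
  have W_ex: "\<exists>z. W (Suc i) z" if i: "i \<ge> i0" for i
    using live[OF i] W_live[OF i] by blast
  have W_step: "W (Suc i) (z + of_bool (fs i))" if i: "i \<ge> i0" and w: "W i z" for i z
  proof -
    obtain l v where v: "nonneg v" "S i = Some (l, tp v)" "j \<in> act v" "\<lfloor>v j\<rfloor> = z" using w unfolding W_def by blast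
    from W_live[OF i v(2)] obtain p :: "valuation \<times> real" where
      p: "\<forall>v'. nonneg v' \<longrightarrow> tp v' = tp v \<longrightarrow> j \<in> act v' \<longrightarrow> \<lfloor>fst p j\<rfloor> = \<lfloor>v' j\<rfloor>" "W (Suc i) (\<lfloor>fst p j\<rfloor> + of_bool (fs i))"
      by (elim exE conjE)
    from p(1)[rule_format, OF v(1) refl v(3)] p(2)
    show ?thesis using v(4) by simp
  qed
  obtain z0 where z0: "W (Suc i0) z0" using W_ex[of i0] by blast
  define zz where "zz n = z0 + int (card {i \<in> {Suc i0..<Suc i0 + n}. fs i})" for n
  have "W (Suc i0 + n) (zz n)" for n
  proof (induction n)
    case 0 then show ?case using z0 unfolding zz_def by simp
  next
    case (Suc n)
    have "{i \<in> {Suc i0..<Suc i0 + Suc n}. fs i} = {i \<in> {Suc i0..<Suc i0 + n}. fs i} \<union> (if fs (Suc i0 + n) then {Suc i0 + n} else {})"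
      by (auto simp: less_Suc_eq)
    then have "zz (Suc n) = zz n + of_bool (fs (Suc i0 + n))" unfolding zz_def by (auto simp: card_insert_if)
    then show ?case using W_step[OF _ Suc] by simp
  qed
  then have bound: "card {i \<in> {Suc i0..<Suc i0 + n}. fs i} \<le> m" for n
    using W_bound[of "Suc i0 + n" "zz n"] W_bound[OF z0] unfolding zz_def by fastforce
  define SS where "SS = {i. fs i \<and> Suc i0 \<le> i}"
  have "infinite SS"
  proof
    assume "finite SS"
    then obtain b where b: "\<forall>i\<in>SS. i \<le> b" using finite_nat_set_iff_bounded_le by blast
    obtain i where "i > max b (Suc i0)" "fs i" using inf unfolding INFM_nat by blast
    then show False using b unfolding SS_def by fastforce
  qed
  then obtain F where F: "finite F" "card F = Suc m" "F \<subseteq> SS" using infinite_arbitrarily_large by blast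
  have sub: "F \<subseteq> {i \<in> {Suc i0..<Suc i0 + Suc (Max F)}. fs i}"
  proof
    fix i assume i: "i \<in> F"
    then have "i \<le> Max F" "fs i" "Suc i0 \<le> i" using Max_ge[OF F(1)] F(3) unfolding SS_def by auto
    then show "i \<in> {i \<in> {Suc i0..<Suc i0 + Suc (Max F)}. fs i}" by simp
  qed
  have "finite {i \<in> {Suc i0..<Suc i0 + Suc (Max F)}. fs i}" by simp
  from card_mono[OF this sub] have "Suc m \<le> card {i \<in> {Suc i0..<Suc i0 + Suc (Max F)}. fs i}" unfolding F(2) .
  then show False using bound[of "Suc (Max F)"] by simp
qed

end

text \<open>Inverts counting: \<open>sel n\<close> is the position at which P holds after exactly n
  earlier occurrences. It enumerates the letters and the automaton steps of a symbolic run.\<close>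

lemma select_infinitely_often:
  assumes "\<exists>\<^sub>\<infinity>i. P i"
  defines "cnt \<equiv> \<lambda>i. card {j. j < i \<and> P j}"
  shows "\<exists>sel. (\<forall>n. P (sel n) \<and> cnt (sel n) = n) \<and> (\<forall>i. P i \<longrightarrow> sel (cnt i) = i) \<and> strict_mono sel"
    and "cnt 0 = 0" "cnt (Suc i) = cnt i + of_bool (P i)"
proof -
  show c0: "cnt 0 = 0" unfolding cnt_def by simp
  show cS: "cnt (Suc i) = cnt i + of_bool (P i)" for i
  proof -
    have "{j. j < Suc i \<and> P j} = {j. j < i \<and> P j} \<union> (if P i then {i} else {})" by (auto simp: less_Suc_eq)
    then show ?thesis unfolding cnt_def by auto
  qed
  have mono: "cnt i \<le> cnt j" if "i \<le> j" for i j using that by (rule lift_Suc_mono_le[rotated]) (simp add: cS)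
  have strict: "cnt i < cnt j" if "P i" "i < j" for i j using mono[of "Suc i" j] that by (simp add: cS)
  have unb: "\<exists>i. n \<le> cnt i" for n
  proof (induction n)
    case (Suc n)
    then obtain i where i: "n \<le> cnt i" by blast
    obtain j where j: "j > i" "P j" using assms(1) unfolding INFM_nat by blast
    have "n < cnt (Suc j)" using i mono[of i j] j by (simp add: cS)
    then show ?case using Suc_leI by blast
  qed simp
  have "\<exists>i. P i \<and> cnt i = n" for n
  proof -
    define i where "i = (LEAST i. n < cnt i)"
    obtain u where u: "n < cnt u" using unb[of "Suc n"] Suc_le_lessD by blast
    then have ni: "n < cnt i" unfolding i_def by (rule LeastI)
    then obtain i' where i': "i = Suc i'" using c0 by (cases i) auto
    then have "\<not> n < cnt i'" using not_less_Least[of i' "\<lambda>i. n < cnt i"] unfolding i_def by simp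
    then have "P i'" "cnt i' = n" using ni unfolding i' cS by (auto split: if_splits simp: of_bool_def)
    then show ?thesis by blast
  qed
  then obtain sel where sel: "\<And>n. P (sel n) \<and> cnt (sel n) = n" by metis
  have "sel (cnt i) = i" if i: "P i" for i
  proof -
    have "P (sel (cnt i))" "cnt (sel (cnt i)) = cnt i" using sel[of "cnt i"] by auto
    then show ?thesis using strict[of i "sel (cnt i)"] strict[of "sel (cnt i)" i] i by (metis less_irrefl linorder_neqE_nat)
  qed
  moreover have "sel a < sel b" if "a < b" for a b
  proof (rule ccontr)
    assume "\<not> ?thesis"
    then have "cnt (sel b) \<le> cnt (sel a)" by (intro mono) simp
    then show False using sel[of a] sel[of b] that by simp
  qed
  ultimately show "\<exists>sel. (\<forall>n. P (sel n) \<and> cnt (sel n) = n) \<and> (\<forall>i. P i \<longrightarrow> sel (cnt i) = i) \<and> strict_mono sel"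
    using sel by (intro exI[of _ sel]) (simp add: strict_mono_def)
qed

section \<open>Concretising symbolic runs\<close>

context winning_ctrl
begin

text \<open>A live path from an initial automaton state can be made real: real delays are chosen
  step by step, its letters form a play of Player I, and the machine answers as the controller does.
  Infinitely many marks make the resulting run accepting, contradicting that the controller
  wins.\<close>

lemma run_not_live:
  assumes S: "\<And>i. E (S i, Q i) (fs i) (S (Suc i), Q (Suc i))" and inf: "\<exists>\<^sub>\<infinity>i. fs i"
    and S0: "S 0 = Some (l0, tp (\<lambda>_. 0))" and Q0: "Q 0 \<in> Init" "tg (Q 0) = 0"
  shows False
proof -
  have "tg (Q (Suc i)) = 0" if "tg (Q i) = 0" for i
    using S[of i] that unfolding E_def ep_def tr_def tr_tick_def tr_letter_def tr_watch_def by auto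
  then have tg0: "tg (Q i) = 0" for i by (induction i) (use Q0 in auto)
  have Q: "Q i \<in> Qs" for i using S[of i] unfolding E_def ep_def tr_def by auto
  have ack: "set (ac (Q i)) \<subseteq> {..<k}" for i using Qs_T[OF Q tg0] by blast
  \<comment> \<open>One format for three kinds of steps: \<open>None\<close> is an epsilon step, a
    move with first component 0 a tick, any other move a letter. P and R are the test and the reset
    of the symbolic step.\<close>
  define info where "info i xo P R r \<longleftrightarrow> inv_pred P \<and> stp P R (vl (Q i)) (vl (Q (Suc i))) \<and>
    (case xo of None \<Rightarrow> S (Suc i) = S i \<and> \<not> fs i \<and> ac (Q (Suc i)) = ac (Q i) \<and> r \<in> set (rules T) \<and> r_lab r = None \<and> r_src r = lc (Q i) \<and> r_tgt r = lc (Q (Suc i)) \<and>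
        bt (Q (Suc i)) = (if bt (Q i) = 1 \<or> lc (Q (Suc i)) \<in> set (finals T) then 1 else 0) \<and> P = gP r \<and> R = rR r
     | Some x \<Rightarrow> x \<in> Xm \<and> S (Suc i) = fst (mstep (S i) x) \<and> fs i = mk x (Q i) \<and>
        (if fst x = 0 then lc (Q (Suc i)) = lc (Q i) \<and> bt (Q (Suc i)) = bt (Q i) \<and> set (snd x) \<noteq> {} \<and>
            set (ac (Q (Suc i))) = set (ac (Q i)) \<inter> set (snd (snd (snd (mstep (S i) x)))) \<and> P = tP (set (ac (Q i))) (set (snd x)) \<and> R = set (snd x)
         else set (ac (Q (Suc i))) = set (snd (snd (snd (mstep (S i) x)))) \<inter> (set (ac (Q i)) \<union> set (fst (snd (snd (mstep (S i) x))))) \<and>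
            r \<in> set (rules T) \<and> r_lab r = Some (fst x - 1, fst (snd (mstep (S i) x))) \<and> r_src r = lc (Q i) \<and> r_tgt r = lc (Q (Suc i)) \<and>
            bt (Q (Suc i)) = (if lc (Q (Suc i)) \<in> set (finals T) then 1 else 0) \<and>
            P = (\<lambda>w. gP r w \<and> lP (set (ac (Q i))) (set (snd x)) w) \<and> R = set (fst (snd (snd (mstep (S i) x)))) \<union> rR r))" for i xo P R r
  have "\<exists>xo P R r. info i xo P R r" for i
  proof -
    from S[of i] consider "S (Suc i) = S i" "\<not> fs i" "ep (Q i) (Q (Suc i))"
      | x where "x \<in> Xm" "S (Suc i) = fst (mstep (S i) x)" "fs i = mk x (Q i)" "tr x (snd (mstep (S i) x)) (Q i) (Q (Suc i))"
      unfolding E_def by auto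
    then show ?thesis
    proof cases
      case 1
      then obtain r where "r \<in> set (rules T)" "r_lab r = None" "r_src r = lc (Q i)" "r_tgt r = lc (Q (Suc i))"
        "bt (Q (Suc i)) = (if bt (Q i) = 1 \<or> lc (Q (Suc i)) \<in> set (finals T) then 1 else 0)" "stp (gP r) (rR r) (vl (Q i)) (vl (Q (Suc i)))"
        "ac (Q (Suc i)) = ac (Q i)"
        unfolding ep_def by blast
      then have "info i None (gP r) (rR r) r" using 1 inv_gP unfolding info_def by simp
      then show ?thesis by blast
    next
      case (2 x)
      show ?thesis
      proof (cases "fst x = 0")
        case True
        then have "tr_tick (snd x) (snd (snd (snd (mstep (S i) x)))) (Q i) (Q (Suc i))"
          using 2(4) tg0 unfolding tr_def tr_watch_def by auto
        then have "info i (Some x) (tP (set (ac (Q i))) (set (snd x))) (set (snd x)) undefined"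
          using 2 True inv_tP[OF ack] unfolding info_def tr_tick_def by simp
        then show ?thesis by blast
      next
        case False
        then have "tr_letter (fst x - 1) (snd x) (snd (mstep (S i) x)) (Q i) (Q (Suc i))"
          using 2(4) tg0 unfolding tr_def tr_watch_def by auto
        then obtain r where "r \<in> set (rules T)" "r_lab r = Some (fst x - 1, fst (snd (mstep (S i) x)))" "r_src r = lc (Q i)" "r_tgt r = lc (Q (Suc i))"
          "bt (Q (Suc i)) = (if lc (Q (Suc i)) \<in> set (finals T) then 1 else 0)"
          "stp (\<lambda>w. gP r w \<and> lP (set (ac (Q i))) (set (snd x)) w) (set (fst (snd (snd (mstep (S i) x)))) \<union> rR r) (vl (Q i)) (vl (Q (Suc i)))"
          "set (ac (Q (Suc i))) = set (snd (snd (snd (mstep (S i) x)))) \<inter> (set (ac (Q i)) \<union> set (fst (snd (snd (mstep (S i) x)))))"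
          unfolding tr_letter_def by blast
        then have "info i (Some x) (\<lambda>w. gP r w \<and> lP (set (ac (Q i))) (set (snd x)) w) (set (fst (snd (snd (mstep (S i) x)))) \<union> rR r) r"
          using 2 False inv_conj[OF inv_gP inv_lP[OF ack]] unfolding info_def by simp
        then show ?thesis by blast
      qed
    qed
  qed
  then obtain x P R r where info: "\<And>i. info i (x i) (P i) (R i) (r i)" by metis
  \<comment> \<open>\<open>stp_conc\<close> is iterated, so controller and automaton coordinates
    share the same real delays.\<close>
  have "\<exists>w. w 0 = (\<lambda>_. 0) \<and> (\<forall>i. (nonneg (w i) \<and> req K c (w i) (rv D (vl (Q i)))) \<and> (\<exists>d\<ge>0. P i (\<lambda>y. w i y + d) \<and> w (Suc i) = rst (R i) (\<lambda>y. w i y + d)))"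
  proof -
    have "\<exists>w. \<forall>i. (nonneg (w i) \<and> req K c (w i) (rv D (vl (Q i))) \<and> (i = 0 \<longrightarrow> w i = (\<lambda>_. 0))) \<and>
        (\<exists>d\<ge>0. P i (\<lambda>y. w i y + d) \<and> w (Suc i) = rst (R i) (\<lambda>y. w i y + d))"
    proof (rule dependent_nat_choice)
      have "vl (Q 0) = replicate K 0" using Q0 unfolding Init_def by blast
      then have "req K c (\<lambda>_. 0) (rv D (vl (Q 0)))" unfolding req_def rv_def by simp
      then show "\<exists>w. nonneg w \<and> req K c w (rv D (vl (Q 0))) \<and> (0 = (0::nat) \<longrightarrow> w = (\<lambda>_. 0))"
        by (intro exI[of _ "\<lambda>_. 0"]) (simp add: nonneg_def)
    next
      fix w i assume w: "nonneg w \<and> req K c w (rv D (vl (Q i))) \<and> (i = 0 \<longrightarrow> w = (\<lambda>_. 0))"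
      have "stp (P i) (R i) (vl (Q i)) (vl (Q (Suc i)))" "inv_pred (P i)" using info[of i] unfolding info_def by auto
      from stp_conc[OF this] w obtain d where "0 \<le> d" "P i (\<lambda>y. w y + d)" "req K c (rst (R i) (\<lambda>y. w y + d)) (rv D (vl (Q (Suc i))))" by blast
      then show "\<exists>w'. (nonneg w' \<and> req K c w' (rv D (vl (Q (Suc i)))) \<and> (Suc i = 0 \<longrightarrow> w' = (\<lambda>_. 0))) \<and>
          (\<exists>d\<ge>0. P i (\<lambda>y. w y + d) \<and> w' = rst (R i) (\<lambda>y. w y + d))"
        using w nonneg_rst[OF nonneg_add] by (intro exI[of _ "rst (R i) (\<lambda>y. w y + d)"]) auto
    qed
    then show ?thesis by blast
  qed
  then obtain w where w0: "w 0 = (\<lambda>_. 0)" and wn: "\<And>i. nonneg (w i)" and "\<And>i. \<exists>d\<ge>0. P i (\<lambda>y. w i y + d) \<and> w (Suc i) = rst (R i) (\<lambda>y. w i y + d)"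
    by blast
  then obtain d where d: "\<And>i. 0 \<le> d i" "\<And>i. P i (\<lambda>y. w i y + d i)" "\<And>i. w (Suc i) = rst (R i) (\<lambda>y. w i y + d i)" by metis
  define tm where "tm i = (\<Sum>j<i. d j)" for i
  have tm: "tm 0 = 0" "tm (Suc i) = tm i + d i" for i unfolding tm_def by auto
  have tm_mono: "tm i \<le> tm j" if "i \<le> j" for i j using that by (rule lift_Suc_mono_le[rotated]) (simp add: tm d(1))

  define isT where "isT i \<longleftrightarrow> (case x i of None \<Rightarrow> True | Some y \<Rightarrow> fst y \<noteq> 0)" for i
  define isL where "isL i \<longleftrightarrow> (case x i of None \<Rightarrow> False | Some y \<Rightarrow> fst y \<noteq> 0)" for i
  have LT: "isL i \<Longrightarrow> isT i" for i unfolding isL_def isT_def by (auto split: option.splits)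
  have fsL: "isL i \<and> bt (Q i) = 1" if "fs i" for i
    using info[of i] that tg0 unfolding info_def isL_def mk_def by (auto split: option.splits)
  have infL: "\<exists>\<^sub>\<infinity>i. isL i" using INFM_mono[OF inf, of isL] fsL by blast
  have infT: "\<exists>\<^sub>\<infinity>i. isT i" using INFM_mono[OF infL, of isT] LT by blast
  define lcnt where "lcnt i = card {j. j < i \<and> isL j}" for i
  define tcnt where "tcnt i = card {j. j < i \<and> isT j}" for i
  obtain sl where sl: "\<And>n. isL (sl n)" "\<And>n. lcnt (sl n) = n" "\<And>i. isL i \<Longrightarrow> sl (lcnt i) = i" "strict_mono sl"
    using select_infinitely_often(1)[OF infL] unfolding lcnt_def by blast
  obtain sT where sT: "\<And>n. isT (sT n)" "\<And>n. tcnt (sT n) = n" "\<And>i. isT i \<Longrightarrow> sT (tcnt i) = i" "strict_mono sT"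
    using select_infinitely_often(1)[OF infT] unfolding tcnt_def by blast
  have lc0: "lcnt 0 = 0" and lcS: "lcnt (Suc i) = lcnt i + of_bool (isL i)" for i
    unfolding lcnt_def using select_infinitely_often(2,3)[OF infL] by auto
  have tc0: "tcnt 0 = 0" and tcS: "tcnt (Suc i) = tcnt i + of_bool (isT i)" for i
    unfolding tcnt_def using select_infinitely_often(2,3)[OF infT] by auto
  have tc_mono: "tcnt i \<le> tcnt j" if "i \<le> j" for i j using that by (rule lift_Suc_mono_le[rotated]) (simp add: tcS)

  define a where "a n = fst (the (x (sl n))) - 1" for n
  define t where "t n = tm (Suc (sl n))" for n
  define tpv where "tpv n = (if n = 0 then 0 else t (n - 1))" for n
  define rs where "rs j = r (sT j)" for j
  define ts where "ts j = tm (Suc (sT j))" for j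
  \<comment> \<open>The index of a letter among all automaton steps, ticks being skipped.\<close>
  define e where "e n = tcnt (sl n)" for n
  define cf where "cf n = ctrl_conf \<delta> l0 a t n" for n
  have sl_move: "\<exists>y. x (sl n) = Some y \<and> fst y = Suc (a n) \<and> y \<in> Xm" for n
    using sl(1)[of n] info[of "sl n"] unfolding isL_def a_def info_def by (auto split: option.splits)
  have aA: "a n \<in> set A" for n using sl_move[of n] Xm_A by fastforce

  \<comment> \<open>The components are the controller valuation at the last tick or letter and the
    time elapsed since. Epsilon steps do not move the machine, so they only add to the elapsed
    time.\<close>
  define bs where "bs = rec_nat (\<lambda>_::nat. 0::real, 0::real) (\<lambda>i me. case x i of None \<Rightarrow> (fst me, snd me + d i)
     | Some y \<Rightarrow> (rst (if fst y = 0 then {} else set (fst (snd (snd (mstep (S i) y))))) (\<lambda>z. fst me z + snd me + d i), 0))"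
  define mu where "mu i = fst (bs i)" for i
  define el where "el i = snd (bs i)" for i
  have bs0: "mu 0 = (\<lambda>_. 0)" "el 0 = 0" unfolding mu_def el_def bs_def by auto
  have bsN: "mu (Suc i) = mu i" "el (Suc i) = el i + d i" if "x i = None" for i using that unfolding mu_def el_def bs_def by auto
  have bsS: "mu (Suc i) = rst (if fst y = 0 then {} else set (fst (snd (snd (mstep (S i) y))))) (\<lambda>z. mu i z + el i + d i)" "el (Suc i) = 0"
    if "x i = Some y" for i y using that unfolding mu_def el_def bs_def by auto

  \<comment> \<open>The machine never enters its sink here: its type is that of the true controller
    valuation. An active coordinate of w is a fractional part plus the elapsed time, and
    \<open>mu i\<close> plus \<open>el i\<close> are the true controller clocks at time
    \<open>tm i\<close>.\<close>
  have Inv: "S i = Some (fst (cf (lcnt i)), tp (mu i)) \<and> fst (cf (lcnt i)) \<in> L \<and> nonneg (mu i) \<and> 0 \<le> el i \<and> set (ac (Q i)) = act (mu i) \<and>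
      (\<forall>y\<in>act (mu i). w i y = mu i y - of_int \<lfloor>mu i y\<rfloor> + el i) \<and>
      (\<forall>y. mu i y + el i = snd (cf (lcnt i)) y + (tm i - tpv (lcnt i)))" for i
  proof (induction i)
    case 0
    have "act (\<lambda>_. 0) = {..<k}" unfolding act_def by auto
    then show ?case using S0 Q0 ctrl(2) unfolding bs0 lc0 cf_def tpv_def tm w0 Init_def nonneg_def by auto
  next
    case (Suc i)
    define l where "l = fst (cf (lcnt i))"
    have Si: "S i = Some (l, tp (mu i))" and lL: "l \<in> L" and nn: "nonneg (mu i)" and el0: "0 \<le> el i" and acm: "set (ac (Q i)) = act (mu i)"
      and wmu: "\<And>y. y \<in> act (mu i) \<Longrightarrow> w i y = mu i y - of_int \<lfloor>mu i y\<rfloor> + el i"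
      and mucf: "\<And>y. mu i y + el i = snd (cf (lcnt i)) y + (tm i - tpv (lcnt i))" using Suc unfolding l_def by auto
    show ?case
    proof (cases "x i")
      case None
      have inf: "S (Suc i) = S i" "ac (Q (Suc i)) = ac (Q i)" "r i \<in> set (rules T)" "R i = rR (r i)" using info[of i] None unfolding info_def by auto
      have lcSi: "lcnt (Suc i) = lcnt i" using None unfolding lcS isL_def by simp
      have "w (Suc i) y = mu i y - of_int \<lfloor>mu i y\<rfloor> + (el i + d i)" if y: "y \<in> act (mu i)" for y
      proof -
        have "y \<notin> R i" using y act_sub rule_resets_K[OF inf(3)] unfolding inf(4) by fastforce
        then show ?thesis using wmu[OF y] unfolding d(3) rst_def by simp
      qed
      moreover have "mu i y + (el i + d i) = snd (cf (lcnt i)) y + (tm (Suc i) - tpv (lcnt i))" for y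
        using mucf[of y] unfolding tm by simp
      ultimately show ?thesis unfolding lcSi bsN[OF None] inf(1,2) using Si lL nn el0 d(1)[of i] acm unfolding l_def by auto
    next
      case (Some y)
      define vv where "vv = (\<lambda>z. mu i z + (el i + d i))"
      have dd: "0 \<le> el i + d i" using el0 d(1)[of i] by simp
      have nnv: "nonneg vv" unfolding vv_def using nonneg_add[OF nn dd] .
      have wd: "w i z + d i = vv z - of_int \<lfloor>mu i z\<rfloor>" if "z \<in> act (mu i)" for z using wmu[OF that] unfolding vv_def by simp
      have yX: "y \<in> Xm" and SS: "S (Suc i) = fst (mstep (S i) y)" using info[of i] Some unfolding info_def by auto
      show ?thesis
      proof (cases "fst y = 0")
        case True
        let ?Z = "set (snd y)"
        have inf: "?Z \<noteq> {}" "set (ac (Q (Suc i))) = act (mu i) \<inter> set (snd (snd (snd (mstep (S i) y))))" "P i = tP (act (mu i)) ?Z" "R i = ?Z"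
          using info[of i] Some True acm unfolding info_def by auto
        have lcSi: "lcnt (Suc i) = lcnt i" using Some True unfolding lcS isL_def by simp
        have tp': "tP (act (mu i)) ?Z (\<lambda>z. w i z + d i)" using d(2)[of i] unfolding inf(3) .
        have tc: "tickc (mu i) (el i + d i) ?Z" unfolding tickc_def
        proof (intro conjI ballI)
          show "mu i z + (el i + d i) \<le> of_int \<lfloor>mu i z\<rfloor> + 1" if z: "z \<in> act (mu i)" for z
          proof -
            have "w i z + d i \<le> 1" using tp' z unfolding tP_def by blast
            then show ?thesis using wd[OF z] unfolding vv_def by simp
          qed
          have "?Z = {z \<in> act (mu i). w i z + d i = 1}" using tp' unfolding tP_def by blast
          also have "\<dots> = {z \<in> act (mu i). mu i z + (el i + d i) = of_int \<lfloor>mu i z\<rfloor> + 1}" using wd unfolding vv_def by auto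
          finally show "?Z = {z \<in> act (mu i). mu i z + (el i + d i) = of_int \<lfloor>mu i z\<rfloor> + 1}" .
        qed (use nn dd inf(1) in auto)
        let ?p = "pickt (tp (mu i)) ?Z"
        have p: "tp (fst ?p) = tp (mu i)" "tickc (fst ?p) (snd ?p) ?Z" using pickt[OF tc] by auto
        have tpa: "tp (after ?p) = tp vv" using tick_det[OF p(1,2) tc] unfolding after_def vv_def .
        have ms: "mstep (S i) y = live_out l (tp (mu i)) y" using tc True Si unfolding mstep_def possible_def by auto
        have S': "S (Suc i) = Some (l, tp vv)" and P': "set (snd (snd (snd (mstep (S i) y)))) = act vv"
          using SS ms True tpa zl[OF act_sub] tp_act[OF tpa] unfolding live_out_def by (auto simp: Let_def)
        have mu': "mu (Suc i) = vv" "el (Suc i) = 0" using bsS[OF Some] True unfolding vv_def rst_def by (auto simp: add.assoc)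
        have actsub: "act vv \<subseteq> act (mu i)" unfolding act_def vv_def using dd by auto
        have ac': "set (ac (Q (Suc i))) = act vv" unfolding inf(2) P' using actsub by blast
        have w': "w (Suc i) z = vv z - of_int \<lfloor>vv z\<rfloor>" if z: "z \<in> act vv" for z
        proof -
          have za: "z \<in> act (mu i)" using z actsub by blast
          show ?thesis
          proof (cases "z \<in> ?Z")
            case zZ: True
            then have "vv z = of_int \<lfloor>mu i z\<rfloor> + 1" using tc unfolding tickc_def vv_def by blast
            then show ?thesis using zZ unfolding d(3) inf(4) rst_def by simp
          next
            case zZ: False
            have "\<lfloor>vv z\<rfloor> = \<lfloor>mu i z\<rfloor>" using tickc_open[OF tc za zZ] unfolding vv_def by linarith
            then show ?thesis using zZ wd[OF za] unfolding d(3) inf(4) rst_def by simp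
          qed
        qed
        show ?thesis unfolding lcSi mu' l_def[symmetric]
        proof (intro conjI ballI allI)
          show "w (Suc i) z = vv z - of_int \<lfloor>vv z\<rfloor> + 0" if "z \<in> act vv" for z using w'[OF that] by simp
          show "vv z + 0 = snd (cf (lcnt i)) z + (tm (Suc i) - tpv (lcnt i))" for z
            using mucf[of z] unfolding tm vv_def by simp
        qed (use S' lL nnv ac' in auto)
      next
        case False
        let ?Z = "set (snd y)" and ?P = "set (snd (snd (snd (mstep (S i) y))))" and ?Y = "set (fst (snd (snd (mstep (S i) y))))"
        have inf: "set (ac (Q (Suc i))) = ?P \<inter> (act (mu i) \<union> ?Y)" "P i = (\<lambda>w. gP (r i) w \<and> lP (act (mu i)) ?Z w)" "R i = ?Y \<union> rR (r i)" "r i \<in> set (rules T)"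
          using info[of i] Some False acm unfolding info_def by auto
        have L: "isL i" using Some False unfolding isL_def by simp
        have lcSi: "lcnt (Suc i) = Suc (lcnt i)" using L unfolding lcS by simp
        have sli: "sl (lcnt i) = i" using sl(3)[OF L] .
        have lp: "lP (act (mu i)) ?Z (\<lambda>z. w i z + d i)" using d(2)[of i] unfolding inf(2) by blast
        have tc: "letc (mu i) (el i + d i) ?Z" unfolding letc_def
        proof (intro conjI ballI)
          show "mu i z + (el i + d i) < of_int \<lfloor>mu i z\<rfloor> + 1" if z: "z \<in> act (mu i)" for z
          proof -
            have "w i z + d i < 1" using lp z unfolding lP_def by blast
            then show ?thesis using wd[OF z] unfolding vv_def by simp
          qed
          have "?Z = {z \<in> act (mu i). w i z + d i = 0}" using lp unfolding lP_def by blast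
          also have "\<dots> = {z \<in> act (mu i). mu i z + (el i + d i) = of_int \<lfloor>mu i z\<rfloor>}" using wd unfolding vv_def by auto
          finally show "?Z = {z \<in> act (mu i). mu i z + (el i + d i) = of_int \<lfloor>mu i z\<rfloor>}" .
        qed (use nn dd in auto)
        let ?p = "pickl (tp (mu i)) ?Z"
        have p: "tp (fst ?p) = tp (mu i)" "letc (fst ?p) (snd ?p) ?Z" using pickl[OF tc] by auto
        have tpa: "tp (after ?p) = tp vv" using let_det[OF p(1,2) tc] unfolding after_def vv_def .
        have nna: "nonneg (after ?p)" using p(2) nonneg_add unfolding letc_def after_def by blast
        have aA': "fst y - 1 \<in> set A" using Xm_A[OF yX False] .
        have deq: "\<delta> l (fst y - 1) (after ?p) = \<delta> l (fst y - 1) vv" using ctrl(6)[OF lL aA' tp_region[OF tpa nna nnv]] .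
        define rr where "rr = \<delta> l (fst y - 1) vv"
        have Yk: "snd (snd rr) \<subseteq> {..<k}" unfolding rr_def using ctrl(5)[OF lL aA'] .
        have tpr: "tp (rst (snd (snd rr)) (after ?p)) = tp (rst (snd (snd rr)) vv)" using tp_rst[OF tpa nna nnv] .
        have ms: "mstep (S i) y = live_out l (tp (mu i)) y" using tc False Si unfolding mstep_def possible_def by auto
        have mo: "mstep (S i) y = (Some (fst rr, tp (rst (snd (snd rr)) vv)), (fst (snd rr), zl k (snd (snd rr)), zl k (act (rst (snd (snd rr)) vv))))"
          unfolding ms live_out_def using False deq tpr tp_act[OF tpr] by (simp add: Let_def rr_def)
        have Yeq: "?Y = snd (snd rr)" and Peq: "?P = act (rst (snd (snd rr)) vv)" unfolding mo using zl[OF Yk] zl[OF act_sub] by auto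
        have S': "S (Suc i) = Some (fst rr, tp (rst (snd (snd rr)) vv))" unfolding SS mo by simp
        have mu': "mu (Suc i) = rst (snd (snd rr)) vv" "el (Suc i) = 0" using bsS[OF Some] False Yeq unfolding vv_def by (auto simp: add.assoc)
        have actsub: "act (rst (snd (snd rr)) vv) \<subseteq> act (mu i) \<union> snd (snd rr)" unfolding act_def vv_def rst_def using dd by (auto split: if_splits)
        have ac': "set (ac (Q (Suc i))) = act (rst (snd (snd rr)) vv)" unfolding inf(1) Peq Yeq using actsub by blast
        have w': "w (Suc i) z = rst (snd (snd rr)) vv z - of_int \<lfloor>rst (snd (snd rr)) vv z\<rfloor>" if z: "z \<in> act (rst (snd (snd rr)) vv)" for z
        proof (cases "z \<in> snd (snd rr)")
          case True then show ?thesis unfolding d(3) inf(3) Yeq rst_def by simp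
        next
          case zY: False
          then have za: "z \<in> act (mu i)" using z actsub by blast
          have zr: "z \<notin> rR (r i)" using za act_sub rule_resets_K[OF inf(4)] by fastforce
          have "mu i z + (el i + d i) < of_int \<lfloor>mu i z\<rfloor> + 1" using tc za unfolding letc_def by blast
          then have "\<lfloor>vv z\<rfloor> = \<lfloor>mu i z\<rfloor>" using dd unfolding vv_def by linarith
          then show ?thesis using zY zr wd[OF za] unfolding d(3) inf(3) Yeq rst_def by simp
        qed
        have tn: "t (lcnt i) = tm (Suc i)" unfolding t_def sli ..
        have an: "a (lcnt i) = fst y - 1" unfolding a_def sli Some by simp
        have vvcf: "vv = (\<lambda>z. snd (cf (lcnt i)) z + (t (lcnt i) - (if lcnt i = 0 then 0 else t (lcnt i - 1))))"
        proof
          fix z show "vv z = snd (cf (lcnt i)) z + (t (lcnt i) - (if lcnt i = 0 then 0 else t (lcnt i - 1)))"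
            using mucf[of z] unfolding vv_def tn tm tpv_def by simp
        qed
        have "cf (Suc (lcnt i)) = (fst (\<delta> (fst (cf (lcnt i))) (a (lcnt i)) vv),
            \<lambda>z. if z \<in> snd (snd (\<delta> (fst (cf (lcnt i))) (a (lcnt i)) vv)) then 0 else vv z)"
          unfolding vvcf cf_def ctrl_conf.simps(2) Let_def split_beta by simp
        then have cf': "cf (Suc (lcnt i)) = (fst rr, rst (snd (snd rr)) vv)"
          unfolding an l_def[symmetric] rr_def[symmetric] rst_def .
        have "tm (Suc i) - tpv (Suc (lcnt i)) = 0" unfolding tpv_def using tn by simp
        moreover have "fst rr \<in> L" unfolding rr_def using ctrl(3)[OF lL aA'] .
        ultimately show ?thesis unfolding lcSi mu' cf' using S' nonneg_rst[OF nnv] ac' w' by simp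
      qed
    qed
  qed

  have letter_info: "r_lab (r (sl n)) = Some (a n, ctrl_answer \<delta> l0 a t n)" for n
  proof -
    let ?i = "sl n"
    obtain y where y: "x ?i = Some y" "fst y = Suc (a n)" "y \<in> Xm" using sl_move by blast
    have lab: "r_lab (r ?i) = Some (fst y - 1, fst (snd (mstep (S ?i) y)))" using info[of ?i] y unfolding info_def by simp
    have I: "S ?i = Some (fst (cf n), tp (mu ?i))" "fst (cf n) \<in> L" "nonneg (mu ?i)" "0 \<le> el ?i" "set (ac (Q ?i)) = act (mu ?i)"
      "\<And>z. z \<in> act (mu ?i) \<Longrightarrow> w ?i z = mu ?i z - of_int \<lfloor>mu ?i z\<rfloor> + el ?i" "\<And>z. mu ?i z + el ?i = snd (cf n) z + (tm ?i - tpv n)"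
      using Inv[of ?i] unfolding sl(2) by auto
    let ?Z = "set (snd y)" and ?vv = "\<lambda>z. mu ?i z + (el ?i + d ?i)"
    have "lP (act (mu ?i)) ?Z (\<lambda>z. w ?i z + d ?i)" using d(2)[of ?i] info[of ?i] y I(5) unfolding info_def by auto
    then have lp: "\<And>z. z \<in> act (mu ?i) \<Longrightarrow> w ?i z + d ?i < 1" "?Z = {z \<in> act (mu ?i). w ?i z + d ?i = 0}" unfolding lP_def by auto
    have dd: "0 \<le> el ?i + d ?i" using I(4) d(1)[of ?i] by simp
    have tc: "letc (mu ?i) (el ?i + d ?i) ?Z" unfolding letc_def
    proof (intro conjI ballI)
      show "mu ?i z + (el ?i + d ?i) < of_int \<lfloor>mu ?i z\<rfloor> + 1" if z: "z \<in> act (mu ?i)" for z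
        using lp(1)[OF z] I(6)[OF z] by simp
      show "?Z = {z \<in> act (mu ?i). mu ?i z + (el ?i + d ?i) = of_int \<lfloor>mu ?i z\<rfloor>}"
        unfolding lp(2) using I(6) by auto
    qed (use I dd in auto)
    let ?p = "pickl (tp (mu ?i)) ?Z"
    have p: "tp (fst ?p) = tp (mu ?i)" "letc (fst ?p) (snd ?p) ?Z" using pickl[OF tc] by auto
    have tpa: "tp (after ?p) = tp ?vv" using let_det[OF p(1,2) tc] unfolding after_def .
    have nna: "nonneg (after ?p)" using p(2) nonneg_add unfolding letc_def after_def by blast
    have nnv: "nonneg ?vv" using nonneg_add[OF I(3) dd] .
    have deq: "\<delta> (fst (cf n)) (a n) (after ?p) = \<delta> (fst (cf n)) (a n) ?vv" using ctrl(6)[OF I(2) aA tp_region[OF tpa nna nnv]] .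
    have "mstep (S ?i) y = live_out (fst (cf n)) (tp (mu ?i)) y" using tc y(2) I(1) unfolding mstep_def possible_def by auto
    then have o: "fst (snd (mstep (S ?i) y)) = fst (snd (\<delta> (fst (cf n)) (a n) ?vv))" unfolding live_out_def using y(2) deq by (simp add: Let_def)
    have "?vv = ctrl_val \<delta> l0 a t n"
    proof
      fix z show "?vv z = ctrl_val \<delta> l0 a t n z"
        using I(7)[of z] unfolding ctrl_val_def cf_def tpv_def t_def tm by simp
    qed
    then show ?thesis using lab o y(2) unfolding ctrl_answer_def cf_def by simp
  qed

  have rT: "r i \<in> set (rules T)" "r_src (r i) = lc (Q i)" "r_tgt (r i) = lc (Q (Suc i))" "gP (r i) (\<lambda>y. w i y + d i)" "isL i \<longleftrightarrow> r_lab (r i) \<noteq> None" if "isT i" for i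
    using info[of i] d(2)[of i] that unfolding info_def isT_def isL_def by (auto split: option.splits)
  have locs: "lc (Q i) = (if tcnt i = 0 then lc (Q 0) else r_tgt (rs (tcnt i - 1)))" for i
  proof (induction i)
    case 0 then show ?case by (simp add: tc0)
  next
    case (Suc i)
    show ?case
    proof (cases "isT i")
      case True
      then show ?thesis using rT(3)[OF True] sT(3)[OF True] unfolding tcS rs_def by simp
    next
      case False
      then have "lc (Q (Suc i)) = lc (Q i)" using info[of i] unfolding info_def isT_def by (auto split: option.splits)
      then show ?thesis using Suc False unfolding tcS by simp
    qed
  qed
  have clocks: "w i (k + y) = tm i - last_reset rs ts (tcnt i) y" for i y
  proof (induction i)
    case 0 then show ?case by (simp add: tc0 tm w0)
  next
    case (Suc i)
    show ?case
    proof (cases "isT i")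
      case True
      have "k + y \<in> R i \<longleftrightarrow> y \<in> set (r_resets (r i))"
      proof (cases "x i")
        case None
        then show ?thesis using info[of i] unfolding info_def rR_def by auto
      next
        case (Some m')
        then have f: "fst m' \<noteq> 0" using True unfolding isT_def by simp
        have "set (fst (snd (snd (mstep (S i) m')))) \<subseteq> {..<k}"
        proof -
          have "S i \<in> MS" using S[of i] unfolding E_def by simp
          moreover have "m' \<in> Xm" using info[of i] Some unfolding info_def by simp
          ultimately have "snd (mstep (S i) m') \<in> Yr m'" by (rule mstep_ok(2))
          then show ?thesis using f Sub_D unfolding Yr_def by (auto simp: mem_Times_iff)
        qed
        moreover have "R i = set (fst (snd (snd (mstep (S i) m')))) \<union> rR (r i)" using info[of i] Some f unfolding info_def by simp
        ultimately show ?thesis unfolding rR_def by auto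
      qed
      moreover have "rs (tcnt i) = r i" "ts (tcnt i) = tm (Suc i)" using sT(3)[OF True] unfolding rs_def ts_def by auto
      ultimately show ?thesis using Suc True unfolding tcS d(3) rst_def by (simp add: tm)
    next
      case False
      then obtain m' where m': "x i = Some m'" "fst m' = 0" unfolding isT_def by (auto split: option.splits)
      have "m' \<in> Xm" "R i = set (snd m')" using info[of i] m' unfolding info_def by auto
      then have "k + y \<notin> R i" using Sub_D unfolding Xm_def by fastforce
      then show ?thesis using Suc False unfolding tcS d(3) rst_def by (simp add: tm)
    qed
  qed
  have run: "is_run T rs ts" unfolding is_run_def
  proof (intro conjI allI)
    have src: "r_src (rs j) = (if j = 0 then lc (Q 0) else r_tgt (rs (j - 1)))" for j
      using rT(2)[OF sT(1)[of j]] locs[of "sT j"] unfolding rs_def sT(2) by simp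
    show "r_src (rs 0) \<in> set (inits T)" unfolding src using Q0 unfolding Init_def by simp
    show "r_tgt (rs i) = r_src (rs (Suc i))" for i unfolding src[of "Suc i"] by simp
    show "0 \<le> ts 0" unfolding ts_def using tm_mono[of 0 "Suc (sT 0)"] tm by simp
    show "rs i \<in> set (rules T)" for i unfolding rs_def using rT(1)[OF sT(1)] .
    show "ts i \<le> ts (Suc i)" for i unfolding ts_def using sT(4) by (intro tm_mono) (simp add: strict_mono_Suc_iff less_imp_le)
    fix i
    have "gP (rs i) (\<lambda>y. w (sT i) y + d (sT i))" unfolding rs_def using rT(4)[OF sT(1)] .
    moreover have "w (sT i) (k + y) + d (sT i) = run_val rs ts i y" for y
      unfolding clocks sT(2) run_val_def ts_def tm by simp
    ultimately show "sat (r_guard (rs i)) (run_val rs ts i)" unfolding gP_def by simp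
  qed
  \<comment> \<open>If final visits stopped, the next letter would clear the bit for good and no
    later letter could be marked.\<close>
  have acc: "is_accepting T rs" unfolding is_accepting_def
  proof (rule ccontr)
    assume "\<not> (\<exists>\<^sub>\<infinity>i. r_tgt (rs i) \<in> set (finals T))"
    then obtain N where N: "\<And>j. j > N \<Longrightarrow> r_tgt (rs j) \<notin> set (finals T)" unfolding INFM_nat by blast
    have nF: "lc (Q (Suc i)) \<notin> set (finals T)" if "isT i" "i > sT N" for i
    proof -
      have "tcnt (Suc (sT N)) \<le> tcnt i" using that by (intro tc_mono) simp
      then have "N < tcnt i" using sT(1,2)[of N] by (simp add: tcS)
      then show ?thesis using N[of "tcnt i"] rT(3)[OF that(1)] sT(3)[OF that(1)] unfolding rs_def by simp
    qed
    obtain i1 where i1: "i1 > sT N" "isL i1" using infL unfolding INFM_nat by blast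
    have "bt (Q i) = 0" if "i \<ge> Suc i1" for i
      using that
    proof (induction rule: nat_induct_at_least)
      case base
      have "lc (Q (Suc i1)) \<notin> set (finals T)" using nF[OF LT] i1 by blast
      then show ?case using info[of i1] i1(2) unfolding info_def isL_def by (auto split: option.splits)
    next
      case (Suc i)
      have "lc (Q (Suc i)) \<notin> set (finals T)" if "isT i" using nF[OF that] i1(1) Suc.hyps by simp
      then show ?case using info[of i] Suc.IH unfolding info_def isT_def by (auto split: option.splits if_splits)
    qed
    moreover obtain i2 where "i2 > Suc i1" "fs i2" using inf unfolding INFM_nat by blast
    ultimately show False using fsL[of i2] by simp
  qed
  have e_T: "sT (e n) = sl n" for n unfolding e_def using sT(3)[OF LT[OF sl(1)]] .
  have "(\<lambda>n. ((a n, ctrl_answer \<delta> l0 a t n), t n)) \<in> ta_lang T"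
    unfolding ta_lang_def
  proof (intro CollectI exI conjI allI)
    show "is_run T rs ts" "is_accepting T rs" using run acc by auto
    show "strict_mono e"
    proof (rule strict_monoI)
      fix n n' :: nat assume "n < n'"
      then have "sT (e n) < sT (e n')" unfolding e_T using sl(4) by (simp add: strict_mono_less)
      then show "e n < e n'" using sT(4) by (simp add: strict_mono_less)
    qed
    show "range e = {i. r_lab (rs i) \<noteq> None}"
    proof (intro equalityI subsetI)
      fix j assume "j \<in> range e"
      then obtain n where "j = e n" by blast
      then show "j \<in> {i. r_lab (rs i) \<noteq> None}" using letter_info[of n] unfolding rs_def by (simp add: e_T)
    next
      fix j assume "j \<in> {i. r_lab (rs i) \<noteq> None}"
      then have "isL (sT j)" using rT(5)[OF sT(1)] unfolding rs_def by simp
      then have "e (lcnt (sT j)) = j" unfolding e_def using sl(3) sT(2) by simp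
      then show "j \<in> range e" by (metis rangeI)
    qed
    fix n
    show "((a n, ctrl_answer \<delta> l0 a t n), t n) = (the (r_lab (rs (e n))), ts (e n))"
      using letter_info[of n] unfolding rs_def ts_def t_def e_T by simp
  qed
  moreover have "0 \<le> t 0" unfolding t_def using tm_mono[of 0 "Suc (sl 0)"] tm by simp
  moreover have "t n \<le> t (Suc n)" for n unfolding t_def using sl(4) by (intro tm_mono) (simp add: strict_mono_Suc_iff less_imp_le)
  ultimately show False using win aA unfolding winning_controller_def by blast
qed

theorem controller_imp_family: "\<exists>G. bg.closed_fam G \<and> (\<exists>g\<in>G. \<forall>q\<in>Init. 0 < g q)"
proof -
  let ?s = "Some (l0, tp (\<lambda>_. 0))"
  have "?s \<in> MS" unfolding MS_def using ctrl(2) tp_TT by simp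
  moreover have "0 < gg ?s q" if q: "q \<in> Init" for q
  proof -
    have "\<not> live E (?s, q)"
    proof
      assume "live E (?s, q)"
      then obtain s fs where s: "s 0 = (?s, q)" "\<And>i. E (s i) (fs i) (s (Suc i))" "\<exists>\<^sub>\<infinity>i. fs i" unfolding live_def by blast
      then have "E (fst (s i), snd (s i)) (fs i) (fst (s (Suc i)), snd (s (Suc i)))" for i by simp
      then show False
        using run_not_live[of "\<lambda>i. fst (s i)" "\<lambda>i. snd (s i)" fs] watch_not_live[of "\<lambda>i. fst (s i)" "\<lambda>i. snd (s i)" fs] s(1,3) q
        by (cases "tg q = 0") auto
    qed
    then show ?thesis using q unfolding gg_def Init_def by auto
  qed
  ultimately show ?thesis using closed_gg by blast
qed

end

section \<open>The decision procedure\<close>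

text \<open>Used twice: codes of subformulas are smaller, which allows table evaluation, and the
  code of an instance exceeds every number occurring in it, which provides the bound c.\<close>

lemma mem_list_encode: "x \<in> set xs \<Longrightarrow> x < list_encode xs"
proof (induction xs)
  case (Cons y ys)
  have "y < list_encode (y # ys)" "list_encode ys < list_encode (y # ys)"
    using le_prod_encode_1[of y "list_encode ys"] le_prod_encode_2[of "list_encode ys" y] by auto
  then show ?case using Cons by auto
qed simp

subsection \<open>Evaluating guards\<close>

definition cmpn :: "nat \<Rightarrow> nat \<Rightarrow> nat \<Rightarrow> bool" where
  "cmpn c a b \<longleftrightarrow> c = 0 \<and> a < b \<or> c = 1 \<and> a \<le> b \<or> c = 2 \<and> a = b \<or> c = 3 \<and> b \<le> a \<or> c = 4 \<and> b < a"

text \<open>The even codes n are those of the nonnegative integers, see \<^const>\<open>int_encode\<close>.\<close>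
definition cmpz :: "nat \<Rightarrow> nat \<Rightarrow> nat \<Rightarrow> nat \<Rightarrow> nat \<Rightarrow> bool" where
  "cmpz D c a b n \<longleftrightarrow> (\<exists>h<Suc n. n = 2 * h \<and> cmpn c a (b + h * D) \<or> n = Suc (2 * h) \<and> cmpn c (a + Suc h * D) b)"

lemma d_cmpn [comp]: "computable c \<Longrightarrow> computable a \<Longrightarrow> computable b \<Longrightarrow> dec (\<lambda>x. cmpn (c x) (a x) (b x))"
  unfolding cmpn_def by (intro comp)

lemma d_cmpz [comp]:
  assumes "computable D" "computable c" "computable a" "computable b" "computable n"
  shows "dec (\<lambda>x. cmpz (D x) (c x) (a x) (b x) (n x))"
  unfolding cmpz_def by (intro comp assms(5) c_comp[OF assms(1)] c_comp[OF assms(2)] c_comp[OF assms(3)] c_comp[OF assms(4)] c_comp[OF assms(5)])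

lemma cmpz: assumes "0 < D" shows "cmpz D (enc_cmp cm) a b (int_encode z) \<longleftrightarrow> cmp_sem cm (real a / real D - real b / real D) (of_int z)"
proof -
  have D: "0 < real D" using assms by simp
  have s: "cmp_sem cm (real a / real D - real b / real D) (of_int z) \<longleftrightarrow> cmp_sem cm (real a - real b) (of_int z * real D)"
    using D by (cases cm) (auto simp: diff_divide_distrib[symmetric] divide_less_eq less_divide_eq divide_le_eq le_divide_eq divide_eq_eq)
  show ?thesis
  proof (cases "z \<ge> 0")
    case True
    then obtain h where h: "z = int h" using nonneg_int_cases by blast
    have e: "int_encode z = 2 * h" using h by (simp add: int_encode_def sum_encode_def)
    have "(2 * h = 2 * i \<longleftrightarrow> i = h) \<and> 2 * h \<noteq> Suc (2 * i)" for i by presburger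
    then have "cmpz D (enc_cmp cm) a b (int_encode z) \<longleftrightarrow> cmpn (enc_cmp cm) a (b + h * D)"
      unfolding cmpz_def e by auto
    also have "\<dots> \<longleftrightarrow> cmp_sem cm (real a - real b) (of_int z * real D)"
    proof -
      have "of_int z * real D = real (h * D)" using h by simp
      then show ?thesis by (cases cm) (auto simp: cmpn_def enc_cmp_def algebra_simps simp del: of_nat_mult of_nat_add simp flip: of_nat_add)
    qed
    finally show ?thesis using s by simp
  next
    case False
    define h where "h = nat (- z - 1)"
    have h: "z = - int (Suc h)" using False unfolding h_def by simp
    have e: "int_encode z = Suc (2 * h)" using False unfolding h_def by (simp add: int_encode_def sum_encode_def)
    have "(Suc (2 * h) = Suc (2 * i) \<longleftrightarrow> i = h) \<and> Suc (2 * h) \<noteq> 2 * i" for i by presburger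
    then have "cmpz D (enc_cmp cm) a b (int_encode z) \<longleftrightarrow> cmpn (enc_cmp cm) (a + Suc h * D) b"
      unfolding cmpz_def e by auto
    also have "\<dots> \<longleftrightarrow> cmp_sem cm (real a - real b) (of_int z * real D)"
    proof -
      have "of_int z * real D = - real (Suc h * D)" unfolding h by (simp add: algebra_simps)
      then show ?thesis by (cases cm) (auto simp: cmpn_def enc_cmp_def algebra_simps simp del: of_nat_mult of_nat_add mult_Suc simp flip: of_nat_add)
    qed
    finally show ?thesis using s by simp
  qed
qed

text \<open>One step of a course-of-values recursion over codes of constraints: \<open>tb\<close>
  holds the truth values for all smaller codes. The tags are those of \<open>enc_cc\<close>, and an
  atom with one clock is compared with 0.\<close>

definition ev1 :: "nat \<Rightarrow> nat \<Rightarrow> nat list \<Rightarrow> nat \<Rightarrow> nat list \<Rightarrow> nat" where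
  "ev1 k D p n tb = (let l = list_decode n in
     if nthd l 0 = 0 then 1
     else if nthd l 0 = 1 then of_bool (cmpz D (nthd l 2) (nthd p (k + nthd l 1)) 0 (nthd l 3))
     else if nthd l 0 = 2 then of_bool (cmpz D (nthd l 3) (nthd p (k + nthd l 1)) (nthd p (k + nthd l 2)) (nthd l 4))
     else if nthd l 0 = 3 then 1 - nthd tb (nthd l 1)
     else if nthd l 0 = 4 then nthd tb (nthd l 1) * nthd tb (nthd l 2)
     else of_bool (0 < nthd tb (nthd l 1) + nthd tb (nthd l 2)))"

definition tab :: "nat \<Rightarrow> nat \<Rightarrow> nat list \<Rightarrow> nat \<Rightarrow> nat list" where
  "tab k D p n = rec_nat [] (\<lambda>i t. t @ [ev1 k D p i t]) n"

definition gsat :: "nat \<Rightarrow> nat \<Rightarrow> nat list \<Rightarrow> nat \<Rightarrow> bool" where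
  "gsat k D p n \<longleftrightarrow> nthd (tab k D p (Suc n)) n = 1"

lemma c_of_bool [comp]: "dec P \<Longrightarrow> computable (\<lambda>x. of_bool (P x) :: nat)"
  unfolding dec_def .

lemma c_ev1 [comp]:
  assumes "computable D" "computable p" "computable n" "computable tb"
  shows "computable (\<lambda>x. ev1 k (D x) (p x) (n x) (tb x))"
  unfolding ev1_def Let_def by (intro comp assms)

lemma d_gsat [comp]:
  assumes "computable D" "computable p" "computable n"
  shows "dec (\<lambda>x. gsat k (D x) (p x) (n x))"
  unfolding gsat_def tab_def by (intro comp c_rec c_comp[OF assms(1)] c_comp[OF assms(2)] assms(3))

lemma tab_props: "length (tab k D p n) = n" "i < n \<Longrightarrow> nthd (tab k D p n) i = ev1 k D p i (tab k D p i)"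
proof -
  show l: "length (tab k D p n) = n" for n by (induction n) (auto simp: tab_def)
  show "i < n \<Longrightarrow> nthd (tab k D p n) i = ev1 k D p i (tab k D p i)"
  proof (induction n)
    case (Suc n)
    have e: "tab k D p (Suc n) = tab k D p n @ [ev1 k D p n (tab k D p n)]" by (simp add: tab_def)
    show ?case using Suc l[of n] unfolding e by (cases "i = n") (auto simp: nthd_def nth_append)
  qed simp
qed

lemma ev1_enc_cc:
  assumes D: "0 < D"
  shows "ev1 k D p (enc_cc \<phi>) (tab k D p (enc_cc \<phi>)) = of_bool (sat \<phi> (\<lambda>x. real (nthd p (k + x)) / real D))"
proof (induction \<phi>)
  case (CNot \<phi>)
  have "enc_cc \<phi> < enc_cc (CNot \<phi>)" unfolding enc_cc.simps by (rule mem_list_encode, simp)+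
  from tab_props(2)[OF this, of k D p] CNot show ?case
    unfolding ev1_def[of k D p "enc_cc (CNot \<phi>)"] by (simp add: nthd_def Let_def)
next
  case (CAnd \<phi> \<psi>)
  have "enc_cc \<phi> < enc_cc (CAnd \<phi> \<psi>)" "enc_cc \<psi> < enc_cc (CAnd \<phi> \<psi>)" unfolding enc_cc.simps by (rule mem_list_encode, simp)+
  from this[THEN tab_props(2)[of _ _ k D p]] CAnd show ?case
    unfolding ev1_def[of k D p "enc_cc (CAnd \<phi> \<psi>)"] by (simp add: nthd_def Let_def)
next
  case (COr \<phi> \<psi>)
  have "enc_cc \<phi> < enc_cc (COr \<phi> \<psi>)" "enc_cc \<psi> < enc_cc (COr \<phi> \<psi>)" unfolding enc_cc.simps by (rule mem_list_encode, simp)+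
  from this[THEN tab_props(2)[of _ _ k D p]] COr show ?case
    unfolding ev1_def[of k D p "enc_cc (COr \<phi> \<psi>)"] by (simp add: nthd_def Let_def)
next
  case (Atom1 x cm z)
  show ?case using cmpz[OF D, of cm "nthd p (k + x)" 0 z] unfolding ev1_def by (simp add: nthd_def Let_def)
next
  case (Atom2 x y cm z)
  show ?case using cmpz[OF D, of cm "nthd p (k + x)" "nthd p (k + y)" z] unfolding ev1_def by (simp add: nthd_def Let_def)
qed (simp add: ev1_def nthd_def)

lemma gsat: "0 < D \<Longrightarrow> gsat k D p (enc_cc \<phi>) \<longleftrightarrow> sat \<phi> (\<lambda>x. real (nthd p (k + x)) / real D)"
  unfolding gsat_def using tab_props(2)[of "enc_cc \<phi>" "Suc (enc_cc \<phi>)" k D p] ev1_enc_cc[of D k p \<phi>] by simp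

subsection \<open>The game on codes\<close>

definition fA :: "nat \<Rightarrow> nat list" where "fA N = list_decode (nthd (list_decode N) 0)"
definition fB :: "nat \<Rightarrow> nat list" where "fB N = list_decode (nthd (list_decode N) 1)"
definition fT :: "nat \<Rightarrow> nat \<Rightarrow> nat list" where "fT N i = list_decode (nthd (list_decode (nthd (list_decode N) 2)) i)"
definition rl :: "nat \<Rightarrow> nat \<Rightarrow> nat" where "rl r i = nthd (list_decode r) i"
text \<open>The bound c is \<open>Suc N\<close>, where N is the code of the instance: crude, but
  available without inspecting the automaton.\<close>

definition KK :: "nat \<Rightarrow> nat \<Rightarrow> nat" where "KK k N = k + (Suc N)"
definition DD :: "nat \<Rightarrow> nat \<Rightarrow> nat" where "DD k N = 2 * (KK k N + 1)"
definition elp :: "nat \<Rightarrow> nat list \<Rightarrow> nat list" where "elp e p = map (\<lambda>v. v + e) p"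
definition rsl :: "nat \<Rightarrow> nat list \<Rightarrow> nat list \<Rightarrow> nat list" where
  "rsl K R p = map (\<lambda>i. if i \<in> set R then 0 else nthd p i) [0..<K]"
text \<open>Region equivalence of grid points with denominators cleared, so that only natural
  numbers occur.\<close>

definition reqg :: "nat \<Rightarrow> nat \<Rightarrow> nat \<Rightarrow> nat list \<Rightarrow> nat list \<Rightarrow> bool" where
  "reqg K c D p p' \<longleftrightarrow> (\<forall>x<K. \<forall>z<Suc c. (nthd p x < z * D \<longleftrightarrow> nthd p' x < z * D) \<and> (z * D < nthd p x \<longleftrightarrow> z * D < nthd p' x) \<and>
     (\<forall>y<K. (nthd p x < nthd p y + z * D \<longleftrightarrow> nthd p' x < nthd p' y + z * D) \<and> (nthd p y + z * D < nthd p x \<longleftrightarrow> nthd p' y + z * D < nthd p' x)))"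

lemma c_fields [comp]:
  "computable f \<Longrightarrow> computable (\<lambda>x. fA (f x))" "computable f \<Longrightarrow> computable (\<lambda>x. fB (f x))"
  "computable f \<Longrightarrow> computable g \<Longrightarrow> computable (\<lambda>x. fT (f x) (g x))" "computable f \<Longrightarrow> computable g \<Longrightarrow> computable (\<lambda>x. rl (f x) (g x))"
  "computable f \<Longrightarrow> computable (\<lambda>x. KK k (f x))" "computable f \<Longrightarrow> computable (\<lambda>x. DD k (f x))"
  unfolding fA_def fB_def fT_def rl_def KK_def DD_def by (intro comp; assumption)+

lemma c_elp [comp]: assumes "computable f" "computable g" shows "computable (\<lambda>x. elp (f x) (g x))"
  unfolding elp_def by (intro comp assms(2) c_comp[OF assms(1)])

lemma c_rsl [comp]: assumes "computable f" "computable g" "computable h" shows "computable (\<lambda>x. rsl (f x) (g x) (h x))"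
  unfolding rsl_def by (intro comp assms(1) c_comp[OF assms(2)] c_comp[OF assms(3)])

lemma d_reqg [comp]:
  assumes "computable f" "computable g" "computable h" "computable i" "computable j"
  shows "dec (\<lambda>x. reqg (f x) (g x) (h x) (i x) (j x))"
  unfolding reqg_def
  by (intro comp c_comp[OF assms(1)] c_comp[OF assms(2)] c_comp[OF assms(3)] c_comp[OF assms(4)] c_comp[OF assms(5)])

text \<open>This and the following predicates repeat the game with bounded quantifiers over codes.
  Membership in \<open>Qs\<close> is left to the enumeration \<open>Qlist\<close>, and equality of
  clock sets is tested clock by clock.\<close>

definition cep :: "nat \<Rightarrow> nat \<Rightarrow> gstate \<Rightarrow> gstate \<Rightarrow> bool" where
  "cep k N q q' \<longleftrightarrow> tg q = 0 \<and> tg q' = 0 \<and> ac q' = ac q \<and>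
     (\<exists>r\<in>set (fT N 4). rl r 1 = 0 \<and> rl r 0 = lc q \<and> rl r 4 = lc q' \<and>
        bt q' = (if bt q = 1 \<or> lc q' \<in> set (fT N 3) then 1 else 0) \<and>
        (\<exists>e<Suc (DD k N * (Suc N + 1)). gsat k (DD k N) (elp e (vl q)) (rl r 2) \<and>
           reqg (KK k N) (Suc N) (DD k N) (vl q') (rsl (KK k N) (map (\<lambda>x. k + x) (list_decode (rl r 3))) (elp e (vl q)))))"

definition ctick :: "nat \<Rightarrow> nat \<Rightarrow> nat list \<Rightarrow> nat list \<Rightarrow> gstate \<Rightarrow> gstate \<Rightarrow> bool" where
  "ctick k N Z P q q' \<longleftrightarrow> tg q = 0 \<and> tg q' = 0 \<and> lc q' = lc q \<and> bt q' = bt q \<and>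
     (\<forall>x<k. x \<in> set (ac q') \<longleftrightarrow> x \<in> set (ac q) \<and> x \<in> set P) \<and> Z \<noteq> [] \<and>
     (\<exists>e<Suc (DD k N * (Suc N + 1)). (\<forall>x<k. (x \<in> set (ac q) \<longrightarrow> nthd (elp e (vl q)) x \<le> DD k N) \<and>
          (x \<in> set Z \<longleftrightarrow> x \<in> set (ac q) \<and> nthd (elp e (vl q)) x = DD k N)) \<and>
        reqg (KK k N) (Suc N) (DD k N) (vl q') (rsl (KK k N) Z (elp e (vl q))))"

definition cletter :: "nat \<Rightarrow> nat \<Rightarrow> nat \<Rightarrow> nat list \<Rightarrow> gresp \<Rightarrow> gstate \<Rightarrow> gstate \<Rightarrow> bool" where
  "cletter k N a Z y q q' \<longleftrightarrow> tg q = 0 \<and> tg q' = 0 \<and>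
     (\<forall>x<k. x \<in> set (ac q') \<longleftrightarrow> x \<in> set (snd (snd y)) \<and> (x \<in> set (ac q) \<or> x \<in> set (fst (snd y)))) \<and>
     (\<exists>r\<in>set (fT N 4). rl r 1 = Suc (en (a, fst y)) \<and> rl r 0 = lc q \<and> rl r 4 = lc q' \<and>
        bt q' = (if lc q' \<in> set (fT N 3) then 1 else 0) \<and>
        (\<exists>e<Suc (DD k N * (Suc N + 1)). gsat k (DD k N) (elp e (vl q)) (rl r 2) \<and>
           (\<forall>x<k. (x \<in> set (ac q) \<longrightarrow> nthd (elp e (vl q)) x < DD k N) \<and>
              (x \<in> set Z \<longleftrightarrow> x \<in> set (ac q) \<and> nthd (elp e (vl q)) x = 0)) \<and>
           reqg (KK k N) (Suc N) (DD k N) (vl q') (rsl (KK k N) (fst (snd y) @ map (\<lambda>x. k + x) (list_decode (rl r 3))) (elp e (vl q)))))"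

definition cwatch :: "nat \<Rightarrow> gresp \<Rightarrow> gstate \<Rightarrow> gstate \<Rightarrow> bool" where
  "cwatch k y q q' \<longleftrightarrow> 0 < tg q \<and> 0 < tg q' \<and>
     (tg q = Suc k \<or> tg q' = tg q \<and> tg q - 1 \<in> set (snd (snd y)) \<and> tg q - 1 \<notin> set (fst (snd y)))"

definition ctr :: "nat \<Rightarrow> nat \<Rightarrow> gmove \<Rightarrow> gresp \<Rightarrow> gstate \<Rightarrow> gstate \<Rightarrow> bool" where
  "ctr k N x y q q' \<longleftrightarrow> fst x = 0 \<and> ctick k N (snd x) (snd (snd y)) q q' \<or> 0 < fst x \<and> cletter k N (fst x - 1) (snd x) y q q' \<or> cwatch k y q q'"

definition cmk :: "gmove \<Rightarrow> gstate \<Rightarrow> bool" where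
  "cmk x q \<longleftrightarrow> tg q = 0 \<and> 0 < fst x \<and> bt q = 1 \<or> 0 < tg q \<and> fst x = 0 \<and> tg q - 1 \<in> set (snd x)"

definition cinit :: "nat \<Rightarrow> nat \<Rightarrow> gstate \<Rightarrow> bool" where
  "cinit k N q \<longleftrightarrow> (tg q = 0 \<longrightarrow> lc q \<in> set (fT N 2) \<and> (\<forall>x<k. x \<in> set (ac q)) \<and> (\<forall>v\<in>set (vl q). v = 0) \<and> bt q = 0)"

text \<open>Since k is fixed, \<open>Sub k\<close> is a constant list and needs no computability
  rule of its own.\<close>

definition Qlist :: "nat \<Rightarrow> nat \<Rightarrow> gstate list" where
  "Qlist k N = concat (map (\<lambda>l. concat (map (\<lambda>a. concat (map (\<lambda>p. map (\<lambda>b. (0, l, a, p, b)) [0, 1])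
        (List.n_lists (KK k N) [0..<Suc (KK k N * ((Suc N + 1) * DD k N))]))) (Sub k))) [0..<Suc N])
     @ map (\<lambda>j. (Suc j, 0, [], [], 0)) [0..<Suc k]"

definition Xlist :: "nat \<Rightarrow> nat \<Rightarrow> gmove list" where
  "Xlist k N = concat (map (\<lambda>a. map (\<lambda>Z. (a, Z)) (Sub k)) (0 # map Suc (fA N)))"

definition Ylist :: "nat \<Rightarrow> nat \<Rightarrow> gmove \<Rightarrow> gresp list" where
  "Ylist k N x = (if fst x = 0 then map (\<lambda>P. (0, [], P)) (Sub k)
     else concat (map (\<lambda>b. concat (map (\<lambda>Y. map (\<lambda>P. (b, Y, P)) (Sub k)) (Sub k))) (fB N)))"

definition vec_ok :: "nat \<Rightarrow> nat \<Rightarrow> gmove \<Rightarrow> gresp \<Rightarrow> nat list \<Rightarrow> nat list \<Rightarrow> bool" where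
  "vec_ok k N x y g g' \<longleftrightarrow> (\<forall>i<length (Qlist k N). \<forall>j<length (Qlist k N).
     0 < nthd g i \<and> ctr k N x y (nthd (Qlist k N) i) (nthd (Qlist k N) j) \<longrightarrow>
       0 < nthd g' j \<and> nthd g' j + of_bool (cmk x (nthd (Qlist k N) i)) \<le> nthd g i)"

definition vec_eps :: "nat \<Rightarrow> nat \<Rightarrow> nat list \<Rightarrow> bool" where
  "vec_eps k N g \<longleftrightarrow> (\<forall>i<length (Qlist k N). \<forall>j<length (Qlist k N).
     0 < nthd g i \<and> cep k N (nthd (Qlist k N) i) (nthd (Qlist k N) j) \<longrightarrow> 0 < nthd g j \<and> nthd g j \<le> nthd g i)"

definition vec_init :: "nat \<Rightarrow> nat \<Rightarrow> nat list \<Rightarrow> bool" where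
  "vec_init k N g \<longleftrightarrow> (\<forall>i<length (Qlist k N). cinit k N (nthd (Qlist k N) i) \<longrightarrow> 0 < nthd g i)"

text \<open>Budget vectors are lists indexed by positions in \<open>Qlist\<close>, and X runs
  through the families of such vectors. Entries up to \<open>bnd\<close> + 1 are tried because a
  budget is one more than a number of marks.\<close>

definition decide :: "nat \<Rightarrow> nat \<Rightarrow> bool" where
  "decide k N \<longleftrightarrow> (\<exists>X\<in>set (sublists (List.n_lists (length (Qlist k N)) [0..<bnd (length (Qlist k N)) + 2])).
     (\<exists>g\<in>set X. vec_init k N g) \<and>
     (\<forall>g\<in>set X. vec_eps k N g \<and> (\<forall>x\<in>set (Xlist k N). \<exists>y\<in>set (Ylist k N x). \<exists>g'\<in>set X. vec_ok k N x y g g')))"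

lemma d_cep [comp]: assumes "computable N" "computable q" "computable q'" shows "dec (\<lambda>x. cep k (N x) (q x) (q' x))"
  unfolding cep_def by (intro comp assms c_comp[OF assms(1)] c_comp[OF assms(2)] c_comp[OF assms(3)])

lemma d_ctick [comp]:
  assumes "computable N" "computable Z" "computable P" "computable q" "computable q'"
  shows "dec (\<lambda>x. ctick k (N x) (Z x) (P x) (q x) (q' x))"
  unfolding ctick_def
  by (intro comp assms c_comp[OF assms(1)] c_comp[OF assms(2)] c_comp[OF assms(3)] c_comp[OF assms(4)] c_comp[OF assms(5)])

lemma d_cletter [comp]:
  assumes "computable N" "computable a" "computable Z" "computable y" "computable q" "computable q'"
  shows "dec (\<lambda>x. cletter k (N x) (a x) (Z x) (y x) (q x) (q' x))"
  unfolding cletter_def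
  by (intro comp c_en assms c_comp[OF assms(1)] c_comp[OF assms(2)] c_comp[OF assms(3)] c_comp[OF assms(4)] c_comp[OF assms(5)] c_comp[OF assms(6)])

lemma d_ctr [comp]:
  assumes "computable N" "computable z" "computable y" "computable q" "computable q'"
  shows "dec (\<lambda>x. ctr k (N x) (z x) (y x) (q x) (q' x))"
  unfolding ctr_def cwatch_def by (intro comp assms)

lemma d_cmk [comp]: assumes "computable z" "computable q" shows "dec (\<lambda>x. cmk (z x) (q x))"
  unfolding cmk_def by (intro comp assms)

lemma d_cinit [comp]: assumes "computable N" "computable q" shows "dec (\<lambda>x. cinit k (N x) (q x))"
  unfolding cinit_def by (intro comp assms c_comp[OF assms(2)])

lemma c_Qlist [comp]: assumes "computable N" shows "computable (\<lambda>x. Qlist k (N x))"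
  unfolding Qlist_def by (intro comp assms c_comp[OF assms])

lemma c_Xlist [comp]: assumes "computable N" shows "computable (\<lambda>x. Xlist k (N x))"
  unfolding Xlist_def by (intro comp assms)

lemma c_Ylist [comp]: assumes "computable N" "computable z" shows "computable (\<lambda>x. Ylist k (N x) (z x))"
  unfolding Ylist_def by (intro comp assms)

lemma d_vec_ok [comp]:
  assumes "computable N" "computable z" "computable y" "computable g" "computable g'"
  shows "dec (\<lambda>x. vec_ok k (N x) (z x) (y x) (g x) (g' x))"
  unfolding vec_ok_def
  by (intro comp assms c_comp[OF assms(1)] c_comp[OF assms(2)] c_comp[OF assms(3)] c_comp[OF assms(4)] c_comp[OF assms(5)])

lemma d_vec_eps [comp]: assumes "computable N" "computable g" shows "dec (\<lambda>x. vec_eps k (N x) (g x))"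
  unfolding vec_eps_def by (intro comp assms c_comp[OF assms(1)] c_comp[OF assms(2)])

lemma d_vec_init [comp]: assumes "computable N" "computable g" shows "dec (\<lambda>x. vec_init k (N x) (g x))"
  unfolding vec_init_def by (intro comp assms c_comp[OF assms(1)] c_comp[OF assms(2)])

lemma c_bnd [comp]: "computable f \<Longrightarrow> computable (\<lambda>x. bnd (f x))"
  unfolding bnd_def by (intro comp)

lemma d_decide: "dec (decide k)"
proof -
  have "dec (\<lambda>N. decide k N)" unfolding decide_def by (intro comp)
  then show ?thesis .
qed

subsection \<open>Correctness\<close>

lemma sat_cong: "(\<And>x. x \<in> cc_clocks \<phi> \<Longrightarrow> v x = v' x) \<Longrightarrow> sat \<phi> v = sat \<phi> v'"
  by (induction \<phi>) auto

lemma reqg_req: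
  assumes D: "0 < D" and w: "\<And>x. x < K \<Longrightarrow> w x = real (nthd p x) / real D" "\<And>x. x < K \<Longrightarrow> w' x = real (nthd p' x) / real D"
  shows "reqg K c D p p' \<longleftrightarrow> req K c w w'"
proof -
  have D': "0 < real D" using D by simp
  have 1: "real a / real D < real z \<longleftrightarrow> a < z * D" "real z < real a / real D \<longleftrightarrow> z * D < a" for a z
  proof -
    have "real a / real D < real z \<longleftrightarrow> real a < real (z * D)" "real z < real a / real D \<longleftrightarrow> real (z * D) < real a"
      using D' by (simp_all add: divide_less_eq less_divide_eq)
    then show "real a / real D < real z \<longleftrightarrow> a < z * D" "real z < real a / real D \<longleftrightarrow> z * D < a" by (simp_all only: of_nat_less_iff)
  qed
  have 2: "real a / real D < real b / real D + real z \<longleftrightarrow> a < b + z * D" "real b / real D + real z < real a / real D \<longleftrightarrow> b + z * D < a" for a b z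
  proof -
    have e: "real b / real D + real z = real (b + z * D) / real D" using D' by (simp add: add_divide_distrib)
    have "real a / real D < real (b + z * D) / real D \<longleftrightarrow> real a < real (b + z * D)" "real (b + z * D) / real D < real a / real D \<longleftrightarrow> real (b + z * D) < real a"
      using D' by (simp_all only: divide_less_cancel) auto
    then show "real a / real D < real b / real D + real z \<longleftrightarrow> a < b + z * D" "real b / real D + real z < real a / real D \<longleftrightarrow> b + z * D < a"
      unfolding e by (simp_all only: of_nat_less_iff)
  qed
  have "req K c w w' \<longleftrightarrow>
     (\<forall>x<K. \<forall>z\<le>c. (nthd p x < z * D \<longleftrightarrow> nthd p' x < z * D) \<and> (z * D < nthd p x \<longleftrightarrow> z * D < nthd p' x)) \<and>
     (\<forall>x<K. \<forall>y<K. \<forall>z\<le>c. (nthd p x < nthd p y + z * D \<longleftrightarrow> nthd p' x < nthd p' y + z * D) \<and> (nthd p y + z * D < nthd p x \<longleftrightarrow> nthd p' y + z * D < nthd p' x))"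
    unfolding req_def by (simp add: w 1 2 del: of_nat_mult)
  then show ?thesis unfolding reqg_def less_Suc_eq_le by blast
qed

lemma consts_enc_cc: "z \<in> cc_consts \<phi> \<Longrightarrow> \<bar>z\<bar> \<le> int (enc_cc \<phi>)"
proof (induction \<phi>)
  have i: "\<bar>z\<bar> \<le> int (int_encode z)" for z by (auto simp: int_encode_def sum_encode_def)
  { case (Atom1 x cm u)
    have "int_encode u < enc_cc (Atom1 x cm u)" unfolding enc_cc.simps by (rule mem_list_encode) simp
    then show ?case using Atom1 i[of u] by simp
  next
    case (Atom2 x y cm u)
    have "int_encode u < enc_cc (Atom2 x y cm u)" unfolding enc_cc.simps by (rule mem_list_encode) simp
    then show ?case using Atom2 i[of u] by simp
  next
    case (CNot \<phi>)
    have "enc_cc \<phi> < enc_cc (CNot \<phi>)" unfolding enc_cc.simps by (rule mem_list_encode) simp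
    then show ?case using CNot by simp
  next
    case (CAnd \<phi> \<psi>)
    have "enc_cc \<phi> < enc_cc (CAnd \<phi> \<psi>)" "enc_cc \<psi> < enc_cc (CAnd \<phi> \<psi>)" unfolding enc_cc.simps by (rule mem_list_encode, simp)+
    then show ?case using CAnd by fastforce
  next
    case (COr \<phi> \<psi>)
    have "enc_cc \<phi> < enc_cc (COr \<phi> \<psi>)" "enc_cc \<psi> < enc_cc (COr \<phi> \<psi>)" unfolding enc_cc.simps by (rule mem_list_encode, simp)+
    then show ?case using COr by fastforce }
qed simp

section \<open>Agreement of the coded game with the tick game\<close>

locale instance_code =
  fixes A B :: "nat list" and T :: ta and k N :: nat
  assumes wfT: "wf_ta A B T" and N: "N = enc_instance (A, B, T)"
begin

lemma fields: "fA N = A" "fB N = B" "fT N 2 = inits T" "fT N 3 = finals T" "fT N 4 = map enc_rule (rules T)"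
  unfolding N enc_instance_def fA_def fB_def fT_def enc_ta_def by (simp_all add: nthd_def)

lemma rule_fields: "rl (enc_rule r) 0 = r_src r" "rl (enc_rule r) 1 = enc_lab (r_lab r)" "rl (enc_rule r) 2 = enc_cc (r_guard r)"
  "list_decode (rl (enc_rule r) 3) = r_resets r" "rl (enc_rule r) 4 = r_tgt r"
  unfolding enc_rule_def rl_def by (simp_all add: nthd_def)

lemma enc_ta_less: "enc_ta T < N"
  unfolding N enc_instance_def by (auto intro!: mem_list_encode simp del: list_encode.simps)

sublocale synth_game A B T k "Suc N"
proof
  show "wf_ta A B T" using wfT .
  show "1 \<le> Suc N" by simp
  show "x < Suc N" if "x \<in> set (clks T)" for x
  proof -
    have "x < list_encode (clks T)" using mem_list_encode that .
    also have "\<dots> < enc_ta T" unfolding enc_ta_def by (rule mem_list_encode) simp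
    finally show ?thesis using enc_ta_less by simp
  qed
  show "l < Suc N" if "l \<in> set (locs T)" for l
  proof -
    have "l < list_encode (locs T)" using mem_list_encode that .
    also have "\<dots> < enc_ta T" unfolding enc_ta_def by (rule mem_list_encode) simp
    finally show ?thesis using enc_ta_less by simp
  qed
  show "\<bar>z\<bar> \<le> int (Suc N)" if r: "r \<in> set (rules T)" "z \<in> cc_consts (r_guard r)" for r z
  proof -
    have "enc_cc (r_guard r) < enc_rule r" unfolding enc_rule_def by (rule mem_list_encode) simp
    also have "\<dots> < list_encode (map enc_rule (rules T))" by (rule mem_list_encode) (use r in simp)
    also have "\<dots> < enc_ta T" unfolding enc_ta_def by (rule mem_list_encode) simp
    finally show ?thesis using enc_ta_less consts_enc_cc[OF r(2)] by simp
  qed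
qed

lemma KD: "KK k N = K" "DD k N = D" "0 < D"
  unfolding KK_def DD_def K_def D_def by simp_all

lemma elapse_grid: "length p = K \<Longrightarrow> x < K \<Longrightarrow> rv D p x + real e / real D = real (nthd (elp e p) x) / real D"
  unfolding rv_def elp_def nthd_def by (simp add: add_divide_distrib)

lemma stp_code:
  assumes p: "length p = K" "length p' = K" and P: "\<And>e. P (\<lambda>x. rv D p x + real e / real D) \<longleftrightarrow> P' e"
  shows "stp P (set R) p p' \<longleftrightarrow> (\<exists>e<Suc (D * (Suc N + 1)). P' e \<and> reqg K (Suc N) D p' (rsl K R (elp e p)))"
proof -
  have "reqg K (Suc N) D p' (rsl K R (elp e p)) \<longleftrightarrow> req K (Suc N) (rv D p') (rst (set R) (\<lambda>x. rv D p x + real e / real D))" for e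
  proof (rule reqg_req[OF KD(3)])
    show "rv D p' x = real (nthd p' x) / real D" if "x < K" for x using that p unfolding rv_def nthd_def by simp
    show "rst (set R) (\<lambda>x. rv D p x + real e / real D) x = real (nthd (rsl K R (elp e p)) x) / real D" if "x < K" for x
      using elapse_grid[OF p(1) that] that unfolding rst_def rsl_def by (simp add: nthd_def)
  qed
  then show ?thesis unfolding stp_def P less_Suc_eq_le by simp
qed

lemma gP_code:
  assumes "r \<in> set (rules T)" "length p = K"
  shows "gP r (\<lambda>x. rv D p x + real e / real D) \<longleftrightarrow> gsat k D (elp e p) (enc_cc (r_guard r))"
  unfolding gsat[OF KD(3)] gP_def
proof (rule sat_cong)
  fix x assume "x \<in> cc_clocks (r_guard r)"
  then have "x \<in> set (clks T)" using assms(1) wfT unfolding wf_ta_def by blast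
  then have "k + x < K" using clk unfolding K_def by simp
  then show "rv D p (k + x) + real e / real D = real (nthd (elp e p) (k + x)) / real D" using elapse_grid[OF assms(2)] by blast
qed

lemma cell_code:
  assumes "length p = K" "x < k"
  shows "rv D p x + real e / real D \<le> 1 \<longleftrightarrow> nthd (elp e p) x \<le> D" "rv D p x + real e / real D = 1 \<longleftrightarrow> nthd (elp e p) x = D"
    "rv D p x + real e / real D < 1 \<longleftrightarrow> nthd (elp e p) x < D" "rv D p x + real e / real D = 0 \<longleftrightarrow> nthd (elp e p) x = 0"
proof -
  have "x < K" using assms(2) unfolding K_def by simp
  from elapse_grid[OF assms(1) this, of e] KD(3)
  show "rv D p x + real e / real D \<le> 1 \<longleftrightarrow> nthd (elp e p) x \<le> D" "rv D p x + real e / real D = 1 \<longleftrightarrow> nthd (elp e p) x = D"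
    "rv D p x + real e / real D < 1 \<longleftrightarrow> nthd (elp e p) x < D" "rv D p x + real e / real D = 0 \<longleftrightarrow> nthd (elp e p) x = 0"
    by auto
qed

lemma tP_code:
  assumes "length p = K" "Act \<subseteq> {..<k}" "Z \<subseteq> {..<k}"
  shows "tP Act Z (\<lambda>x. rv D p x + real e / real D) \<longleftrightarrow>
    (\<forall>x<k. (x \<in> Act \<longrightarrow> nthd (elp e p) x \<le> D) \<and> (x \<in> Z \<longleftrightarrow> x \<in> Act \<and> nthd (elp e p) x = D))"
  unfolding tP_def using cell_code[OF assms(1)] assms(2,3) by (auto simp: set_eq_iff subset_iff)

lemma lP_code:
  assumes "length p = K" "Act \<subseteq> {..<k}" "Z \<subseteq> {..<k}"
  shows "lP Act Z (\<lambda>x. rv D p x + real e / real D) \<longleftrightarrow>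
    (\<forall>x<k. (x \<in> Act \<longrightarrow> nthd (elp e p) x < D) \<and> (x \<in> Z \<longleftrightarrow> x \<in> Act \<and> nthd (elp e p) x = 0))"
  unfolding lP_def using cell_code[OF assms(1)] assms(2,3) by (auto simp: set_eq_iff subset_iff)

lemma cep_iff: assumes q: "q \<in> Qs" "q' \<in> Qs" shows "cep k N q q' \<longleftrightarrow> ep q q'"
proof (cases "tg q = 0 \<and> tg q' = 0")
  case True
  have l: "length (vl q) = K" "length (vl q') = K" using Qs_T q True by blast+
  have s: "stp (gP r) (rR r) (vl q) (vl q') \<longleftrightarrow> (\<exists>e<Suc (D * (Suc N + 1)). gsat k D (elp e (vl q)) (enc_cc (r_guard r)) \<and>
      reqg K (Suc N) D (vl q') (rsl K (map (\<lambda>x. k + x) (r_resets r)) (elp e (vl q))))" if "r \<in> set (rules T)" for r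
  proof -
    have "rR r = set (map (\<lambda>x. k + x) (r_resets r))" unfolding rR_def by simp
    then show ?thesis
      using stp_code[OF l, of "gP r" "\<lambda>e. gsat k D (elp e (vl q)) (enc_cc (r_guard r))" "map (\<lambda>x. k + x) (r_resets r)"] gP_code[OF that l(1)]
      by (simp only:)
  qed
  have lab: "enc_lab l = 0 \<longleftrightarrow> l = None" for l by (cases l) (auto simp: enc_lab_def)
  show ?thesis unfolding cep_def ep_def KD fields using q True s by (auto simp: rule_fields rule_fields(2)[unfolded One_nat_def] lab)
qed (use q in \<open>auto simp: cep_def ep_def\<close>)

lemma set_less_iff: "S \<subseteq> {..<k} \<Longrightarrow> S = S' \<longleftrightarrow> S' \<subseteq> {..<k} \<and> (\<forall>x<k. x \<in> S \<longleftrightarrow> x \<in> S')"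
  by (auto simp: set_eq_iff)

lemma ctr_iff:
  assumes q: "q \<in> Qs" "q' \<in> Qs" and x: "x \<in> Xm" and y: "y \<in> Yr x"
  shows "ctr k N x y q q' \<longleftrightarrow> tr x y q q'"
proof (cases "tg q = 0 \<and> tg q' = 0")
  case True
  have l: "length (vl q) = K" "length (vl q') = K" "set (ac q) \<subseteq> {..<k}" "set (ac q') \<subseteq> {..<k}" using Qs_T q True by blast+
  have Z: "set (snd x) \<subseteq> {..<k}" using x Sub_D unfolding Xm_def by blast
  have PY: "set (snd (snd y)) \<subseteq> {..<k}" "set (fst (snd y)) \<subseteq> {..<k}"
    using y Sub_D unfolding Yr_def by (auto split: if_splits simp: mem_Times_iff)
  have t: "ctick k N (snd x) (snd (snd y)) q q' \<longleftrightarrow> tr_tick (snd x) (snd (snd y)) q q'"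
  proof -
    have "set (ac q') = set (ac q) \<inter> set (snd (snd y)) \<longleftrightarrow> (\<forall>z<k. z \<in> set (ac q') \<longleftrightarrow> z \<in> set (ac q) \<and> z \<in> set (snd (snd y)))"
      using set_less_iff[OF l(4), of "set (ac q) \<inter> set (snd (snd y))"] l(3) by auto
    moreover have "stp (tP (set (ac q)) (set (snd x))) (set (snd x)) (vl q) (vl q') \<longleftrightarrow>
        (\<exists>e<Suc (D * (Suc N + 1)). (\<forall>z<k. (z \<in> set (ac q) \<longrightarrow> nthd (elp e (vl q)) z \<le> D) \<and> (z \<in> set (snd x) \<longleftrightarrow> z \<in> set (ac q) \<and> nthd (elp e (vl q)) z = D)) \<and>
          reqg K (Suc N) D (vl q') (rsl K (snd x) (elp e (vl q))))"
      by (rule stp_code[OF l(1,2)]) (rule tP_code[OF l(1,3) Z])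
    ultimately show ?thesis unfolding ctick_def tr_tick_def KD using True by (simp only:)
  qed
  have lt: "cletter k N a (snd x) y q q' \<longleftrightarrow> tr_letter a (snd x) y q q'" for a
  proof -
    have 1: "set (ac q') = set (snd (snd y)) \<inter> (set (ac q) \<union> set (fst (snd y))) \<longleftrightarrow>
        (\<forall>z<k. z \<in> set (ac q') \<longleftrightarrow> z \<in> set (snd (snd y)) \<and> (z \<in> set (ac q) \<or> z \<in> set (fst (snd y))))"
      using set_less_iff[OF l(4), of "set (snd (snd y)) \<inter> (set (ac q) \<union> set (fst (snd y)))"] PY by auto
    have s: "stp (\<lambda>w. gP r w \<and> lP (set (ac q)) (set (snd x)) w) (set (fst (snd y)) \<union> rR r) (vl q) (vl q') \<longleftrightarrow>
       (\<exists>e<Suc (D * (Suc N + 1)). gsat k D (elp e (vl q)) (enc_cc (r_guard r)) \<and>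
          (\<forall>z<k. (z \<in> set (ac q) \<longrightarrow> nthd (elp e (vl q)) z < D) \<and> (z \<in> set (snd x) \<longleftrightarrow> z \<in> set (ac q) \<and> nthd (elp e (vl q)) z = 0)) \<and>
          reqg K (Suc N) D (vl q') (rsl K (fst (snd y) @ map (\<lambda>z. k + z) (r_resets r)) (elp e (vl q))))" if r: "r \<in> set (rules T)" for r
    proof -
      have "set (fst (snd y)) \<union> rR r = set (fst (snd y) @ map (\<lambda>z. k + z) (r_resets r))" unfolding rR_def by simp
      then show ?thesis using stp_code[OF l(1,2), of "\<lambda>w. gP r w \<and> lP (set (ac q)) (set (snd x)) w"
            "\<lambda>e. gsat k D (elp e (vl q)) (enc_cc (r_guard r)) \<and> (\<forall>z<k. (z \<in> set (ac q) \<longrightarrow> nthd (elp e (vl q)) z < D) \<and> (z \<in> set (snd x) \<longleftrightarrow> z \<in> set (ac q) \<and> nthd (elp e (vl q)) z = 0))"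
            "fst (snd y) @ map (\<lambda>z. k + z) (r_resets r)"]
          gP_code[OF r l(1)] lP_code[OF l(1,3) Z] by (simp only: conj_assoc)
    qed
    have lab: "enc_lab l = Suc (en (a, b)) \<longleftrightarrow> l = Some (a, b)" for l b
      by (cases l) (auto simp: enc_lab_def en_prod_def en_nat_def)
    show ?thesis unfolding cletter_def tr_letter_def KD fields 1 using True s
      by (auto simp: rule_fields rule_fields(2)[unfolded One_nat_def] lab)
  qed
  show ?thesis unfolding ctr_def tr_def using q True t lt unfolding cwatch_def tr_watch_def by simp
next
  case False
  then show ?thesis using q unfolding ctr_def tr_def ctick_def tr_tick_def cletter_def tr_letter_def cwatch_def tr_watch_def by blast
qed

lemma cmk_eq: "cmk = mk"
  unfolding cmk_def mk_def by (intro ext) simp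

lemma cinit_iff: assumes "q \<in> Qs" shows "cinit k N q \<longleftrightarrow> q \<in> Init"
proof (cases "tg q = 0")
  case True
  have l: "length (vl q) = K" "set (ac q) \<subseteq> {..<k}" using Qs_T assms True by blast+
  have "(\<forall>v\<in>set (vl q). v = 0) \<longleftrightarrow> vl q = replicate K 0" using l(1) by (auto simp: replicate_eqI)
  moreover have "(\<forall>x<k. x \<in> set (ac q)) \<longleftrightarrow> set (ac q) = {..<k}" using l(2) by auto
  ultimately show ?thesis unfolding cinit_def Init_def fields using assms True by simp
qed (use assms in \<open>simp add: cinit_def Init_def\<close>)

lemma set_Qlist: "set (Qlist k N) = Qs"
proof -
  define M where "M = K * ((Suc N + 1) * D)"
  have p: "set p \<subseteq> set [0..<Suc M] \<longleftrightarrow> (\<forall>x<K. p ! x \<le> M)" if "length p = K" for p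
    using that by (auto simp: in_set_conv_nth subset_iff less_Suc_eq_le simp del: upt_Suc)
  have "set (Qlist k N) = {(0, l, a, p, b) | l a p b. l < Suc N \<and> a \<in> set (Sub k) \<and> length p = K \<and> set p \<subseteq> set [0..<Suc M] \<and> b < 2} \<union> watch ` {..k}"
    unfolding Qlist_def KD M_def[symmetric] watch_def
    by (auto simp: set_n_lists less_2_cases_iff atLeast0LessThan lessThan_Suc_atMost simp del: upt_Suc)
  also have "\<dots> = Qs"
    unfolding Qs_def M_def[symmetric] using p by (auto simp: image_iff simp del: upt_Suc)
  finally show ?thesis .
qed

lemma set_Xlist: "set (Xlist k N) = Xm"
proof -
  have "x \<in> set (Xlist k N) \<longleftrightarrow> x \<in> Xm" for x
    unfolding Xlist_def Xm_def fields by (cases x; cases "fst x") auto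
  then show ?thesis by blast
qed

lemma set_Ylist: "set (Ylist k N x) = Yr x"
  unfolding Ylist_def Yr_def fields by auto

abbreviation "nQ \<equiv> length (Qlist k N)"

lemma Qn: "i < nQ \<Longrightarrow> nthd (Qlist k N) i \<in> Qs"
  using set_Qlist nth_mem unfolding nthd_def by fastforce

text \<open>A list becomes a budget function through some position \<open>ix q\<close> of each
  state. Its entries are bounded by \<open>bnd nQ + 2\<close>, so
  \<open>family_imp_controller\<close> gives a controller with m =
  \<open>bnd nQ + 3\<close>.\<close>

lemma decide_sound: assumes "decide k N" shows "\<exists>m. has_winning_controller A B (ta_lang T) k m"
proof -
  obtain X where X: "X \<in> set (sublists (List.n_lists nQ [0..<bnd nQ + 2]))" "\<exists>g\<in>set X. vec_init k N g"
    "\<And>g. g \<in> set X \<Longrightarrow> vec_eps k N g" "\<And>g x. g \<in> set X \<Longrightarrow> x \<in> Xm \<Longrightarrow> \<exists>y\<in>Yr x. \<exists>g'\<in>set X. vec_ok k N x y g g'"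
    using assms unfolding decide_def set_Xlist set_Ylist by blast
  have "set X \<in> set ` set (sublists (List.n_lists nQ [0..<bnd nQ + 2]))" using X(1) by (rule imageI)
  then have "set X \<subseteq> set (List.n_lists nQ [0..<bnd nQ + 2])" unfolding set_sublists by blast
  then have bd: "length g = nQ \<and> (\<forall>v\<in>set g. v < bnd nQ + 2)" if "g \<in> set X" for g
    using that by (fastforce simp: set_n_lists)
  have "\<exists>i<nQ. nthd (Qlist k N) i = q" if "q \<in> Qs" for q
    using that unfolding set_Qlist[symmetric] in_set_conv_nth nthd_def by auto
  then obtain ix where ix: "\<And>q. q \<in> Qs \<Longrightarrow> ix q < nQ \<and> nthd (Qlist k N) (ix q) = q" by metis
  define h where "h g q = (if q \<in> Qs then nthd g (ix q) else 0)" for g :: "nat list" and q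
  define G where "G = h ` set X"
  have eps: "bg.eps_ok (h g)" if g: "g \<in> set X" for g
    unfolding bg.eps_ok_def
  proof (intro allI impI)
    fix q q' assume a: "0 < h g q \<and> ep q q'"
    then have Q: "q \<in> Qs" "q' \<in> Qs" unfolding ep_def by auto
    then have "cep k N q q'" using a cep_iff[OF Q] by simp
    then show "0 < h g q' \<and> h g q' \<le> h g q"
      using X(3)[OF g, unfolded vec_eps_def, rule_format, of "ix q" "ix q'"] a ix[OF Q(1)] ix[OF Q(2)] Q by (simp add: h_def)
  qed
  have mv: "bg.move_ok (h g) x y (h g')" if "vec_ok k N x y g g'" "x \<in> Xm" "y \<in> Yr x" for x y g g'
    unfolding bg.move_ok_def
  proof (intro allI impI)
    fix q q' assume a: "0 < h g q \<and> tr x y q q'"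
    then have Q: "q \<in> Qs" "q' \<in> Qs" unfolding tr_def by auto
    then have "ctr k N x y q q'" using a ctr_iff[OF Q that(2,3)] by simp
    then show "0 < h g' q' \<and> h g' q' + of_bool (mk x q) \<le> h g q"
      using that(1)[unfolded vec_ok_def cmk_eq, rule_format, of "ix q" "ix q'"] a ix[OF Q(1)] ix[OF Q(2)] Q by (simp add: h_def)
  qed
  have "\<exists>y g'. g \<in> G \<longrightarrow> x \<in> Xm \<longrightarrow> y \<in> Yr x \<and> g' \<in> G \<and> bg.move_ok g x y g'" for g x
  proof (cases "g \<in> G \<and> x \<in> Xm")
    case True
    then obtain u where u: "u \<in> set X" "g = h u" unfolding G_def by blast
    then obtain y u' where y: "y \<in> Yr x" "u' \<in> set X" "vec_ok k N x y u u'" using X(4) True by blast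
    then have "y \<in> Yr x \<and> h u' \<in> G \<and> bg.move_ok g x y (h u')" using mv[OF y(3) _ y(1)] True u(2) unfolding G_def by simp
    then show ?thesis by blast
  qed blast
  then obtain yx gx where yg: "\<And>g x. g \<in> G \<Longrightarrow> x \<in> Xm \<Longrightarrow> yx g x \<in> Yr x \<and> gx g x \<in> G \<and> bg.move_ok g x (yx g x) (gx g x)" by metis
  obtain u0 where u0: "u0 \<in> set X" "vec_init k N u0" using X(2) by blast
  have i0: "0 < h u0 q" if q: "q \<in> Init" for q
  proof -
    have Q: "q \<in> Qs" using q unfolding Init_def by blast
    then have "cinit k N q" using cinit_iff q by blast
    then show ?thesis using u0(2)[unfolded vec_init_def, rule_format, of "ix q"] ix[OF Q] Q by (simp add: h_def)
  qed
  have hb: "h g q \<le> bnd nQ + 2" if g: "g \<in> set X" for g q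
  proof (cases "q \<in> Qs")
    case True
    then have "nthd g (ix q) \<in> set g" using ix[OF True] bd[OF g] unfolding nthd_def by simp
    then show ?thesis using bd[OF g] True unfolding h_def by (auto intro: less_imp_le)
  qed (simp add: h_def)
  interpret winning_family A B T k "Suc N" G "bnd nQ + 2" yx gx "h u0"
  proof
    show "bg.eps_ok g" if "g \<in> G" for g using that eps unfolding G_def by blast
    show "g q \<le> bnd nQ + 2" if "g \<in> G" for g q using that hb unfolding G_def by blast
    show "g q = 0" if "g \<in> G" "q \<notin> Qs" for g q using that unfolding G_def h_def by auto
    show "h u0 \<in> G" using u0(1) unfolding G_def by blast
  qed (use yg i0 in blast)+
  show ?thesis using family_imp_controller by blast
qed

lemma decide_complete: assumes "has_winning_controller A B (ta_lang T) k m" shows "decide k N"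
proof -
  obtain L l0 \<delta> where win: "winning_controller A B (ta_lang T) k m L l0 \<delta>" using assms unfolding has_winning_controller_def by blast
  interpret winning_ctrl A B T k "Suc N" m L l0 \<delta> by standard (use win in blast)
  obtain G0 g0 where G0: "bg.closed_fam G0" "g0 \<in> G0" "\<And>q. q \<in> Init \<Longrightarrow> 0 < g0 q" using controller_imp_family by blast
  have "Init \<subseteq> Qs" unfolding Init_def by blast
  from bg.bounded_family[OF G0(1,2) this G0(3)] obtain G where G: "bg.closed_fam G" "\<exists>g\<in>G. \<forall>q\<in>Init. 0 < g q"
    "\<And>g q. g \<in> G \<Longrightarrow> g q \<le> Suc (bnd (card Qs))" by blast
  \<comment> \<open>The search uses the length of the enumeration instead of the number of states;
    monotonicity of \<open>bnd\<close> makes its range large enough.\<close>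
  have "card Qs \<le> nQ" unfolding set_Qlist[symmetric] by (rule card_length)
  then have gb: "g q < bnd nQ + 2" if "g \<in> G" for g q using G(3)[OF that, of q] bnd_mono[of "card Qs" nQ] by linarith
  define vec where "vec g = map g (Qlist k N)" for g :: "gstate \<Rightarrow> nat"
  have nv: "nthd (vec g) i = g (nthd (Qlist k N) i)" if "i < nQ" for g i using that unfolding vec_def nthd_def by simp
  have "vec g \<in> set (List.n_lists nQ [0..<bnd nQ + 2])" if g: "g \<in> G" for g
    using gb[OF g] unfolding vec_def set_n_lists by (auto simp del: upt_Suc add_2_eq_Suc')
  then have "vec ` G \<subseteq> set (List.n_lists nQ [0..<bnd nQ + 2])" by blast
  then obtain X where X: "X \<in> set (sublists (List.n_lists nQ [0..<bnd nQ + 2]))" "set X = vec ` G"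
    using set_sublists[of "List.n_lists nQ [0..<bnd nQ + 2]"] by (metis (no_types, lifting) PowI image_iff)
  have "vec_init k N (vec g)" if "\<forall>q\<in>Init. 0 < g q" for g
    using that cinit_iff Qn unfolding vec_init_def by (simp add: nv)
  then have 1: "\<exists>g\<in>set X. vec_init k N g" using G(2) X(2) by blast
  have 2: "vec_eps k N (vec g)" if "g \<in> G" for g
  proof -
    have "bg.eps_ok g" using G(1) that unfolding bg.closed_fam_def by blast
    note ok = this[unfolded bg.eps_ok_def, rule_format]
    show ?thesis unfolding vec_eps_def
    proof (intro allI impI)
      fix i j assume "i < nQ" "j < nQ" and a: "0 < nthd (vec g) i \<and> cep k N (nthd (Qlist k N) i) (nthd (Qlist k N) j)"
      then show "0 < nthd (vec g) j \<and> nthd (vec g) j \<le> nthd (vec g) i"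
        using ok[of "nthd (Qlist k N) i" "nthd (Qlist k N) j"] cep_iff[OF Qn Qn, of i j] by (simp add: nv)
    qed
  qed
  have 3: "\<exists>y\<in>Yr x. \<exists>g'\<in>set X. vec_ok k N x y (vec g) g'" if g: "g \<in> G" and x: "x \<in> Xm" for g x
  proof -
    obtain y g' where y: "y \<in> Yr x" "g' \<in> G" "bg.move_ok g x y g'" using G(1) g x unfolding bg.closed_fam_def by blast
    have "vec_ok k N x y (vec g) (vec g')"
      unfolding vec_ok_def cmk_eq
    proof (intro allI impI)
      fix i j assume "i < nQ" "j < nQ" and a: "0 < nthd (vec g) i \<and> ctr k N x y (nthd (Qlist k N) i) (nthd (Qlist k N) j)"
      then show "0 < nthd (vec g') j \<and> nthd (vec g') j + of_bool (mk x (nthd (Qlist k N) i)) \<le> nthd (vec g) i"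
        using y(3)[unfolded bg.move_ok_def, rule_format, of "nthd (Qlist k N) i" "nthd (Qlist k N) j"] ctr_iff[OF Qn Qn x y(1), of i j] by (simp add: nv)
    qed
    then show ?thesis using y X(2) by blast
  qed
  show ?thesis unfolding decide_def set_Xlist set_Ylist
  proof (rule bexI[OF _ X(1)], intro conjI ballI)
    show "\<exists>g\<in>set X. vec_init k N g" by (rule 1)
    fix g assume "g \<in> set X"
    then obtain u where u: "u \<in> G" "g = vec u" using X(2) by blast
    show "vec_eps k N g" using 2[OF u(1)] u(2) by simp
    show "\<exists>y\<in>Yr x. \<exists>g'\<in>set X. vec_ok k N x y g g'" if "x \<in> Xm" for x using 3[OF u(1) that] u(2) by simp
  qed
qed

end

theorem theorem3:
  fixes k :: nat
  shows "decidable_on enc_instance valid_instance (synth_problem k)"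
proof -
  obtain f where f: "\<And>n. reval f [n] (if decide k n then 1 else 0)" using dec_imp_reval[OF d_decide] by blast
  have "decide k (enc_instance I) \<longleftrightarrow> synth_problem k I" if "valid_instance I" for I
  proof -
    obtain A B T where I: "I = (A, B, T)" by (cases I)
    then interpret instance_code A B T k "enc_instance I" using that by unfold_locales (auto simp: valid_instance_def)
    show ?thesis using decide_sound decide_complete unfolding synth_problem_def I by auto
  qed
  then show ?thesis unfolding decidable_on_def using f by metis
qed

end
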